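(* Let $F(z)=a_nz^n+\dots+a_1z+a_0$ be a complex polynomial of degree $n$ ($a_n\neq 0$) with $n$ even, and let $k_F$ be the associated birational map of $\mathbb{P}^2$. Case 1: If $a_0\neq \frac{2}{1+m}$ for all integers $m\ge 0$, then $\delta(k_F)$ is the largest root of $x^2-(n+1)x-1$. Case 2: If $a_0=\frac{2}{1+m}$ for some integer $m\ge 0$, then $\delta(k_F)$ is the largest real root of the polynomial $x^{2m+1}\left(x^2-(n+1)x-1\right)+x^2+n$.
   Context: For a complex polynomial $F$, the birational map $k_F:\mathbb{P}^2\dashrightarrow\mathbb{P}^2$ (complex projective plane with coordinates $[x_0:x_1:x_2]$, affine chart $(x,y)=(x_1/x_0,x_2/x_0)$) is $k_F=j_F\circ i$, where $j_F(x,y)=(-x+F(y),\,y)$ and $i(x,y)=\left(1-x-\frac{x-1}{y},\,-y-1-\frac{y}{x-1}\right)$ are birational involutions. The degree complexity of a birational map $k$ of $\mathbb{P}^2$ is $\delta(k)=\lim_{p\to\infty}(\deg k^p)^{1/p}$, where $\deg k^p$ is the common degree of the homogeneous polynomials without common factor that define $k^p$.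
   Formalization: The degree n is assumed positive (so n ≥ 2); for constant F (n = 0) the claim fails as stated, e.g. for F = 3/4, where Case 1 would give the golden ratio but δ(k_F) is different. *)

theory Defs
  imports
    Complex_Main
    "HOL-Computational_Algebra.Computational_Algebra"
    "HOL-Computational_Algebra.Field_as_Ring"
begin

text \<open>
  Polynomials in several variables are iterated univariate ones, the innermost variable being
  the first: the coefficient of \<open>x\<^sup>i y\<^sup>j\<close> in \<open>A :: cpoly2\<close> is \<open>coeff (coeff A j) i\<close>, and the
  coefficient of \<open>x\<^sub>0\<^sup>i x\<^sub>1\<^sup>j x\<^sub>2\<^sup>k\<close> in \<open>P :: cpoly3\<close> is \<open>coeff (coeff (coeff P k) j) i\<close>.

  A rational self-map of the projective plane (whose image is not contained in the line at
  infinity \<open>x\<^sub>0 = 0\<close>) is given by its two components in the affine chart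
  \<open>(x, y) = (x\<^sub>1/x\<^sub>0, x\<^sub>2/x\<^sub>0)\<close>, that is, by a pair of elements of the field \<open>\<complex>(x, y)\<close>.
\<close>

type_synonym cpoly2 = "complex poly poly"
type_synonym cpoly3 = "complex poly poly poly"
type_synonym ratfun = "cpoly2 fract"
type_synonym ratmap = "ratfun \<times> ratfun"

definition const_rf :: "complex \<Rightarrow> ratfun" where
  "const_rf c = to_fract [:[:c:]:]"

definition X_rf :: ratfun where
  "X_rf = to_fract [:[:0, 1:]:]"

definition Y_rf :: ratfun where
  "Y_rf = to_fract [:0, 1:]"

definition eval2 :: "cpoly2 \<Rightarrow> ratmap \<Rightarrow> ratfun" where
  "eval2 A h = poly (map_poly (\<lambda>a. poly (map_poly const_rf a) (fst h)) A) (snd h)"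

text \<open>
  Substitution of \<open>h\<close> into a reduced fraction. The denominator can become zero only if the
  image of \<open>h\<close> is not dense; birational maps and their compositions never meet that case.
\<close>

definition rat_subst :: "ratfun \<Rightarrow> ratmap \<Rightarrow> ratfun" where
  "rat_subst r h = eval2 (fst (quot_of_fract r)) h / eval2 (snd (quot_of_fract r)) h"

definition rat_id :: ratmap where
  "rat_id = (X_rf, Y_rf)"

definition rat_comp :: "ratmap \<Rightarrow> ratmap \<Rightarrow> ratmap" (infixl "\<circ>\<^sub>r" 55) where
  "g \<circ>\<^sub>r h = (rat_subst (fst g) h, rat_subst (snd g) h)"

definition rat_iterate :: "ratmap \<Rightarrow> nat \<Rightarrow> ratmap" where
  "rat_iterate k p = ((\<lambda>h. k \<circ>\<^sub>r h) ^^ p) rat_id"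

definition homogeneous3 :: "nat \<Rightarrow> cpoly3 \<Rightarrow> bool" where
  "homogeneous3 d P \<longleftrightarrow> (\<forall>i j k. coeff (coeff (coeff P k) j) i \<noteq> 0 \<longrightarrow> i + j + k = d)"

text \<open>The polynomial \<open>P(1, x, y)\<close>.\<close>

definition dehomogenize :: "cpoly3 \<Rightarrow> cpoly2" where
  "dehomogenize P = map_poly (map_poly (\<lambda>a. poly a 1)) P"

text \<open>
  The homogeneous polynomials \<open>P\<^sub>0\<close>, \<open>P\<^sub>1\<close>, \<open>P\<^sub>2\<close> of degree \<open>d\<close> have no common factor, and the map
  \<open>[P\<^sub>0 : P\<^sub>1 : P\<^sub>2]\<close> is \<open>h\<close> in the affine chart.
\<close>

definition reduced_form :: "nat \<Rightarrow> cpoly3 \<Rightarrow> cpoly3 \<Rightarrow> cpoly3 \<Rightarrow> ratmap \<Rightarrow> bool" where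
  "reduced_form d P\<^sub>0 P\<^sub>1 P\<^sub>2 h \<longleftrightarrow>
     homogeneous3 d P\<^sub>0 \<and> homogeneous3 d P\<^sub>1 \<and> homogeneous3 d P\<^sub>2 \<and>
     (\<forall>Q. Q dvd P\<^sub>0 \<and> Q dvd P\<^sub>1 \<and> Q dvd P\<^sub>2 \<longrightarrow> is_unit Q) \<and>
     dehomogenize P\<^sub>0 \<noteq> 0 \<and>
     fst h = to_fract (dehomogenize P\<^sub>1) / to_fract (dehomogenize P\<^sub>0) \<and>
     snd h = to_fract (dehomogenize P\<^sub>2) / to_fract (dehomogenize P\<^sub>0)"

text \<open>Every \<open>h\<close> has a reduced form, unique up to a common nonzero constant, so \<open>d\<close> is unique.\<close>

definition rat_degree :: "ratmap \<Rightarrow> nat" where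
  "rat_degree h = (THE d. \<exists>P\<^sub>0 P\<^sub>1 P\<^sub>2. reduced_form d P\<^sub>0 P\<^sub>1 P\<^sub>2 h)"

definition has_degree_complexity :: "ratmap \<Rightarrow> real \<Rightarrow> bool" where
  "has_degree_complexity k \<delta> \<longleftrightarrow>
     (\<lambda>p. root p (real (rat_degree (rat_iterate k p)))) \<longlonglongrightarrow> \<delta>"

definition j_map :: "complex poly \<Rightarrow> ratmap" where
  "j_map F = (- X_rf + poly (map_poly const_rf F) Y_rf, Y_rf)"

definition i_map :: ratmap where
  "i_map = (1 - X_rf - (X_rf - 1) / Y_rf, - Y_rf - 1 - Y_rf / (X_rf - 1))"

definition k_map :: "complex poly \<Rightarrow> ratmap" where
  "k_map F = j_map F \<circ>\<^sub>r i_map"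

definition is_largest_root :: "(real \<Rightarrow> real) \<Rightarrow> real \<Rightarrow> bool" where
  "is_largest_root f r \<longleftrightarrow> f r = 0 \<and> (\<forall>s. f s = 0 \<longrightarrow> s \<le> r)"

end

theory Submission
  imports Defs
begin

text \<open>
  In the coordinate \<open>u = x - 1\<close> the map \<open>k_F\<close> sends \<open>(u, y)\<close> to \<open>(u', y')\<close> with
  \<open>y' = - s / u\<close> and \<open>u' = s / y - 2 + F(y')\<close>, where \<open>s = u y + u + y\<close>. Let
  \<open>(u\<^sub>p, y\<^sub>p)\<close> be the \<open>p\<close>-th iterate and write it as \<open>(U / W, Y / W)\<close> with \<open>W\<close>, \<open>U\<close>, \<open>Y\<close> homogeneous
  of the same degree \<open>d\<^sub>p\<close> and without common factor. For a homogeneous polynomial the degree is the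
  sum of \<open>deg D\<close> times the multiplicity of \<open>D\<close>, taken over the prime polynomials \<open>D\<close>. Hence every
  relation between multiplicities that holds along all \<open>D\<close> gives a relation between degrees, and
  the degree growth can be found by following the valuations of \<open>u\<^sub>p\<close> and \<open>y\<^sub>p\<close> along one \<open>D\<close> at a
  time. A curve that an iterate contracts to a point of the affine plane appears here as a
  discrete valuation along which the residues of \<open>u\<^sub>p\<close> and \<open>y\<^sub>p\<close> are complex numbers.

  Along a fixed \<open>D\<close> the pair \<open>(u\<^sub>p, y\<^sub>p)\<close> moves between few states. It is generic while both are
  integral and \<open>y\<^sub>p\<close> is a unit. If \<open>u\<^sub>p\<close> vanishes to order \<open>j\<close>, then \<open>y\<close> gets a pole
  of order \<open>j\<close> and \<open>u\<close> a pole of order \<open>n j\<close>; since \<open>n\<close> is even, the leading terms of the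
  values \<open>F(y)\<close> add up in all later steps and the poles stay forever. If \<open>s\<close> vanishes to order \<open>j\<close>,
  then \<open>y\<close> vanishes to order \<open>j\<close> and \<open>u\<close> has residue \<open>a\<^sub>0 - 2\<close>; the next step is a pole of
  \<open>u\<close> of order \<open>j\<close> with \<open>y\<close> near \<open>- 1\<close>, after which \<open>y\<close> vanishes again and the residue of \<open>u\<close> has
  increased by \<open>a\<^sub>0\<close>. This two-step cycle ends only if the residue \<open>(k + 1) a\<^sub>0 - 2\<close> becomes \<open>0\<close> for
  some \<open>k\<close>, which means \<open>a\<^sub>0 = 2 / (1 + k)\<close>. The point \<open>u = y = 0\<close> is indeterminate for the map, and the
  orbit becomes generic again. The lemmas on single steps are \<open>infinite_step\<close>, \<open>generic_u_zero_step\<close>,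
  \<open>generic_s_zero_step\<close>, \<open>zero_step\<close>, \<open>pole_step\<close>, \<open>zero_two_steps\<close> and \<open>corner_step\<close>; the resulting
  balances of orders are \<open>balance_without_corner\<close> and \<open>balance_with_corner\<close>.

  Let \<open>I\<^sub>p\<close> be the degree of the denominator of \<open>y\<^sub>p\<close> and \<open>z\<^sub>p\<close> the degree of \<open>gcd U Y\<close>. Summing over
  all \<open>D\<close> gives \<open>I\<^sub>p\<^sub>+\<^sub>1 + z\<^sub>p = I\<^sub>p + d\<^sub>p\<close> and \<open>d\<^sub>p\<^sub>+\<^sub>1 + z\<^sub>p = n I\<^sub>p\<^sub>+\<^sub>1 + I\<^sub>p\<close> (\<open>degree_recurrence\<close>). In the
  first case \<open>z\<close> vanishes, so that \<open>I\<^sub>p\<^sub>+\<^sub>2 = (n + 1) I\<^sub>p\<^sub>+\<^sub>1 + I\<^sub>p\<close>. In the second case each zero of \<open>s\<close> in a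
  generic state at time \<open>p\<close> is a common zero of \<open>U\<close> and \<open>Y\<close> at time \<open>p + 2m + 1\<close>, and
  counting the zeros of \<open>s\<close> gives \<open>z\<^sub>p\<^sub>+\<^sub>2\<^sub>m\<^sub>+\<^sub>1 + z\<^sub>p = (n + 1) I\<^sub>p\<close> for \<open>p > 0\<close>. Then \<open>I\<^sub>p - (z\<^sub>p + z\<^sub>p\<^sub>+\<^sub>2 + \<dots> + z\<^sub>p\<^sub>+\<^sub>2\<^sub>m)\<close> has
  period two, and eliminating \<open>I\<close> leaves a recursion for \<open>z\<close> with nonnegative coefficients and
  characteristic polynomial \<open>x\<^sup>2\<^sup>m\<^sup>+\<^sup>1 - (n + 1) (x\<^sup>2 + x\<^sup>4 + \<dots> + x\<^sup>2\<^sup>m) - n\<close>. Its product with \<open>x\<^sup>2 - 1\<close> is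
  the polynomial of the theorem, and because of the signs its only positive root is the growth rate.
\<close>

section \<open>Discrete valuations over the complex numbers\<close>

text \<open>
  One step of \<open>k_F\<close> in the coordinates \<open>u = x - 1\<close> and \<open>y\<close>, over an arbitrary field that contains
  the complex numbers through \<open>c\<close>: the same formulas are used in \<open>\<complex>(x, y)\<close> and in the
  fraction field of the homogeneous coordinate ring.
\<close>

definition next_y :: "'k::field \<Rightarrow> 'k \<Rightarrow> 'k" where
  "next_y u y = - (y + 1) - y / u"

definition affine_next_u ::
    "(complex \<Rightarrow> 'k::field) \<Rightarrow> complex poly \<Rightarrow> 'k \<Rightarrow> 'k \<Rightarrow> 'k" where
  "affine_next_u c F u y = u - 1 + u / y + poly (map_poly c F) (next_y u y)"

definition sfun :: "'k::field \<Rightarrow> 'k \<Rightarrow> 'k" where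
  "sfun u y = u * y + u + y"

text \<open>
  The valuation is given by integers, so its value at \<open>0\<close> has no meaning; for this reason all
  estimates are stated with the predicate \<open>V j\<close> below, which holds for \<open>0\<close>.
\<close>

locale complex_valuation =
  fixes v :: "'k::field \<Rightarrow> int" and c :: "complex \<Rightarrow> 'k"
  assumes v_mult: "a \<noteq> 0 \<Longrightarrow> b \<noteq> 0 \<Longrightarrow> v (a * b) = v a + v b"
    and v_add: "a \<noteq> 0 \<Longrightarrow> b \<noteq> 0 \<Longrightarrow> a + b \<noteq> 0 \<Longrightarrow> min (v a) (v b) \<le> v (a + b)"
    and v_const: "z \<noteq> 0 \<Longrightarrow> v (c z) = 0"
    and c_add: "c (z + w) = c z + c w"
    and c_mult: "c (z * w) = c z * c w"
    and c_1: "c 1 = 1"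
begin

lemma c_0: "c 0 = 0"
  using c_add[of 0 0] by (metis add.right_neutral add_cancel_right_right)

lemma c_minus: "c (- z) = - c z"
  using c_add[of z "- z"] c_0 by (simp add: eq_neg_iff_add_eq_0 add.commute)

lemma c_diff: "c (z - w) = c z - c w"
  using c_add[of z "- w"] c_minus by simp

lemma c_eq_0_iff: "c z = 0 \<longleftrightarrow> z = 0"
proof
  assume "c z = 0"
  then show "z = 0"
    using c_mult[of z "1 / z"] c_1 by (cases "z = 0") auto
qed (simp add: c_0)

lemma c_of_nat: "c (of_nat k) = of_nat k"
  by (induction k) (simp_all add: c_0 c_add c_1)

lemma v_1: "v 1 = 0"
  using v_const[of 1] c_1 by simp

lemma v_minus: "v (- a) = v a"
proof (cases "a = 0")
  case False
  have "v (c (- 1)) = 0"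
    by (rule v_const) simp
  then have "v (- 1) = 0"
    by (simp add: c_minus c_1)
  then show ?thesis
    using v_mult[of "- 1" a] False by simp
qed simp

lemma v_inverse: "a \<noteq> 0 \<Longrightarrow> v (inverse a) = - v a"
  using v_mult[of a "inverse a"] v_1 by simp

lemma v_divide: "a \<noteq> 0 \<Longrightarrow> b \<noteq> 0 \<Longrightarrow> v (a / b) = v a - v b"
  using v_mult[of a "inverse b"] v_inverse[of b] by (simp add: divide_inverse)

lemma v_power: "a \<noteq> 0 \<Longrightarrow> v (a ^ k) = int k * v a"
  by (induction k) (simp_all add: v_1 v_mult algebra_simps)

definition V :: "int \<Rightarrow> 'k \<Rightarrow> bool" where
  "V j a \<longleftrightarrow> a = 0 \<or> j \<le> v a"

lemma V_0: "V j 0"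
  by (simp add: V_def)

lemma V_mono: "V j a \<Longrightarrow> i \<le> j \<Longrightarrow> V i a"
  by (auto simp: V_def)

lemma V_add:
  assumes "V j a" "V j b"
  shows "V j (a + b)"
proof (cases "a = 0 \<or> b = 0 \<or> a + b = 0")
  case False
  then show ?thesis
    using assms v_add[of a b] unfolding V_def by auto
qed (use assms in \<open>auto simp: V_def\<close>)

lemma V_minus_iff: "V j (- a) \<longleftrightarrow> V j a"
  by (simp add: V_def v_minus)

lemma V_minus: "V j a \<Longrightarrow> V j (- a)"
  by (simp add: V_minus_iff)

lemma V_diff: "V j a \<Longrightarrow> V j b \<Longrightarrow> V j (a - b)"
  using V_add[of j a "- b"] V_minus[of j b] by simp

lemma V_mult: "V i a \<Longrightarrow> V j b \<Longrightarrow> V (i + j) (a * b)"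
  unfolding V_def by (cases "a = 0 \<or> b = 0") (auto simp: v_mult)

lemma V_mult0: "V 0 a \<Longrightarrow> V j b \<Longrightarrow> V j (a * b)"
  using V_mult[of 0 a j b] by simp

lemma V_mult0_right: "V j a \<Longrightarrow> V 0 b \<Longrightarrow> V j (a * b)"
  using V_mult[of j a 0 b] by simp

lemma V_c: "V 0 (c z)"
  using v_const[of z] c_0 by (cases "z = 0") (auto simp: V_def)

lemma V_1: "V 0 1"
  using V_c[of 1] c_1 by simp

lemma V_divide:
  assumes "V i a" "\<not> V (j + 1) b"
  shows "V (i - j) (a / b)"
proof (cases "a = 0")
  case False
  moreover have "b \<noteq> 0" "v b \<le> j"
    using assms(2) by (auto simp: V_def)
  ultimately show ?thesis
    using assms(1) v_divide[of a b] by (auto simp: V_def)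
qed (simp add: V_0)

lemma V_divide0: "V i a \<Longrightarrow> \<not> V 1 b \<Longrightarrow> V i (a / b)"
  using V_divide[of i a 0 b] by simp

lemma V_v: "V (v a) a"
  by (simp add: V_def)

lemma not_V: "a \<noteq> 0 \<Longrightarrow> v a < j \<Longrightarrow> \<not> V j a"
  by (simp add: V_def)

lemma v_eqI: "V j a \<Longrightarrow> \<not> V (j + 1) a \<Longrightarrow> a \<noteq> 0 \<and> v a = j"
  by (auto simp: V_def)

lemma V_cong: "V j (a - b) \<Longrightarrow> V j a \<longleftrightarrow> V j b"
  using V_add[of j "a - b" b] V_diff[of j a "a - b"] by auto

lemma v_perturb:
  assumes "b \<noteq> 0" "V (v b + 1) (a - b)"
  shows "a \<noteq> 0 \<and> v a = v b"
proof (rule v_eqI)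
  show "V (v b) a"
    using V_cong[of "v b" a b] V_mono[OF assms(2)] V_v by auto
  show "\<not> V (v b + 1) a"
    using V_cong[OF assms(2)] not_V[OF assms(1)] by auto
qed

lemma V_sum: "(\<And>i. i \<in> I \<Longrightarrow> V j (f i)) \<Longrightarrow> V j (sum f I)"
  by (induction I rule: infinite_finite_induct) (auto simp: V_0 V_add)

text \<open>
  The residue of \<open>a\<close> is the complex constant \<open>z\<close>. Most elements of the valuation ring have no
  residue in this sense, as the residue field is larger than \<open>\<complex>\<close>.
\<close>

definition res :: "'k \<Rightarrow> complex \<Rightarrow> bool" where
  "res a z \<longleftrightarrow> V 1 (a - c z)"

lemma res_V0: "res a z \<Longrightarrow> V 0 a"
  using V_cong[of 0 a "c z"] V_mono[of 1 "a - c z" 0] V_c unfolding res_def by auto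

lemma res_0_iff: "res a 0 \<longleftrightarrow> V 1 a"
  by (simp add: res_def c_0)

lemma res_0: "V 1 a \<Longrightarrow> res a 0"
  by (simp add: res_0_iff)

lemma res_c: "res (c z) z"
  by (simp add: res_def V_0)

lemma res_1: "res 1 1"
  using res_c[of 1] c_1 by simp

lemma res_V1_iff: "res a z \<Longrightarrow> V 1 a \<longleftrightarrow> z = 0"
  using V_cong[of 1 a "c z"] not_V[of "c z" 1] v_const[of z] c_eq_0_iff[of z] c_0 V_0
  by (cases "z = 0") (auto simp: res_def)

lemma res_add: "res a z \<Longrightarrow> res b w \<Longrightarrow> res (a + b) (z + w)"
  unfolding res_def c_add add_diff_add by (rule V_add)

lemma res_minus: "res a z \<Longrightarrow> res (- a) (- z)"
  unfolding res_def using V_minus[of 1 "a - c z"] by (simp add: c_minus add.commute)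

lemma res_diff: "res a z \<Longrightarrow> res b w \<Longrightarrow> res (a - b) (z - w)"
  using res_add[of a z "- b" "- w"] res_minus[of b w] by simp

lemma res_mult:
  assumes "res a z" "res b w"
  shows "res (a * b) (z * w)"
proof -
  have "a * b - c (z * w) = a * (b - c w) + c w * (a - c z)"
    by (simp add: c_mult algebra_simps)
  then show ?thesis
    using assms res_V0[OF assms(1)] V_c[of w] unfolding res_def
    by (simp add: V_add V_mult0)
qed

lemma res_divide:
  assumes "res a z" "res b w" "w \<noteq> 0"
  shows "res (a / b) (z / w)"
proof -
  have nb: "\<not> V 1 b"
    using res_V1_iff[OF assms(2)] assms(3) by simp
  then have "b \<noteq> 0"
    by (auto simp: V_0)
  moreover have "c z = c (z / w) * c w"
    using c_mult[of "z / w" w] assms(3) by simp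
  ultimately have "a / b - c (z / w) = ((a - c z) - c (z / w) * (b - c w)) / b"
    by (simp add: right_diff_distrib diff_divide_distrib)
  moreover have "V 1 (((a - c z) - c (z / w) * (b - c w)) / b)"
    using assms(1,2) unfolding res_def by (intro V_divide0[OF _ nb] V_diff[of 1 "a - c z"] V_mult0[OF V_c])
  ultimately show ?thesis
    unfolding res_def by (simp only:)
qed

abbreviation polyv :: "complex poly \<Rightarrow> 'k \<Rightarrow> 'k" where
  "polyv G y \<equiv> poly (map_poly c G) y"

lemma polyv_pCons: "polyv (pCons a G) y = c a + y * polyv G y"
  by (simp add: map_poly_pCons c_0)

lemma V_polyv:
  assumes "V 0 y"
  shows "V 0 (polyv G y)"
proof (induction G)
  case (pCons a G)
  then show ?case
    unfolding polyv_pCons by (intro V_add[OF V_c] V_mult0[OF assms])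
qed (simp add: V_0)

lemma res_polyv:
  assumes "res y z"
  shows "res (polyv G y) (poly G z)"
proof (induction G)
  case (pCons a G)
  then show ?case
    unfolding polyv_pCons poly_pCons by (intro res_add[OF res_c] res_mult[OF assms])
qed (simp add: res_0_iff V_0)

text \<open>
  At a pole of \<open>y\<close> all terms but the leading one have a smaller pole order; the bound is attained by the
  term of degree \<open>degree G - 1\<close>.
\<close>

lemma polyv_near_infinity:
  assumes "y \<noteq> 0" "v y < 0"
  shows "V (v y * (int (degree G) - 1)) (polyv G y - c (lead_coeff G) * y ^ degree G)"
proof (induction G)
  case 0
  then show ?case by (simp add: V_0 c_0)
next
  case (pCons a p)
  show ?case
  proof (cases "p = 0")
    case True
    then show ?thesis by (simp add: polyv_pCons V_0)
  next
    case False
    let ?r = "polyv p y - c (lead_coeff p) * y ^ degree p"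
    have eq: "polyv (pCons a p) y - c (lead_coeff (pCons a p)) * y ^ degree (pCons a p)
        = c a + y * ?r"
      using False by (simp add: polyv_pCons algebra_simps)
    have "V (v y + v y * (int (degree p) - 1)) (y * ?r)"
      by (rule V_mult[OF V_v pCons.IH])
    then have "V (v y * int (degree p)) (y * ?r)"
      by (simp add: algebra_simps)
    moreover have "V (v y * int (degree p)) (c a)"
      using V_mono[OF V_c, of "v y * int (degree p)" a] assms(2)
      by (simp add: mult_nonpos_nonneg)
    ultimately show ?thesis
      unfolding eq using False by (simp add: V_add)
  qed
qed

end

section \<open>One step of the map along a valuation\<close>

locale k_valuation = complex_valuation v c
  for v :: "'k::field \<Rightarrow> int" and c :: "complex \<Rightarrow> 'k" +
  fixes F :: "complex poly" and n :: nat
  assumes deg_F: "degree F = n" and even_n: "even n" and n_pos: "n > 0"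
begin

abbreviation next_u :: "'k \<Rightarrow> 'k \<Rightarrow> 'k" where
  "next_u \<equiv> affine_next_u c F"

lemmas next_u_def = affine_next_u_def

text \<open>
  The four states of a pair \<open>(u, y)\<close>. In \<open>infinite_state\<close> the coefficient of \<open>y\<^sup>n\<close> is \<open>l\<close> times the leading
  coefficient of \<open>F\<close> after \<open>l\<close> steps at infinity. In \<open>zero_state\<close> the parameter \<open>e\<close> has the residue of
  \<open>u\<close>; it is a field element rather than a complex number because the line \<open>y = 0\<close> itself is a
  prime divisor, along which this residue is not constant. In \<open>pole_state\<close> the same parameter is carried
  by the product of \<open>u\<close>, which is infinite, and \<open>y + 1\<close>, which is zero.
\<close>

definition generic_state :: "'k \<Rightarrow> 'k \<Rightarrow> bool" where
  "generic_state u y \<longleftrightarrow> V 0 u \<and> V 0 y \<and> \<not> V 1 y"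

definition infinite_state :: "int \<Rightarrow> 'k \<Rightarrow> 'k \<Rightarrow> bool" where
  "infinite_state j u y \<longleftrightarrow> j \<ge> 1 \<and> y \<noteq> 0 \<and> v y = - j \<and>
     (\<exists>l::nat. l \<ge> 1 \<and> V (- (int n * j) + 1) (u - c (of_nat l * lead_coeff F) * y ^ n))"

definition zero_state :: "'k \<Rightarrow> int \<Rightarrow> 'k \<Rightarrow> 'k \<Rightarrow> bool" where
  "zero_state e j u y \<longleftrightarrow> j \<ge> 1 \<and> y \<noteq> 0 \<and> v y = j \<and> V 0 e \<and> V 1 (u - e)"

definition pole_state :: "'k \<Rightarrow> int \<Rightarrow> 'k \<Rightarrow> 'k \<Rightarrow> bool" where
  "pole_state e j u y \<longleftrightarrow> j \<ge> 1 \<and> u \<noteq> 0 \<and> v u = - j \<and> V 0 e \<and> V j (y + 1) \<and>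
     V 1 (u * (y + 1) + e + 1)"

lemma lead_F: "lead_coeff F \<noteq> 0"
  using deg_F n_pos by auto

lemma n_ge_2: "n \<ge> 2"
  using even_n n_pos by (elim evenE) auto

lemma sfun_next_y: "u \<noteq> 0 \<Longrightarrow> sfun u y = - (u * next_y u y)"
  by (simp add: sfun_def next_y_def field_simps)

lemma next_u_sfun: "y \<noteq> 0 \<Longrightarrow> next_u u y = sfun u y / y - 2 + polyv F (next_y u y)"
  by (simp add: sfun_def next_u_def field_simps)

lemma infinite_v_u:
  assumes "infinite_state j u y"
  shows "u \<noteq> 0 \<and> v u = - (int n * j)"
proof -
  from assms obtain l :: nat where l: "l \<ge> 1" "y \<noteq> 0" "v y = - j"
    "V (- (int n * j) + 1) (u - c (of_nat l * lead_coeff F) * y ^ n)"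
    by (auto simp: infinite_state_def)
  let ?b = "c (of_nat l * lead_coeff F) * y ^ n"
  have nz: "c (of_nat l * lead_coeff F) \<noteq> 0" "v (c (of_nat l * lead_coeff F)) = 0"
    using l(1) lead_F c_eq_0_iff v_const by auto
  then have "v ?b = - (int n * j)" "?b \<noteq> 0"
    using l v_mult[of "c (of_nat l * lead_coeff F)" "y ^ n"] v_power[of y n] by auto
  then show ?thesis
    using v_perturb[of ?b u] l(4) by simp
qed

lemma polyv_infinite:
  assumes "y \<noteq> 0" "v y = - j" "j \<ge> 1"
  shows "V (- (int n * j) + 1) (polyv F y - c (lead_coeff F) * y ^ n)"
proof -
  have "V (v y * (int n - 1)) (polyv F y - c (lead_coeff F) * y ^ n)"
    using polyv_near_infinity[of y F] assms deg_F by auto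
  moreover have "- (int n * j) + 1 \<le> v y * (int n - 1)"
    using assms by (simp add: algebra_simps)
  ultimately show ?thesis by (rule V_mono)
qed

lemma enter_infinity:
  assumes j: "j \<ge> 1" and y': "next_y u y \<noteq> 0" "v (next_y u y) = - j"
    and b: "V (- (int n * j) + 1) (u - 1 + u / y)"
  shows "infinite_state j (next_u u y) (next_y u y)"
proof -
  have "next_u u y - c (lead_coeff F) * next_y u y ^ n
     = (u - 1 + u / y) + (polyv F (next_y u y) - c (lead_coeff F) * next_y u y ^ n)"
    by (simp add: next_u_def)
  then have "V (- (int n * j) + 1) (next_u u y - c (lead_coeff F) * next_y u y ^ n)"
    using V_add[OF b polyv_infinite[OF y' j]] by (simp only:)
  then show ?thesis
    unfolding infinite_state_def using j y' by (auto intro!: exI[of _ "1::nat"])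
qed

text \<open>
  Up to lower order \<open>y\<close> changes its sign and \<open>u\<close> increases by \<open>F(y')\<close>. For even \<open>n\<close> the increment is
  again \<open>lead_coeff F * y ^ n\<close>, so the leading coefficient of \<open>u\<close> is multiplied by \<open>(l + 1) / l\<close> and
  never cancels.
\<close>

lemma infinite_step:
  assumes "infinite_state j u y"
  shows "infinite_state j (next_u u y) (next_y u y)"
proof -
  from assms obtain l :: nat where l: "l \<ge> 1" "y \<noteq> 0" "v y = - j" "j \<ge> 1"
    "V (- (int n * j) + 1) (u - c (of_nat l * lead_coeff F) * y ^ n)"
    by (auto simp: infinite_state_def)
  have u: "u \<noteq> 0" "v u = - (int n * j)"
    using infinite_v_u[OF assms] by auto
  have "2 * j \<le> int n * j"
    using n_ge_2 l(4) by (intro mult_right_mono) auto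
  then have nj: "j + 1 \<le> int n * j"
    using l(4) by linarith
  let ?y = "next_y u y"
  have "V 1 (y / u)"
    using u l(2-4) nj by (auto simp: V_def v_divide)
  then have "V 0 (- 1 - y / u)"
    by (intro V_diff V_minus V_1) (auto intro: V_mono)
  moreover have "?y - (- y) = - 1 - y / u"
    by (simp add: next_y_def)
  ultimately have yy: "V 0 (?y - (- y))"
    by simp
  have y': "?y \<noteq> 0 \<and> v ?y = - j"
    using v_perturb[of "- y" ?y] V_mono[OF yy, of "v (- y) + 1"] l by (simp add: v_minus)
  \<comment> \<open>Evenness of \<open>n\<close> allows to compare \<open>?y ^ n\<close> with \<open>y ^ n = (- y) ^ n\<close>.\<close>
  have "?y ^ n - y ^ n = (?y - (- y)) * (\<Sum>i<n. (- y) ^ (n - Suc i) * ?y ^ i)"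
    using power_diff_sumr2[of ?y n "- y"] even_n by (simp add: power_minus_even)
  moreover have "V (- (int n * j) + 1) (\<Sum>i<n. (- y) ^ (n - Suc i) * ?y ^ i)"
  proof -
    have "V (- (int n * j) + 1) ((- y) ^ (n - Suc i) * ?y ^ i)" if "i < n" for i
    proof -
      have "v ((- y) ^ (n - Suc i) * ?y ^ i) = int (n - Suc i) * (- j) + int i * (- j)"
        using y' l v_mult[of "(- y) ^ (n - Suc i)" "?y ^ i"] v_power[of "- y" "n - Suc i"]
          v_power[of ?y i]
        by (simp add: v_minus)
      also have "\<dots> = - (int n * j) + j"
        using that by (simp add: of_nat_diff algebra_simps)
      finally show ?thesis
        using l(4) by (simp add: V_def)
    qed
    then show ?thesis
      by (intro V_sum) auto
  qed
  ultimately have pw: "V (- (int n * j) + 1) (?y ^ n - y ^ n)"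
    using V_mult0[OF yy] by simp
  have uy: "V (- (int n * j) + 1) (u / y)"
    using u l nj by (simp add: V_def v_divide)
  have one: "V (- (int n * j) + 1) 1"
    using V_mono[OF V_1, of "- (int n * j) + 1"] nj l by simp
  let ?lc = "c (lead_coeff F)" and ?llc = "c (of_nat l * lead_coeff F)"
  have "c (of_nat (Suc l) * lead_coeff F) = ?llc + ?lc"
    by (simp add: c_add algebra_simps)
  then have "next_u u y - c (of_nat (Suc l) * lead_coeff F) * ?y ^ n =
      (u - ?llc * y ^ n) - ?llc * (?y ^ n - y ^ n) - 1 + u / y + (polyv F ?y - ?lc * ?y ^ n)"
    by (simp add: next_u_def algebra_simps)
  moreover have "V (- (int n * j) + 1) \<dots>"
    using polyv_infinite[of ?y j] y' l(4)
    by (intro V_add[OF V_add[OF V_diff[OF V_diff[OF l(5) V_mult0[OF V_c pw]] one] uy]]) auto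
  ultimately have "V (- (int n * j) + 1)
      (next_u u y - c (of_nat (Suc l) * lead_coeff F) * ?y ^ n)"
    by simp
  then show ?thesis
    unfolding infinite_state_def using l y' by (auto intro!: exI[of _ "Suc l"])
qed

text \<open>
  The line at infinity is contracted: both poles are simple before the step, and the term \<open>F(y')\<close>
  dominates after it.
\<close>

lemma line_at_infinity_step:
  assumes "u \<noteq> 0" "y \<noteq> 0" "v u = - 1" "v y = - 1"
  shows "infinite_state 1 (next_u u y) (next_y u y)"
proof -
  have yu: "V 0 (y / u)" "V 0 (u / y)"
    using assms by (auto simp: V_def v_divide)
  moreover have "next_y u y - (- y) = - 1 - y / u"
    by (simp add: next_y_def)
  ultimately have "V 0 (next_y u y - (- y))"
    using V_diff[OF V_minus[OF V_1]] by (simp only:)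
  then have y1: "next_y u y \<noteq> 0 \<and> v (next_y u y) = - 1"
    using v_perturb[of "- y"] assms by (simp add: v_minus)
  have n1: "- (int n * 1) + 1 \<le> - 1"
    using n_ge_2 by simp
  have "V (- 1) (u - 1 + u / y)"
    using V_v[of u] assms V_mono[OF V_1, of "- 1"] V_mono[OF yu(2), of "- 1"]
    by (intro V_add V_diff) auto
  then show ?thesis
    using enter_infinity[of 1 u y] y1 V_mono[OF _ n1] by simp
qed

lemma generic_u_zero_step:
  assumes "generic_state u y" "V 1 u" "u \<noteq> 0"
  shows "infinite_state (v u) (next_u u y) (next_y u y)"
proof (rule enter_infinity)
  from assms have yv: "y \<noteq> 0" "v y = 0" and u: "v u \<ge> 1"
    by (auto simp: generic_state_def V_def)
  show "v u \<ge> 1" by fact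
  have "next_y u y - (- (y / u)) = - (y + 1)"
    by (simp add: next_y_def)
  moreover have "V 0 (- (y + 1))"
    using assms(1) by (intro V_minus V_add V_1) (auto simp: generic_state_def)
  ultimately have "V 0 (next_y u y - (- (y / u)))"
    by simp
  moreover have "v (- (y / u)) = - v u"
    using assms yv by (simp add: v_minus v_divide)
  ultimately have "next_y u y \<noteq> 0 \<and> v (next_y u y) = - v u"
    using v_perturb[of "- (y / u)" "next_y u y"] V_mono[of 0 _ "- v u + 1"] yv assms u by simp
  then show "next_y u y \<noteq> 0" "v (next_y u y) = - v u"
    by auto
  have "V 0 (u - 1 + u / y)"
    using assms by (intro V_add V_diff V_1 V_divide0) (auto simp: generic_state_def)
  moreover have "1 * 1 \<le> int n * v u"
    using u n_pos by (intro mult_mono) auto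
  ultimately show "V (- (int n * v u) + 1) (u - 1 + u / y)"
    using V_mono by auto
qed

lemma generic_step:
  assumes "generic_state u y" "\<not> V 1 u" "\<not> V 1 (sfun u y)"
  shows "generic_state (next_u u y) (next_y u y)"
proof -
  have "u \<noteq> 0"
    using assms(2) V_0 by auto
  have V0: "V 0 u" "V 0 y" "\<not> V 1 y"
    using assms by (auto simp: generic_state_def)
  have y: "V 0 (next_y u y)"
    unfolding next_y_def using V0 assms(2) by (intro V_diff V_minus V_add V_1 V_divide0) auto
  moreover have "V 0 (next_u u y)"
    unfolding next_u_def using V0 y by (intro V_diff V_add V_1 V_divide0 V_polyv) auto
  moreover have "\<not> V 1 (next_y u y)"
    using assms(3) sfun_next_y[OF \<open>u \<noteq> 0\<close>, of y] V_mult0[of u 1 "next_y u y"] V0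
    by (auto simp: V_minus_iff)
  ultimately show ?thesis
    by (simp add: generic_state_def)
qed

lemma generic_s_zero_step:
  assumes "generic_state u y" "\<not> V 1 u" "V 1 (sfun u y)" "next_y u y \<noteq> 0"
  shows "zero_state (c (coeff F 0 - 2)) (v (sfun u y)) (next_u u y) (next_y u y)"
proof -
  have u: "u \<noteq> 0" "v u = 0"
    using assms(1,2) by (auto simp: generic_state_def V_def)
  have yn: "y \<noteq> 0" "\<not> V 1 y"
    using assms(1) V_0 by (auto simp: generic_state_def)
  have s: "sfun u y = - (u * next_y u y)"
    by (rule sfun_next_y[OF u(1)])
  then have vs: "v (sfun u y) = v (next_y u y)" "sfun u y \<noteq> 0"
    using u assms(4) by (auto simp: v_minus v_mult)
  then have v1: "v (sfun u y) \<ge> 1"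
    using assms(3) by (auto simp: V_def)
  then have "V 1 (next_y u y)"
    using vs by (simp add: V_def)
  then have "res (polyv F (next_y u y)) (poly F 0)"
    by (intro res_polyv res_0)
  moreover have "res (sfun u y / y) 0"
    using V_divide0[OF assms(3) yn(2)] by (simp add: res_0)
  ultimately have "res (next_u u y) (0 - 2 + poly F 0)"
    unfolding next_u_sfun[OF yn(1)] using res_c[of 2] c_of_nat[of 2]
    by (intro res_add res_diff) auto
  then show ?thesis
    using vs v1 assms(4) V_c by (auto simp: zero_state_def res_def poly_0_coeff_0)
qed

text \<open>
  Near \<open>y = 0\<close> one has \<open>u' = u / y + g\<close> with integral \<open>g\<close> and \<open>y' + 1 = - y (u + 1) / u\<close>, and the product of the two
  leading terms is \<open>- (u + 1)\<close>.
\<close>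

lemma zero_step:
  assumes "zero_state e j u y" "\<not> V 1 e"
  shows "pole_state e j (next_u u y) (next_y u y)"
proof -
  from assms have y: "y \<noteq> 0" "v y = j" "j \<ge> 1" and e: "V 0 e" and ue: "V 1 (u - e)"
    by (auto simp: zero_state_def)
  have u: "V 0 u" "\<not> V 1 u"
    using V_cong[of 0 u e] V_cong[of 1 u e] ue e assms(2) V_mono[of 1 "u - e" 0] by auto
  then have u0: "u \<noteq> 0" "v u = 0"
    by (auto simp: V_def)
  let ?y = "next_y u y" and ?u = "next_u u y"
  have y1: "?y + 1 = y * (- ((u + 1) / u))"
    using u0 by (simp add: next_y_def field_simps)
  have vy1: "V j (?y + 1)"
    unfolding y1 using u y V_v[of y]
    by (intro V_mult0_right V_minus V_divide0 V_add V_1) auto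
  have "V 0 ?y"
    using V_diff[OF V_mono[OF vy1, of 0] V_1] y by simp
  then have F0: "V 0 (polyv F ?y)"
    by (rule V_polyv)
  define g where "g = u - 1 + polyv F ?y"
  have g: "V 0 g"
    unfolding g_def using u F0 by (intro V_add V_diff V_1)
  have ug: "?u = u / y + g"
    by (simp add: next_u_def g_def)
  have "v (u / y) = - j"
    using u0 y by (simp add: v_divide)
  moreover have "?u - u / y = g"
    using ug by simp
  ultimately have u': "?u \<noteq> 0 \<and> v ?u = - j"
    using v_perturb[of "u / y" ?u] V_mono[OF g, of "- j + 1"] y u0 by simp
  have "u / y * (?y + 1) = - (u + 1)"
    unfolding y1 using y(1) u0 by (simp add: field_simps)
  then have "?u * (?y + 1) + e + 1 = g * (?y + 1) - (u - e)"
    unfolding ug by (simp add: distrib_right)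
  moreover have "V 1 (g * (?y + 1) - (u - e))"
    using V_diff[OF V_mult0[OF g V_mono[OF vy1]] ue] y by simp
  ultimately have "V 1 (?u * (?y + 1) + e + 1)"
    by (simp only:)
  then show ?thesis
    using u' e y vy1 by (simp add: pole_state_def)
qed

text \<open>
  The pole of \<open>u\<close> cancels in \<open>u + u / y = u (y + 1) / y\<close>, whose residue is \<open>e + 1\<close>, and \<open>F(y') - 1\<close>
  contributes \<open>a\<^sub>0 - 1\<close>. If \<open>e = - 2\<close>, the zero of the next \<open>y\<close> may have a higher order than the pole of \<open>u\<close>, hence
  only an inequality between the orders.
\<close>

lemma pole_step:
  assumes "pole_state e j u y" "next_y u y \<noteq> 0"
  shows "zero_state (e + c (coeff F 0)) (v (next_y u y)) (next_u u y) (next_y u y)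
    \<and> v (next_y u y) \<ge> j"
proof -
  from assms have u: "u \<noteq> 0" "v u = - j" and j: "j \<ge> 1" and e: "V 0 e"
    and y1: "V j (y + 1)" and ue: "V 1 (u * (y + 1) + e + 1)"
    by (auto simp: pole_state_def)
  have ry: "res y (- 1)"
    using V_mono[OF y1 j] by (simp add: res_def c_minus c_1)
  then have y: "\<not> V 1 y" "V 0 y"
    using res_V1_iff[OF ry] res_V0[OF ry] by auto
  then have y0: "y \<noteq> 0" "v y = 0"
    by (auto simp: V_def)
  let ?y = "next_y u y" and ?u = "next_u u y"
  have "V j (y / u)"
    using u y0 by (simp add: V_def v_divide)
  then have yj: "V j ?y"
    unfolding next_y_def using y1 by (intro V_diff V_minus)
  then have vj: "v ?y \<ge> j"
    using assms(2) by (simp add: V_def)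
  have "res (polyv F ?y) (poly F 0)"
    using V_mono[OF yj j] by (intro res_polyv res_0)
  then have Fa: "V 1 (polyv F ?y - c (coeff F 0))"
    by (simp add: res_def poly_0_coeff_0)
  have "?u - (e + c (coeff F 0)) = (u * (y + 1) + e + 1) * (1 / y) - (e + 1) * ((y + 1) / y)
      + (polyv F ?y - c (coeff F 0))"
    using y0 by (simp add: next_u_def field_simps)
  moreover have "V 1 ((u * (y + 1) + e + 1) * (1 / y) - (e + 1) * ((y + 1) / y)
      + (polyv F ?y - c (coeff F 0)))"
  proof -
    have "V 0 (1 / y)" "V 0 (e + 1)" "V 1 ((y + 1) / y)"
      using e y V_mono[OF y1 j] by (auto intro: V_add V_divide0 V_1)
    then show ?thesis
      using V_add[OF V_diff[OF V_mult0_right[OF ue] V_mult0] Fa] by blast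
  qed
  ultimately have "V 1 (?u - (e + c (coeff F 0)))"
    by (simp only:)
  then show ?thesis
    using vj j assms(2) V_add[OF e V_c] by (simp add: zero_state_def)
qed

end

section \<open>Residues that are not constant\<close>

text \<open>
  The orbit leaves the point \<open>u = y = 0\<close> in the direction \<open>u / y\<close>. To see that this direction is not a
  special one, it is enough to know that its residue is not a complex number, and that property is
  inherited from step to step.
\<close>

context complex_valuation
begin

definition nonconst :: "'k \<Rightarrow> bool" where
  "nonconst a \<longleftrightarrow> V 0 a \<and> (\<forall>z. \<not> res a z)"

lemma nonconst_V0: "nonconst a \<Longrightarrow> V 0 a"
  by (simp add: nonconst_def)

lemma nonconst_not_V1: "nonconst a \<Longrightarrow> \<not> V 1 a"
  using res_0 by (auto simp: nonconst_def)

lemma nonconst_minus: "nonconst a \<Longrightarrow> nonconst (- a)"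
  using res_minus[of "- a"] by (auto simp: nonconst_def V_minus_iff)

lemma nonconst_add:
  assumes "nonconst a" "res b w"
  shows "nonconst (a + b)"
  unfolding nonconst_def
proof (intro conjI allI notI)
  show "V 0 (a + b)"
    using assms res_V0 by (intro V_add) (auto simp: nonconst_def)
  show False if "res (a + b) z" for z
    using res_diff[OF that assms(2)] assms(1) by (auto simp: nonconst_def)
qed

lemma nonconst_divide:
  assumes "nonconst a" "res b w" "w \<noteq> 0"
  shows "nonconst (a / b)"
  unfolding nonconst_def
proof (intro conjI allI notI)
  have nb: "\<not> V 1 b"
    using res_V1_iff[OF assms(2)] assms(3) by simp
  then have "b \<noteq> 0"
    by (auto simp: V_0)
  show "V 0 (a / b)"
    using assms(1) nb by (intro V_divide0) (auto simp: nonconst_def)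
  show False if "res (a / b) z" for z
    using res_mult[OF that assms(2)] assms(1) \<open>b \<noteq> 0\<close> by (auto simp: nonconst_def)
qed

lemma nonconst_inverse:
  assumes "nonconst a"
  shows "nonconst (1 / a)"
  unfolding nonconst_def
proof (intro conjI allI notI)
  have na: "\<not> V 1 a" "V 0 a"
    using nonconst_not_V1[OF assms] assms by (auto simp: nonconst_def)
  then have "a \<noteq> 0" "v a = 0"
    by (auto simp: V_def)
  show "V 0 (1 / a)"
    using V_divide0[OF V_1 na(1)] .
  show False if "res (1 / a) z" for z
  proof (cases "z = 0")
    case True
    then show ?thesis
      using that v_divide[of 1 a] v_1 \<open>a \<noteq> 0\<close> \<open>v a = 0\<close> by (simp add: res_0_iff V_def)
  next
    case False
    then show ?thesis
      using res_divide[OF res_1 that] assms \<open>a \<noteq> 0\<close> by (auto simp: nonconst_def)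
  qed
qed

end

context k_valuation
begin

lemma infinite_v_s:
  assumes "infinite_state j u y"
  shows "v (sfun u y) = - (int (n + 1) * j)"
proof -
  have j: "j \<ge> 1" and y: "y \<noteq> 0" "v y = - j" and u: "u \<noteq> 0" "v u = - (int n * j)"
    using assms infinite_v_u[OF assms] by (auto simp: infinite_state_def)
  have uy: "v (u * y) = - (int (n + 1) * j)" "u * y \<noteq> 0"
    using u y by (auto simp: v_mult algebra_simps)
  have "1 * 1 \<le> int n * j"
    using j n_pos by (intro mult_mono) auto
  then have "v (u * y) + 1 \<le> v u" "v (u * y) + 1 \<le> v y"
    using u y j uy(1) by (auto simp: algebra_simps)
  then have "V (v (u * y) + 1) u" "V (v (u * y) + 1) y"
    by (auto simp: V_def)
  then have "V (v (u * y) + 1) (sfun u y - u * y)"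
    using V_add by (simp add: sfun_def)
  then show ?thesis
    using v_perturb[OF uy(2)] uy(1) by simp
qed

lemma generic_v:
  assumes "generic_state u y" "u \<noteq> 0"
  shows "y \<noteq> 0" "v y = 0" "v u \<ge> 0" "V 0 (sfun u y)" "V 1 u \<Longrightarrow> v (sfun u y) = 0"
proof -
  show y: "y \<noteq> 0" "v y = 0" and u: "v u \<ge> 0"
    using assms by (auto simp: generic_state_def V_def)
  have V0: "V 0 u" "V 0 y"
    using assms by (auto simp: generic_state_def)
  then show "V 0 (sfun u y)"
    unfolding sfun_def by (intro V_add V_mult0)
  assume "V 1 u"
  then have "V 1 (u * y + u)"
    using V0 by (intro V_add V_mult0_right)
  then show "v (sfun u y) = 0"
    using v_perturb[OF y(1), of "sfun u y"] y by (simp add: sfun_def)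
qed

lemma zero_state_v:
  assumes "zero_state e j u y" "\<not> V 1 e"
  shows "u \<noteq> 0" "v u = 0" "v (sfun u y) = 0"
proof -
  have e: "e \<noteq> 0" "v e = 0"
    using assms by (auto simp: zero_state_def V_def)
  have ue: "V 1 (u - e)" and e0: "V 0 e" and y: "V 1 y"
    using assms by (auto simp: zero_state_def V_def)
  show "u \<noteq> 0" "v u = 0"
    using v_perturb[OF e(1), of u] e ue by auto
  have "V 0 u"
    using V_add[OF V_mono[OF ue] e0] by simp
  then have "V 1 ((u - e) + u * y + y)"
    using ue y by (intro V_add V_mult0)
  then show "v (sfun u y) = 0"
    using v_perturb[OF e(1), of "sfun u y"] e by (simp add: sfun_def algebra_simps)
qed

lemma pole_state_v:
  assumes "pole_state e j u y"
  shows "y \<noteq> 0" "v y = 0" "\<not> V 1 (e + 2) \<Longrightarrow> v (sfun u y) = 0"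
proof -
  have j: "j \<ge> 1" and e: "V 0 e" and y1: "V 1 (y + 1)" and ue: "V 1 (u * (y + 1) + e + 1)"
    using assms V_mono[of j "y + 1" 1] by (auto simp: pole_state_def)
  show "y \<noteq> 0" "v y = 0"
    using v_perturb[of "- 1" y] y1 v_minus[of 1] v_1 by auto
  assume "\<not> V 1 (e + 2)"
  moreover have "V 0 (e + 2)"
    using V_add[OF e V_c[of 2]] c_of_nat[of 2] by simp
  ultimately have e2: "e + 2 \<noteq> 0" "v (e + 2) = 0"
    by (auto simp: V_def)
  have "sfun u y - (- (e + 2)) = (u * (y + 1) + e + 1) + (y + 1)"
    by (simp add: sfun_def algebra_simps)
  then have "V 1 (sfun u y - (- (e + 2)))"
    using V_add[OF ue y1] by (simp only:)
  moreover have "- (e + 2) \<noteq> 0" "v (- (e + 2)) = 0"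
    using e2 v_minus[of "e + 2"] by (simp_all only: neg_equal_0_iff_equal not_False_eq_True)
  ultimately show "v (sfun u y) = 0"
    using v_perturb[of "- (e + 2)" "sfun u y"] by (simp only: add_0 simp_thms)
qed

text \<open>
  Away from the exceptional curves the map is invertible, so constant residues after the step come from
  constant residues before it. The inverse is computed as \<open>i \<circ> j\<close>, using that the involution \<open>i\<close>
  leaves \<open>s\<close> invariant.
\<close>

lemma generic_step_nonconst:
  assumes "generic_state u y" "\<not> V 1 u" "\<not> V 1 (sfun u y)"
    and "res (next_u u y) z" "res (next_y u y) w"
  shows "\<exists>z w. res u z \<and> res y w"
proof -
  let ?y = "next_y u y"
  have u: "u \<noteq> 0" and y: "y \<noteq> 0"
    using assms(1,2) V_0 by (auto simp: generic_state_def)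
  define ii where "ii = - (sfun u y / y)"
  have V0: "V 0 u" "V 0 y" "\<not> V 1 y"
    using assms(1) by (auto simp: generic_state_def)
  have s0: "V 0 (sfun u y)"
    unfolding sfun_def using V0 by (intro V_add V_mult0)
  have s: "sfun u y = - (u * ?y)"
    by (rule sfun_next_y[OF u])
  \<comment> \<open>\<open>(ii, next_y u y)\<close> is the image of \<open>(u, y)\<close> under the involution \<open>i\<close>.\<close>
  have ii: "ii = - next_u u y - 2 + polyv F ?y"
    using next_u_sfun[OF y, of u] by (simp add: ii_def)
  have "res 2 2"
    using res_c[of 2] c_of_nat[of 2] by simp
  then have ri: "res ii (- z - 2 + poly F w)"
    unfolding ii using assms by (intro res_add res_diff res_minus res_polyv)
  have y': "?y \<noteq> 0"
    using assms(3) s V_0 by auto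
  have sinv: "sfun ii ?y = sfun u y"
  proof -
    have sii: "sfun ii ?y = ii * (?y + 1) + ?y"
      by (simp add: sfun_def algebra_simps)
    have "ii * y = u * ?y"
      using y s by (simp add: ii_def)
    then have "y * (ii * (?y + 1) + ?y) = u * ?y * (?y + 1) + y * ?y"
      by (simp add: algebra_simps)
    also have "u * ?y = - (u * (y + 1) + y)"
      using s by (simp add: sfun_def algebra_simps)
    also have "- (u * (y + 1) + y) * (?y + 1) + y * ?y = - (u * ?y) * (y + 1) - u * (y + 1) - y"
      by (simp add: algebra_simps)
    also have "- (u * ?y) = u * (y + 1) + y"
      using s by (simp add: sfun_def algebra_simps)
    also have "(u * (y + 1) + y) * (y + 1) - u * (y + 1) - y = y * (u * (y + 1) + y)"
      by (simp add: algebra_simps)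
    finally have "y * (ii * (?y + 1) + ?y) = y * (u * (y + 1) + y)" .
    then have "ii * (?y + 1) + ?y = u * (y + 1) + y"
      using y by simp
    then show ?thesis
      unfolding sii by (simp add: sfun_def algebra_simps)
  qed
  have "res (sfun ii ?y) ((- z - 2 + poly F w) * w + (- z - 2 + poly F w) + w)"
    unfolding sfun_def[of ii] using assms ri by (intro res_add res_mult)
  then obtain t where rs: "res (sfun u y) t"
    using sinv by auto
  then have "t \<noteq> 0"
    using assms(3) res_V1_iff by auto
  have "\<not> V 1 ?y"
    using V_mult0[of u 1 ?y] V0(1) assms(3) s by (auto simp: V_minus_iff)
  then have w: "w \<noteq> 0"
    using res_V1_iff[OF assms(5)] by simp
  have "sfun u y = - (ii * y)"
    using y by (simp add: ii_def)
  then have "\<not> V 1 ii"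
    using V_mult0_right[of 1 ii y] V0(2) assms(3) by (auto simp: V_minus_iff)
  then have z: "- z - 2 + poly F w \<noteq> 0"
    using res_V1_iff[OF ri] by simp
  have "ii \<noteq> 0"
    using \<open>\<not> V 1 ii\<close> V_0 by auto
  have "u = - (sfun u y / ?y)" "y = - (sfun u y / ii)"
    using s y' u \<open>sfun u y = - (ii * y)\<close> \<open>ii \<noteq> 0\<close> by (auto simp: field_simps)
  then show ?thesis
    using res_minus[OF res_divide[OF rs assms(5) w]] res_minus[OF res_divide[OF rs ri z]]
    by auto
qed

text \<open>
  On the curve \<open>s = 0\<close> the residue of \<open>u\<close> determines that of \<open>y\<close>, so neither is constant. The direction
  in which the contracted curve reaches \<open>(a\<^sub>0 - 2, 0)\<close> is \<open>- u / y\<close> up to a constant, and \<open>- u / y\<close> agrees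
  with \<open>u + 1\<close> on \<open>s = 0\<close>.
\<close>

lemma generic_s_zero_nonconst:
  assumes "generic_state u y" "\<not> V 1 u" "V 1 (sfun u y)" "next_y u y \<noteq> 0"
    and nc: "\<not> (\<exists>z w. res u z \<and> res y w)"
  shows "nonconst ((next_u u y - c (coeff F 0 - 2)) / next_y u y)"
proof -
  let ?y = "next_y u y"
  have u: "u \<noteq> 0" and y: "y \<noteq> 0"
    using assms(1,2) V_0 by (auto simp: generic_state_def)
  have V0: "V 0 u" "V 0 y" "\<not> V 1 y"
    using assms(1) by (auto simp: generic_state_def)
  have s: "sfun u y = - (u * ?y)"
    by (rule sfun_next_y[OF u])
  have sz: "res (sfun u y) 0"
    using assms(3) by (rule res_0)
  have nu: "nonconst u"
    unfolding nonconst_def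
  proof (intro conjI allI notI)
    fix z assume z: "res u z"
    have su: "sfun u y - u = (1 + u) * y"
      by (simp add: sfun_def algebra_simps)
    show False
    proof (cases "1 + z = 0")
      case True
      then have "V 1 (1 + u)"
        using res_add[OF res_1 z] by (simp add: res_0_iff)
      then have "V 1 (sfun u y - u)"
        unfolding su using V0 by (intro V_mult0_right)
      then show False
        using V_diff[OF assms(3), of "sfun u y - u"] assms(2) by simp
    next
      case False
      have r1: "res (1 + u) (1 + z)"
        by (intro res_add res_1 z)
      then have "1 + u \<noteq> 0"
        using False res_V1_iff[OF r1] V_0 by auto
      then have "y = (sfun u y - u) / (1 + u)"
        using su by (simp add: field_simps)
      then have "res y ((0 - z) / (1 + z))"
        using res_divide[OF res_diff[OF sz z] r1 False] by simp
      then show False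
        using nc z by auto
    qed
  qed (use V0 in auto)
  obtain H where H: "F = pCons (coeff F 0) H"
    by (metis coeff_pCons_0 pCons_cases)
  have FH: "polyv F ?y = c (coeff F 0) + ?y * polyv H ?y"
    using polyv_pCons[of "coeff F 0" H ?y] H by simp
  have "u * ?y / y = - (sfun u y / y)"
    using s by simp
  then have "next_u u y - c (coeff F 0 - 2) = - (u * ?y / y) + ?y * polyv H ?y"
    using next_u_sfun[OF y, of u] FH c_of_nat[of 2] by (simp add: c_diff)
  then have r: "(next_u u y - c (coeff F 0 - 2)) / ?y = - (u / y) + polyv H ?y"
    using assms(4) y by (simp add: field_simps)
  have "- (u / y) = u + (1 - sfun u y / y)"
    using y by (simp add: sfun_def field_simps)
  then have r': "(next_u u y - c (coeff F 0 - 2)) / ?y = u + (1 - sfun u y / y + polyv H ?y)"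
    unfolding r by simp
  have "V 1 (sfun u y / y)"
    using V_divide0[OF assms(3) V0(3)] .
  moreover have "V 1 ?y"
    using V_divide0[OF assms(3,2)] s u by (simp add: V_minus_iff)
  ultimately have "res (1 - sfun u y / y + polyv H ?y) (1 - 0 + poly H 0)"
    by (intro res_add res_diff res_1 res_0 res_polyv)
  then show ?thesis
    unfolding r' by (rule nonconst_add[OF nu])
qed

text \<open>
  To first order in \<open>y\<close>, two steps multiply \<open>y\<close> by the constant \<open>(e + 2) / e\<close> and add to \<open>u - e\<close> a constant
  multiple of \<open>y\<close>. So the direction \<open>(u - e) / y\<close> undergoes an affine map with constant
  coefficients and its residue remains non-constant. Only the scaling factor \<open>t\<close> has to be
  known exactly; for the translation \<open>\<kappa>\<close> it is enough that some complex number is its residue.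
\<close>

lemma zero_two_steps:
  assumes zs: "zero_state (c e) j u y" and e: "e \<noteq> 0" "e + 2 \<noteq> 0"
    and nc: "nonconst ((u - c e) / y)"
  defines "u1 \<equiv> next_u u y" and "y1 \<equiv> next_y u y"
  defines "u2 \<equiv> next_u u1 y1" and "y2 \<equiv> next_y u1 y1"
  assumes y2: "y2 \<noteq> 0"
  shows "zero_state (c (e + coeff F 0)) j u2 y2 \<and> nonconst ((u2 - c (e + coeff F 0)) / y2)"
proof -
  let ?a = "coeff F 0"
  from zs have y: "y \<noteq> 0" "v y = j" "j \<ge> 1" and ue: "res u e"
    by (auto simp: zero_state_def res_def)
  have ne: "\<not> V 1 (c e)"
    using res_V1_iff[OF res_c] e by simp
  have u: "u \<noteq> 0"
    using zero_state_v(1)[OF zs ne] .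
  have ry: "res y 0"
    using y by (intro res_0) (simp add: V_def)
  define q where "q = - ((u + 1) / u)"
  have rq: "res q (- ((e + 1) / e))"
    unfolding q_def using ue e by (intro res_minus res_divide res_add res_1)
  have y1q: "y1 + 1 = q * y"
    using u y by (simp add: y1_def next_y_def q_def field_simps)
  have "res (q * y - 1) (- ((e + 1) / e) * 0 - 1)"
    by (intro res_diff res_mult rq ry res_1)
  then have ry1: "res y1 (- 1)"
    unfolding y1q[symmetric] by simp
  then have y1n: "y1 \<noteq> 0"
    using res_V1_iff[OF ry1] V_0 by auto
  define g where "g = u - 1 + polyv F y1"
  have rg: "res g (e - 1 + poly F (- 1))"
    unfolding g_def using ue ry1 by (intro res_add res_diff res_1 res_polyv)
  have u1g: "u1 = u / y + g"
    by (simp add: u1_def next_u_def g_def y1_def)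
  have u1y: "u1 * y = u + g * y"
    using y by (simp add: u1g field_simps)
  have ru1y: "res (u1 * y) (e + (e - 1 + poly F (- 1)) * 0)"
    unfolding u1y by (intro res_add res_mult ue rg ry)
  have u1n: "u1 \<noteq> 0"
    using res_V1_iff[OF ru1y] e V_0 by auto
  define t where "t = - q - y1 / (u1 * y)"
  have ty: "y2 = t * y"
    using u1n y y1q by (simp add: t_def y2_def next_y_def field_simps)
  have "res t (- (- ((e + 1) / e)) - (- 1) / (e + (e - 1 + poly F (- 1)) * 0))"
    unfolding t_def using e by (intro res_diff res_minus rq res_divide[OF ry1 ru1y]) auto
  moreover have "- (- ((e + 1) / e)) - (- 1) / (e + (e - 1 + poly F (- 1)) * 0) = (e + 2) / e"
    using e by (simp add: field_simps)
  ultimately have rt: "res t ((e + 2) / e)"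
    by simp
  have tn: "t \<noteq> 0"
    using y2 ty by auto
  have te: "(e + 2) / e \<noteq> 0"
    using e by simp
  have "\<not> V 1 t"
    using res_V1_iff[OF rt] te by blast
  then have vt: "v t = 0"
    using tn res_V0[OF rt] by (auto simp: V_def)
  have vy2: "v y2 = j"
    using ty tn y vt by (simp add: v_mult)
  have ry2: "res y2 0"
    using y2 vy2 y by (intro res_0) (simp add: V_def)
  obtain H where H: "F = pCons ?a H"
    by (metis coeff_pCons_0 pCons_cases)
  have FH: "polyv F y2 = c ?a + y2 * polyv H y2"
    using polyv_pCons[of ?a H y2] H by simp
  define A where "A = - (u + 1) + g * q * y"
  have A: "u1 * (y1 + 1) = A"
  proof -
    have "u1 * (y1 + 1) = (u1 * y) * q"
      by (simp add: y1q)
    also have "\<dots> = u * q + g * q * y"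
      unfolding u1y by (simp add: algebra_simps)
    also have "u * q = - (u + 1)"
      using u by (simp add: q_def)
    finally show ?thesis
      by (simp add: A_def)
  qed
  define \<kappa> where "\<kappa> = - (g * q) + A * q / y1 + t * polyv H y2"
  have "res A (- (e + 1) + (e - 1 + poly F (- 1)) * (- ((e + 1) / e)) * 0)"
    unfolding A_def by (intro res_add res_minus res_mult ue rg rq ry res_1)
  then obtain \<alpha> where rA: "res A \<alpha>"
    by blast
  have rk: "res \<kappa> (- ((e - 1 + poly F (- 1)) * (- ((e + 1) / e))) + \<alpha> * (- ((e + 1) / e)) / (- 1)
      + (e + 2) / e * poly H 0)"
    unfolding \<kappa>_def
    by (intro res_add res_minus res_mult rg rq rA res_divide ry1 rt res_polyv ry2) simp
  have uy1: "u1 + u1 / y1 = A / y1"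
    unfolding A[symmetric] using y1n by (simp add: field_simps)
  have Ay: "A / y1 = - A + A * q * y / y1"
  proof -
    have "A * q * y = A * (y1 + 1)"
      by (simp add: y1q)
    then show ?thesis
      using y1n by (simp add: field_simps)
  qed
  have "u2 = A / y1 - 1 + polyv F y2"
    using uy1 by (simp add: u2_def y2_def next_u_def algebra_simps)
  also have "\<dots> = - A + A * q * y / y1 - 1 + c ?a + t * y * polyv H y2"
    unfolding FH Ay by (simp add: ty)
  finally have "u2 - c (e + ?a) = (u - c e) + y * \<kappa>"
    by (simp add: A_def \<kappa>_def c_add algebra_simps)
  then have "(u2 - c (e + ?a)) / y = (u - c e) / y + \<kappa>"
    using y by (simp add: field_simps)
  then have r2: "(u2 - c (e + ?a)) / y2 = ((u - c e) / y + \<kappa>) / t"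
    unfolding ty by (metis divide_divide_eq_left mult.commute)
  have nc2: "nonconst ((u2 - c (e + ?a)) / y2)"
    unfolding r2 by (rule nonconst_divide[OF nonconst_add[OF nc rk] rt te])
  have "V 1 (y2 * ((u2 - c (e + ?a)) / y2))"
    by (rule V_mult0_right[OF ry2[unfolded res_0_iff] nonconst_V0[OF nc2]])
  then have "V 1 (u2 - c (e + ?a))"
    using y2 by (simp only: nonzero_mult_div_cancel_left times_divide_eq_right not_False_eq_True)
  then show ?thesis
    using nc2 y2 vy2 y(3) V_c by (simp add: zero_state_def)
qed

text \<open>
  At \<open>u = y = 0\<close> with direction \<open>r = u / y\<close> the next value of \<open>y\<close> is \<open>- 1 - 1 / r\<close> up to small terms. Its
  residue is not constant, in particular not zero.
\<close>

lemma corner_step: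
  assumes zs: "zero_state (c 0) j u y" and nc: "nonconst ((u - c 0) / y)"
  shows "u \<noteq> 0" "v u = j" "v (sfun u y) = j"
    and "generic_state (next_u u y) (next_y u y)" "\<not> (\<exists>w. res (next_y u y) w)"
proof -
  have y: "y \<noteq> 0" "v y = j" "j \<ge> 1" "V 1 y" and u1: "V 1 u"
    using zs by (auto simp: zero_state_def V_def c_0)
  define r where "r = u / y"
  have r: "nonconst r" and u: "u = r * y"
    using nc y by (auto simp: r_def c_0)
  have rn: "V 0 r" "\<not> V 1 r"
    using nonconst_V0[OF r] nonconst_not_V1[OF r] by auto
  then have r0: "r \<noteq> 0" "v r = 0"
    by (auto simp: V_def)
  then show un: "u \<noteq> 0" and vu: "v u = j"
    using y by (auto simp: u v_mult)
  have ru: "res u 0" "res y 0"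
    using u1 y res_0 by auto
  have "sfun u y = y * (r + 1 + u)"
    using y by (simp add: sfun_def u algebra_simps)
  moreover have "nonconst (r + (1 + u))"
    by (rule nonconst_add[OF r res_add[OF res_1 ru(1)]])
  then have "r + 1 + u \<noteq> 0 \<and> v (r + 1 + u) = 0"
    using nonconst_V0 nonconst_not_V1 by (intro v_eqI) (auto simp: add.assoc)
  ultimately show "v (sfun u y) = j"
    using y by (simp add: v_mult)
  have "next_y u y = - (1 / r + (y + 1))"
    using y r0 by (simp add: next_y_def u field_simps)
  moreover have "nonconst (1 / r + (y + 1))"
    by (rule nonconst_add[OF nonconst_inverse[OF r] res_add[OF ru(2) res_1]])
  ultimately have ny: "nonconst (next_y u y)"
    using nonconst_minus by (simp only:)
  then show "\<not> (\<exists>w. res (next_y u y) w)"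
    by (simp add: nonconst_def)
  have "V 0 (u - 1 + u / y + polyv F (next_y u y))"
    using rn r_def V_mono[OF u1] nonconst_V0[OF ny]
    by (intro V_add V_diff V_1 V_polyv) auto
  then show "generic_state (next_u u y) (next_y u y)"
    using nonconst_V0[OF ny] nonconst_not_V1[OF ny] by (simp add: generic_state_def next_u_def)
qed

end

section \<open>Orders of zeros and poles along an orbit\<close>

text \<open>
  The three alternatives of \<open>start\<close> are the line at infinity, a curve other than the two coordinate
  lines \<open>x\<^sub>0 = 0\<close> and \<open>x\<^sub>2 = 0\<close>, and the line \<open>y = 0\<close>.
\<close>

locale k_orbit = k_valuation +
  fixes u y :: "nat \<Rightarrow> 'a"
  assumes u_Suc: "u (Suc p) = next_u (u p) (y p)"
    and y_Suc: "y (Suc p) = next_y (u p) (y p)"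
    and u_nz: "u p \<noteq> 0" and y_nz: "y p \<noteq> 0"
    and start: "(v (u 0) = - 1 \<and> v (y 0) = - 1)
      \<or> (generic_state (u 0) (y 0) \<and> \<not> (\<exists>z w. res (u 0) z \<and> res (y 0) w))
      \<or> (\<exists>j. zero_state (u 0) j (u 0) (y 0) \<and> nonconst (u 0))"
begin

abbreviation s where "s p \<equiv> sfun (u p) (y p)"

text \<open>
  If \<open>(u, y) = (U / W, Y / W)\<close> with \<open>W\<close>, \<open>U\<close>, \<open>Y\<close> coprime, these are the multiplicities of the denominator of
  \<open>y\<close>, of \<open>W\<close>, of \<open>gcd U Y\<close>, and of the part of \<open>s\<close> that vanishes at generic points.
\<close>

definition y_pole :: "nat \<Rightarrow> int" where "y_pole p = max 0 (- v (y p))"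
definition pole :: "nat \<Rightarrow> int" where "pole p = max 0 (max (- v (u p)) (- v (y p)))"
definition common_zero :: "nat \<Rightarrow> int" where "common_zero p = max 0 (min (v (u p)) (v (y p)))"
definition s_zero :: "nat \<Rightarrow> int" where
  "s_zero p = (if v (u p) = 0 \<and> v (y p) = 0 then v (s p) else 0)"

text \<open>
  The two balances express in multiplicities where poles come from: a pole of \<open>y\<close> arises exactly from a zero
  of \<open>u\<close> outside \<open>u = y = 0\<close> and is permanent, while the remaining part of \<open>pole\<close>, which is
  \<open>pole - n * y_pole\<close>, arises from a zero of \<open>y\<close> and lasts one step. The line at infinity, which has poles from
  the start, satisfies the same equations.
\<close>

definition pole_balance :: "nat \<Rightarrow> bool" where
  "pole_balance p \<longleftrightarrow> y_pole (Suc p) + common_zero p = y_pole p + v (u p) + pole p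
    \<and> v (y p) + y_pole p + int n * y_pole (Suc p) = pole (Suc p) + common_zero p"

definition s_balance :: "nat \<Rightarrow> bool" where
  "s_balance p \<longleftrightarrow> s_zero p + common_zero p = v (s p) + int (n + 1) * y_pole p"

lemma infinite_Suc: "infinite_state j (u p) (y p) \<Longrightarrow> infinite_state j (u (Suc p)) (y (Suc p))"
  unfolding u_Suc y_Suc by (rule infinite_step)

lemma infinite_counts:
  assumes "infinite_state j (u p) (y p)"
  shows "y_pole p = j" "pole p = int n * j" "common_zero p = 0" "s_zero p = 0"
proof -
  have j: "j \<ge> 1" and y: "v (y p) = - j" and u: "v (u p) = - (int n * j)"
    using assms infinite_v_u[OF assms] by (auto simp: infinite_state_def)
  have "1 * j \<le> int n * j"
    using j n_pos by (intro mult_right_mono) auto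
  then show "y_pole p = j" "pole p = int n * j" "common_zero p = 0" "s_zero p = 0"
    using j y u by (auto simp: y_pole_def pole_def common_zero_def s_zero_def)
qed

lemma infinite_balance:
  assumes "infinite_state j (u p) (y p)"
  shows "pole_balance p" "s_balance p" "common_zero p = 0"
proof -
  have "v (y p) = - j" "v (u p) = - (int n * j)"
    using assms infinite_v_u[OF assms] by (auto simp: infinite_state_def)
  then show "pole_balance p" "s_balance p" "common_zero p = 0"
    using infinite_counts[OF assms] infinite_counts[OF infinite_Suc[OF assms]]
      infinite_v_s[OF assms]
    by (auto simp: pole_balance_def s_balance_def algebra_simps)
qed

lemma generic_counts:
  assumes "generic_state (u p) (y p)"
  shows "y_pole p = 0" "pole p = 0" "common_zero p = 0" "s_zero p = v (s p)" "s_balance p"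
    "v (y p) = 0" "s_zero p \<ge> 0"
proof -
  note g = generic_v[OF assms u_nz]
  have "s p \<noteq> 0"
    using sfun_next_y[OF u_nz, of p "y p"] y_Suc[of p] y_nz[of "Suc p"] u_nz[of p] by simp
  then have vs: "v (s p) \<ge> 0"
    using g(4) by (simp add: V_def)
  have *: "v (s p) = 0" if "v (u p) \<noteq> 0"
    using that g(3) g(5) by (auto simp: V_def)
  show "y_pole p = 0" "pole p = 0" "common_zero p = 0" "v (y p) = 0"
    using g(2,3) by (auto simp: y_pole_def pole_def common_zero_def)
  moreover show "s_zero p = v (s p)" "s_zero p \<ge> 0"
    using * g(2) vs by (auto simp: s_zero_def)
  ultimately show "s_balance p"
    by (simp add: s_balance_def)
qed

lemma generic_cases:
  assumes "generic_state (u p) (y p)"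
  obtains (infinite) "pole_balance p" "infinite_state (v (u p)) (u (Suc p)) (y (Suc p))"
  | (generic) "pole_balance p" "\<not> V 1 (u p)" "\<not> V 1 (s p)"
      "generic_state (u (Suc p)) (y (Suc p))"
  | (zero) "pole_balance p" "\<not> V 1 (u p)" "V 1 (s p)"
      "zero_state (c (coeff F 0 - 2)) (s_zero p) (u (Suc p)) (y (Suc p))"
proof -
  note g = generic_counts[OF assms]
  consider "V 1 (u p)" | "\<not> V 1 (u p)" "\<not> V 1 (s p)" | "\<not> V 1 (u p)" "V 1 (s p)"
    by blast
  then show ?thesis
  proof cases
    case 1
    then have i: "infinite_state (v (u p)) (u (Suc p)) (y (Suc p))"
      unfolding u_Suc y_Suc by (rule generic_u_zero_step[OF assms _ u_nz])
    then have "pole_balance p"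
      using g infinite_counts[OF i] by (simp add: pole_balance_def)
    then show ?thesis
      using i infinite by blast
  next
    case 2
    then have i: "generic_state (u (Suc p)) (y (Suc p))"
      unfolding u_Suc y_Suc by (rule generic_step[OF assms])
    moreover have "v (u p) = 0"
      using 2(1) generic_v(3)[OF assms u_nz] by (auto simp: V_def)
    ultimately have "pole_balance p"
      using g generic_counts[OF i] by (simp add: pole_balance_def)
    then show ?thesis
      using i 2 generic by blast
  next
    case 3
    have i: "zero_state (c (coeff F 0 - 2)) (v (s p)) (u (Suc p)) (y (Suc p))"
      using y_nz[of "Suc p"] unfolding u_Suc y_Suc by (rule generic_s_zero_step[OF assms 3])
    then have "V 0 (u (Suc p))" "v (y (Suc p)) \<ge> 1"
      using V_add[of 0 "u (Suc p) - c (coeff F 0 - 2)" "c (coeff F 0 - 2)"] V_mono[of 1 _ 0] V_c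
      by (auto simp: zero_state_def)
    then have "y_pole (Suc p) = 0" "pole (Suc p) = 0"
      using u_nz[of "Suc p"] by (auto simp: y_pole_def pole_def V_def)
    moreover have "v (u p) = 0"
      using 3(1) generic_v(3)[OF assms u_nz] by (auto simp: V_def)
    ultimately have "pole_balance p"
      using g by (simp add: pole_balance_def)
    then show ?thesis
      using i 3 zero g(4) by simp
  qed
qed

lemma zero_Suc:
  assumes "zero_state e j (u p) (y p)" "\<not> V 1 e"
  shows "pole_state e j (u (Suc p)) (y (Suc p))"
  unfolding u_Suc y_Suc by (rule zero_step[OF assms])

lemma pole_Suc:
  assumes "pole_state e j (u p) (y p)"
  shows "\<exists>i. zero_state (e + c (coeff F 0)) i (u (Suc p)) (y (Suc p))"
  using pole_step[OF assms] y_nz[of "Suc p"] unfolding u_Suc y_Suc by blast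

lemma zero_poles:
  assumes "zero_state e j (u p) (y p)"
  shows "y_pole p = 0" "pole p = 0" "v (y p) = j" "j \<ge> 1"
proof -
  have "V 0 (u p)" and y: "v (y p) = j" "j \<ge> 1"
    using assms V_add[of 0 "u p - e" e] V_mono[of 1 "u p - e" 0] by (auto simp: zero_state_def)
  then show "y_pole p = 0" "pole p = 0" "v (y p) = j" "j \<ge> 1"
    using u_nz[of p] by (auto simp: y_pole_def pole_def V_def)
qed

lemma pole_counts:
  assumes "pole_state e j (u p) (y p)"
  shows "y_pole p = 0" "pole p = j" "common_zero p = 0" "v (y p) = 0" "s_zero p = 0"
    "pole_balance p"
proof -
  have u: "v (u p) = - j" "j \<ge> 1"
    using assms by (auto simp: pole_state_def)
  show "y_pole p = 0" "pole p = j" "common_zero p = 0" "v (y p) = 0" "s_zero p = 0"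
    using u pole_state_v(2)[OF assms]
    by (auto simp: y_pole_def pole_def common_zero_def s_zero_def)
  moreover obtain i where "zero_state (e + c (coeff F 0)) i (u (Suc p)) (y (Suc p))"
    using pole_Suc[OF assms] by blast
  ultimately show "pole_balance p"
    using zero_poles u by (simp add: pole_balance_def)
qed

lemma pole_s_balance:
  assumes "pole_state e j (u p) (y p)" "\<not> V 1 (e + 2)"
  shows "s_balance p"
  using pole_counts[OF assms(1)] pole_state_v(3)[OF assms] by (simp add: s_balance_def)

lemma zero_balance:
  assumes "zero_state e j (u p) (y p)" "\<not> V 1 e"
  shows "pole_balance p" "s_balance p" "common_zero p = 0" "s_zero p = 0"
proof -
  note z = zero_state_v[OF assms] and q = zero_poles[OF assms(1)]
  show c: "common_zero p = 0" "s_zero p = 0"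
    using z q by (auto simp: common_zero_def s_zero_def)
  show "pole_balance p" "s_balance p"
    using z q c pole_counts[OF zero_Suc[OF assms]] by (auto simp: pole_balance_def s_balance_def)
qed

lemma start_at_infinity:
  assumes "v (u 0) = - 1" "v (y 0) = - 1"
  shows "infinite_state 1 (u 1) (y 1)"
    and "pole_balance 0" "common_zero 0 = 0" "s_zero 0 = 0" "v (s 0) + 2 * pole 0 = 0"
proof -
  show i: "infinite_state 1 (u 1) (y 1)"
    using line_at_infinity_step[OF u_nz y_nz assms] u_Suc[of 0] y_Suc[of 0] by simp
  show z: "common_zero 0 = 0" "s_zero 0 = 0"
    using assms by (auto simp: common_zero_def s_zero_def)
  show "pole_balance 0"
    using assms z infinite_counts[OF i] by (simp add: pole_balance_def y_pole_def pole_def)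
  have uy: "v (u 0 * y 0) = - 2" "u 0 * y 0 \<noteq> 0"
    using assms u_nz y_nz by (auto simp: v_mult)
  have "V (- 1) (u 0 + y 0)"
    using V_v[of "u 0"] V_v[of "y 0"] assms by (intro V_add) auto
  then have "v (s 0) = - 2"
    using v_perturb[OF uy(2), of "s 0"] uy(1) by (simp add: sfun_def add.assoc)
  then show "v (s 0) + 2 * pole 0 = 0"
    using assms by (simp add: pole_def)
qed

text \<open>
  Each cycle through \<open>zero_state\<close> and \<open>pole_state\<close> adds \<open>a\<^sub>0\<close> to the parameter, so this condition keeps the orbit
  away from \<open>u = y = 0\<close>.
\<close>

definition never_small :: "'a \<Rightarrow> bool" where
  "never_small e \<longleftrightarrow> (\<forall>k::nat. \<not> V 1 (e + c (of_nat k * coeff F 0)))"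

lemma never_small_not_V1: "never_small e \<Longrightarrow> \<not> V 1 e"
  unfolding never_small_def by (metis add_0_right c_0 mult_zero_left of_nat_0)

lemma never_small_add: "never_small e \<Longrightarrow> never_small (e + c (coeff F 0))"
  unfolding never_small_def
proof
  fix k :: nat
  assume "\<forall>k::nat. \<not> V 1 (e + c (of_nat k * coeff F 0))"
  then have "\<not> V 1 (e + c (of_nat (Suc k) * coeff F 0))"
    by blast
  then show "\<not> V 1 (e + c (coeff F 0) + c (of_nat k * coeff F 0))"
    by (simp add: c_add algebra_simps)
qed

lemma nonconst_never_small:
  assumes "nonconst e"
  shows "never_small e"
  unfolding never_small_def
  by (intro allI nonconst_not_V1 nonconst_add[OF assms res_c])

text \<open>
  The orbit enters \<open>zero_state\<close> with parameter \<open>a\<^sub>0 - 2\<close>, and \<open>a\<^sub>0 - 2 + k a\<^sub>0 = 0\<close> means \<open>a\<^sub>0 = 2 / (1 + k)\<close>.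
  On the line \<open>y = 0\<close> the parameter has a non-constant residue and can never be small.
\<close>

lemma balance_without_corner:
  assumes a0: "\<And>m::nat. coeff F 0 \<noteq> 2 / (1 + of_nat m)"
  shows "pole_balance p \<and> common_zero p = 0"
proof -
  have "never_small (c (coeff F 0 - 2))"
    unfolding never_small_def
  proof
    fix k :: nat
    have k: "(1 + of_nat k :: complex) \<noteq> 0"
      by (metis of_nat_Suc of_nat_neq_0)
    have "coeff F 0 - 2 + of_nat k * coeff F 0 = (1 + of_nat k) * (coeff F 0 - 2 / (1 + of_nat k))"
      using k by (simp add: field_simps)
    then have "coeff F 0 - 2 + of_nat k * coeff F 0 \<noteq> 0"
      using a0[of k] k by simp
    then show "\<not> V 1 (c (coeff F 0 - 2) + c (of_nat k * coeff F 0))"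
      using res_V1_iff[OF res_c] c_add by metis
  qed
  note ns = this
  define inv where "inv p \<longleftrightarrow> generic_state (u p) (y p)
    \<or> (\<exists>j. infinite_state j (u p) (y p))
    \<or> (\<exists>e j. zero_state e j (u p) (y p) \<and> never_small e)
    \<or> (\<exists>e j. pole_state e j (u p) (y p) \<and> never_small e)" for p
  have step: "inv (Suc p) \<and> pole_balance p \<and> common_zero p = 0" if "inv p" for p
    using that unfolding inv_def[of p]
  proof (elim disjE exE conjE)
    assume g: "generic_state (u p) (y p)"
    show ?thesis
      using generic_counts(3)[OF g] ns by (cases rule: generic_cases[OF g]) (auto simp: inv_def)
  next
    fix j assume i: "infinite_state j (u p) (y p)"
    show ?thesis
      using infinite_Suc[OF i] infinite_balance[OF i] by (auto simp: inv_def)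
  next
    fix e j assume z: "zero_state e j (u p) (y p)" and e: "never_small e"
    show ?thesis
      using zero_balance[OF z never_small_not_V1[OF e]] zero_Suc[OF z never_small_not_V1[OF e]] e
      by (auto simp: inv_def)
  next
    fix e j assume z: "pole_state e j (u p) (y p)" and e: "never_small e"
    show ?thesis
      using pole_counts[OF z] pole_Suc[OF z] never_small_add[OF e] by (auto simp: inv_def)
  qed
  have "(inv 0 \<or> inv 1) \<and> (\<not> inv 0 \<longrightarrow> pole_balance 0 \<and> common_zero 0 = 0)"
    using start start_at_infinity nonconst_never_small by (auto simp: inv_def)
  moreover have "inv 1" if "inv 0"
    using step[OF that] by simp
  ultimately have "inv (Suc p)" for p
    using step by (induction p) auto
  then have "inv p \<or> p = 0 \<and> \<not> inv 0"
    by (cases p) auto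
  then show ?thesis
    using step \<open>(inv 0 \<or> inv 1) \<and> (\<not> inv 0 \<longrightarrow> pole_balance 0 \<and> common_zero 0 = 0)\<close> by blast
qed

end

context k_orbit
begin

text \<open>
  The residue of \<open>u\<close> after \<open>k\<close> cycles that started from a zero of \<open>s\<close>.
\<close>

definition mark :: "nat \<Rightarrow> complex" where
  "mark k = of_nat (Suc k) * coeff F 0 - 2"

definition marked :: "nat \<Rightarrow> int \<Rightarrow> nat \<Rightarrow> bool" where
  "marked k j p \<longleftrightarrow> zero_state (c (mark k)) j (u p) (y p) \<and> nonconst ((u p - c (mark k)) / y p)"

definition varying :: "nat \<Rightarrow> bool" where
  "varying p \<longleftrightarrow> \<not> (\<exists>z w. res (u p) z \<and> res (y p) w)"

lemma generic_marked:
  assumes "generic_state (u p) (y p)" "varying p" "\<not> V 1 (u p)" "V 1 (s p)"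
    and "zero_state (c (coeff F 0 - 2)) (s_zero p) (u (Suc p)) (y (Suc p))"
  shows "marked 0 (s_zero p) (Suc p)"
  using generic_s_zero_nonconst[OF assms(1,3,4)] assms(2,5) y_nz[of "Suc p"]
  unfolding u_Suc y_Suc by (simp add: marked_def mark_def varying_def u_Suc y_Suc)

lemma generic_varying:
  assumes "generic_state (u p) (y p)" "varying p" "\<not> V 1 (u p)" "\<not> V 1 (s p)"
  shows "varying (Suc p)"
  using generic_step_nonconst[OF assms(1,3,4)] assms(2)
  unfolding varying_def u_Suc y_Suc by blast

context
  fixes m :: nat
  assumes a0: "coeff F 0 = 2 / (1 + of_nat m)"
begin

lemma mark_less:
  assumes "k < m"
  shows "mark k \<noteq> 0" "mark k + 2 \<noteq> 0" "mark k + coeff F 0 = mark (Suc k)"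
proof -
  have m: "(1 + of_nat m :: complex) \<noteq> 0"
    by (metis of_nat_Suc of_nat_neq_0)
  show "mark k + 2 \<noteq> 0"
    using m by (simp add: mark_def a0 del: of_nat_Suc)
  have "mark k = 2 * (of_nat k - of_nat m) / (1 + of_nat m)"
    using m by (simp add: mark_def a0 field_simps)
  then show "mark k \<noteq> 0"
    using m assms by simp
  show "mark k + coeff F 0 = mark (Suc k)"
    by (simp add: mark_def algebra_simps)
qed

lemma mark_m: "mark m = 0"
proof -
  have "(1 + of_nat m :: complex) \<noteq> 0"
    by (metis of_nat_Suc of_nat_neq_0)
  then show ?thesis
    by (simp add: mark_def a0 nonzero_divide_eq_eq)
qed

text \<open>
  For \<open>k < m\<close> neither \<open>mark k\<close> nor \<open>mark k + 2\<close> is zero. The former keeps the orbit in the cycle, the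
  latter prevents an additional zero of \<open>s\<close> at the pole and a change of the order \<open>j\<close>.
\<close>

lemma marked_less:
  assumes "marked k j p" "k < m"
  shows "pole_state (c (mark k)) j (u (Suc p)) (y (Suc p))"
    and "pole_balance p" "s_balance p" "common_zero p = 0" "s_zero p = 0"
    and "pole_balance (Suc p)" "s_balance (Suc p)" "common_zero (Suc p) = 0" "s_zero (Suc p) = 0"
    and "marked (Suc k) j (Suc (Suc p))"
proof -
  have z: "zero_state (c (mark k)) j (u p) (y p)" and r: "nonconst ((u p - c (mark k)) / y p)"
    using assms(1) by (auto simp: marked_def)
  note mk = mark_less[OF assms(2)]
  have n1: "\<not> V 1 (c (mark k))"
    using mk(1) res_V1_iff[OF res_c] by simp
  show p: "pole_state (c (mark k)) j (u (Suc p)) (y (Suc p))"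
    by (rule zero_Suc[OF z n1])
  show "pole_balance p" "s_balance p" "common_zero p = 0" "s_zero p = 0"
    using zero_balance[OF z n1] .
  have "c (mark k) + 2 = c (mark k + 2)"
    using c_of_nat[of 2] by (simp add: c_add)
  then have "\<not> V 1 (c (mark k) + 2)"
    using mk(2) res_V1_iff[OF res_c] by simp
  then show "pole_balance (Suc p)" "s_balance (Suc p)" "common_zero (Suc p) = 0" "s_zero (Suc p) = 0"
    using pole_counts[OF p] pole_s_balance[OF p] by auto
  show "marked (Suc k) j (Suc (Suc p))"
    using zero_two_steps[OF z mk(1,2) r] y_nz[of "Suc (Suc p)"] mk(3)
    by (simp add: marked_def u_Suc y_Suc)
qed

lemma marked_corner:
  assumes "marked m j p"
  shows "common_zero p = j" "s_zero p = 0" "pole_balance p" "s_balance p"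
    "generic_state (u (Suc p)) (y (Suc p))" "varying (Suc p)"
proof -
  have z: "zero_state (c 0) j (u p) (y p)" and r: "nonconst ((u p - c 0) / y p)"
    using assms by (auto simp: marked_def mark_m)
  note s = corner_step[OF z r] and q = zero_poles[OF z]
  show g: "generic_state (u (Suc p)) (y (Suc p))" and "varying (Suc p)"
    using s(4,5) by (auto simp: u_Suc y_Suc varying_def)
  show cz: "common_zero p = j" "s_zero p = 0"
    using s q by (auto simp: common_zero_def s_zero_def)
  then show "pole_balance p" "s_balance p"
    using s q generic_counts[OF g] by (auto simp: pole_balance_def s_balance_def)
qed

lemma marked_trajectory:
  "marked 0 j p \<Longrightarrow> k \<le> m \<Longrightarrow> marked k j (p + 2 * k)"
proof (induction k)
  case (Suc k)
  then show ?case
    using marked_less(10)[of k j "p + 2 * k"] by simp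
qed simp

text \<open>
  A marked state remembers the time \<open>q\<close> of the zero of \<open>s\<close> from which it comes, and that the order is still the same.
  Thus a common zero of \<open>u\<close> and \<open>y\<close> can be traced back to its origin.
\<close>

definition status :: "nat \<Rightarrow> bool" where
  "status p \<longleftrightarrow> (generic_state (u p) (y p) \<and> varying p)
    \<or> (\<exists>j. infinite_state j (u p) (y p))
    \<or> (\<exists>e j. zero_state e j (u p) (y p) \<and> nonconst e)
    \<or> (\<exists>e j. pole_state e j (u p) (y p) \<and> nonconst e)
    \<or> (\<exists>k q. p = Suc q + 2 * k \<and> k \<le> m \<and> marked k (s_zero q) p)
    \<or> (\<exists>k q. p = Suc (Suc q + 2 * k) \<and> k < m \<and> marked k (s_zero q) (Suc q + 2 * k))"

lemma status_Suc:
  assumes "status p"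
  shows "status (Suc p) \<and> pole_balance p \<and> s_balance p \<and> s_zero p \<ge> 0
    \<and> (s_zero p = 0 \<or> marked 0 (s_zero p) (Suc p))
    \<and> (common_zero p = 0 \<or> (\<exists>q. p = q + (2 * m + 1) \<and> common_zero p = s_zero q))"
  using assms unfolding status_def[of p]
proof (elim disjE exE conjE)
  assume g: "generic_state (u p) (y p)" and n: "varying p"
  have z: "s_zero p = 0" if "\<not> V 1 (u p)" "\<not> V 1 (s p)"
    using that generic_v(4)[OF g u_nz] generic_counts(4,7)[OF g] by (auto simp: V_def)
  have z': "s_zero p = 0" if "V 1 (u p)"
    using generic_v(5)[OF g u_nz that] generic_counts(4)[OF g] by simp
  from g show ?thesis
  proof (cases rule: generic_cases)
    case infinite
    have "V 1 (u p)"
      using infinite(2) by (auto simp: infinite_state_def V_def)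
    then show ?thesis
      using infinite z' generic_counts[OF g] by (auto simp: status_def)
  next
    case generic
    then show ?thesis
      using z generic_varying[OF g n] generic_counts[OF g] by (auto simp: status_def)
  next
    case zero
    have mk: "marked 0 (s_zero p) (Suc p)"
      by (rule generic_marked[OF g n zero(2-4)])
    then have "\<exists>k q. Suc p = Suc q + 2 * k \<and> k \<le> m \<and> marked k (s_zero q) (Suc p)"
      by (intro exI[of _ 0] exI[of _ p]) simp
    then have "status (Suc p)"
      unfolding status_def by blast
    then show ?thesis
      using mk zero(1) generic_counts[OF g] by auto
  qed
next
  fix j assume i: "infinite_state j (u p) (y p)"
  show ?thesis
    using infinite_Suc[OF i] infinite_balance[OF i] infinite_counts[OF i] by (auto simp: status_def)
next
  fix e j assume z: "zero_state e j (u p) (y p)" and e: "nonconst e"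
  show ?thesis
    using zero_balance[OF z nonconst_not_V1[OF e]] zero_Suc[OF z nonconst_not_V1[OF e]] e
    by (auto simp: status_def)
next
  fix e j assume z: "pole_state e j (u p) (y p)" and e: "nonconst e"
  have "res 2 2"
    using res_c[of 2] c_of_nat[of 2] by simp
  then have "\<not> V 1 (e + 2)"
    by (intro nonconst_not_V1 nonconst_add[OF e])
  then show ?thesis
    using pole_counts[OF z] pole_s_balance[OF z] pole_Suc[OF z] nonconst_add[OF e res_c]
    by (auto simp: status_def)
next
  fix k q assume p: "p = Suc q + 2 * k" and k: "k \<le> m" and mk: "marked k (s_zero q) p"
  show ?thesis
  proof (cases "k = m")
    case True
    then show ?thesis
      using marked_corner[of "s_zero q" p] mk p by (auto simp: status_def intro!: exI[of _ q])
  next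
    case False
    then have "k < m"
      using k by simp
    moreover from this have "\<exists>k q. Suc p = Suc (Suc q + 2 * k) \<and> k < m \<and> marked k (s_zero q) (Suc q + 2 * k)"
      using mk p by (intro exI[of _ k] exI[of _ q]) simp
    then have "status (Suc p)"
      unfolding status_def by blast
    ultimately show ?thesis
      using marked_less[OF mk] by auto
  qed
next
  fix k q assume p: "p = Suc (Suc q + 2 * k)" and k: "k < m"
    and mk: "marked k (s_zero q) (Suc q + 2 * k)"
  have "\<exists>k q. Suc p = Suc q + 2 * k \<and> k \<le> m \<and> marked k (s_zero q) (Suc p)"
    using marked_less(10)[OF mk k] k p by (intro exI[of _ "Suc k"] exI[of _ q]) simp
  then have "status (Suc p)"
    unfolding status_def by blast
  then show ?thesis
    using marked_less[OF mk k] p by auto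
qed

lemma status_start: "status 0 \<or> (status 1 \<and> v (u 0) = - 1 \<and> v (y 0) = - 1)"
  using start start_at_infinity(1) by (auto simp: status_def varying_def)

lemma status_pos: "status (Suc p)"
proof (induction p)
  case 0
  then show ?case
    using status_start status_Suc[of 0] by auto
next
  case (Suc p)
  then show ?case
    using status_Suc by blast
qed

lemma s_zero_cases: "s_zero p = 0 \<or> marked 0 (s_zero p) (Suc p)"
  using status_start start_at_infinity(4) status_Suc[of p] status_pos[of "p - 1"]
  by (cases p) auto

text \<open>
  A zero of \<open>s\<close> reaches \<open>u = y = 0\<close> after one step and \<open>m\<close> cycles, and by \<open>status\<close> nothing else does.
\<close>

lemma common_zero_eq_s_zero: "common_zero (p + (2 * m + 1)) = s_zero p"
proof (cases "s_zero p = 0")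
  case True
  then show ?thesis
    using status_Suc[OF status_pos[of "p + 2 * m"]] by auto
next
  case False
  then have "marked m (s_zero p) (Suc p + 2 * m)"
    using s_zero_cases[of p] marked_trajectory[of "s_zero p" "Suc p" m] by auto
  then show ?thesis
    using marked_corner(1) by (simp add: add.commute)
qed

text \<open>
  On the line at infinity \<open>s_balance\<close> fails at time \<open>0\<close>, because this line has a simple pole of \<open>y\<close> but \<open>u\<close>
  does not have the pole of order \<open>n\<close> that belongs to \<open>infinite_state\<close>. Therefore time \<open>0\<close> has
  its own formula.
\<close>

lemma balance_with_corner:
  shows "pole_balance p"
    and "p \<le> 2 * m \<Longrightarrow> common_zero p = 0"
    and "p > 0 \<Longrightarrow> common_zero (p + (2 * m + 1)) + common_zero p = v (s p) + int (n + 1) * y_pole p"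
    and "common_zero (2 * m + 1) = v (s 0) + 2 * pole 0"
proof -
  have st: "status p \<or> (p = 0 \<and> v (u 0) = - 1 \<and> v (y 0) = - 1)" for p
    using status_start status_pos[of "p - 1"] by (cases p) auto
  show "pole_balance p"
    using st[of p] status_Suc start_at_infinity(2) by auto
  show "common_zero p = 0" if "p \<le> 2 * m"
    using st[of p] status_Suc[of p] start_at_infinity(3) that by auto
  show "common_zero (p + (2 * m + 1)) + common_zero p = v (s p) + int (n + 1) * y_pole p"
    if "p > 0"
    using st[of p] status_Suc[of p] that common_zero_eq_s_zero[of p] by (auto simp: s_balance_def)
  show "common_zero (2 * m + 1) = v (s 0) + 2 * pole 0"
  proof (cases "v (u 0) = - 1 \<and> v (y 0) = - 1")
    case True
    then show ?thesis
      using start_at_infinity common_zero_eq_s_zero[of 0] by simp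
  next
    case False
    have "pole 0 = 0" "y_pole 0 = 0"
      using False start generic_counts[of 0] zero_poles[of _ _ 0] by auto
    moreover have "s_balance 0" "common_zero 0 = 0"
      using False st[of 0] status_Suc[of 0] by auto
    ultimately show ?thesis
      using common_zero_eq_s_zero[of 0] by (simp add: s_balance_def)
  qed
qed

end

end

section \<open>Total degree and prime divisors of homogeneous polynomials\<close>

definition ring_map :: "('a::comm_ring_1 \<Rightarrow> 'b::comm_ring_1) \<Rightarrow> bool" where
  "ring_map \<phi> \<longleftrightarrow> \<phi> 1 = 1 \<and> (\<forall>a b. \<phi> (a + b) = \<phi> a + \<phi> b) \<and> (\<forall>a b. \<phi> (a * b) = \<phi> a * \<phi> b)"

lemma ring_mapD:
  assumes "ring_map \<phi>"
  shows "\<phi> 1 = 1" "\<phi> 0 = 0" "\<phi> (a + b) = \<phi> a + \<phi> b" "\<phi> (a * b) = \<phi> a * \<phi> b"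
    "\<phi> (- a) = - \<phi> a" "\<phi> (a - b) = \<phi> a - \<phi> b" "\<phi> (a ^ k) = \<phi> a ^ k"
proof -
  show 1: "\<phi> 1 = 1" and add: "\<And>a b. \<phi> (a + b) = \<phi> a + \<phi> b" and mult: "\<And>a b. \<phi> (a * b) = \<phi> a * \<phi> b"
    using assms by (auto simp: ring_map_def)
  show 0: "\<phi> 0 = 0"
    using add[of 0 0] by (metis add_cancel_right_right add_0)
  show m: "\<phi> (- a) = - \<phi> a" for a
    using add[of a "- a"] 0 by (simp add: eq_neg_iff_add_eq_0 add.commute)
  show "\<phi> (a - b) = \<phi> a - \<phi> b"
    using add[of a "- b"] m by simp
  show "\<phi> (a ^ k) = \<phi> a ^ k"
    by (induction k) (simp_all add: 1 mult)
qed

lemma ring_map_map_poly: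
  assumes "ring_map \<phi>"
  shows "ring_map (map_poly \<phi>)"
proof -
  note h = ring_mapD[OF assms]
  have add: "map_poly \<phi> (p + q) = map_poly \<phi> p + map_poly \<phi> q" for p q
    by (rule poly_eqI) (simp add: coeff_map_poly h)
  have "map_poly \<phi> (p * q) = map_poly \<phi> p * map_poly \<phi> q" for p q
    by (induction p) (simp_all add: map_poly_pCons h add map_poly_smult)
  then show ?thesis
    using add h by (simp add: ring_map_def)
qed

lemma ring_map_poly:
  assumes "ring_map \<phi>"
  shows "ring_map (\<lambda>p. poly (map_poly \<phi> p) z)"
  using ring_mapD[OF ring_map_map_poly[OF assms]] by (simp add: ring_map_def)

lemma poly_map_poly_altdef:
  fixes \<phi> :: "'a::zero \<Rightarrow> 'b::comm_semiring_1"
  assumes "\<phi> 0 = 0"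
  shows "poly (map_poly \<phi> p) z = (\<Sum>i\<le>degree p. \<phi> (coeff p i) * z ^ i)"
  unfolding poly_altdef
proof (rule sum.mono_neutral_cong_left)
  show "\<forall>i\<in>{..degree p} - {..degree (map_poly \<phi> p)}. \<phi> (coeff p i) * z ^ i = 0"
  proof
    fix i assume "i \<in> {..degree p} - {..degree (map_poly \<phi> p)}"
    then have "coeff (map_poly \<phi> p) i = 0"
      by (intro coeff_eq_0) auto
    then show "\<phi> (coeff p i) * z ^ i = 0"
      using assms by (simp add: coeff_map_poly)
  qed
qed (use assms map_poly_degree_leq[of \<phi> p] in \<open>auto simp: coeff_map_poly\<close>)

abbreviation const3 :: "complex \<Rightarrow> cpoly3" where "const3 a \<equiv> [:[:[:a:]:]:]"
definition x0 :: cpoly3 where "x0 = [:[:[:0, 1:]:]:]"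
definition x1 :: cpoly3 where "x1 = [:[:0, 1:]:]"
definition x2 :: cpoly3 where "x2 = [:0, 1:]"

text \<open>
  The homomorphism \<open>P(x\<^sub>0, x\<^sub>1, x\<^sub>2) \<mapsto> P(t x\<^sub>0, t x\<^sub>1, t x\<^sub>2)\<close> into polynomials in \<open>t\<close>. The coefficient of \<open>t\<^sup>e\<close> is the
  homogeneous part of degree \<open>e\<close>, so facts about the total degree reduce to facts
  about polynomials in one variable.
\<close>

definition scale :: "cpoly3 \<Rightarrow> cpoly3 poly" where
  "scale P = poly (map_poly (\<lambda>A. poly (map_poly (\<lambda>a. poly (map_poly (\<lambda>b. [:const3 b:]) a)
     [:0, x0:]) A) [:0, x1:]) P) [:0, x2:]"

lemma ring_map_scale: "ring_map scale"
  unfolding scale_def[abs_def]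
  by (intro ring_map_poly) (simp add: ring_map_def one_pCons)

abbreviation mono4 :: "complex \<Rightarrow> nat \<Rightarrow> nat \<Rightarrow> nat \<Rightarrow> nat \<Rightarrow> cpoly3 poly" where
  "mono4 b i j k e \<equiv> monom (monom (monom (monom b i) j) k) e"

lemma scale_sum: "scale P = (\<Sum>k\<le>degree P. \<Sum>j\<le>degree (coeff P k). \<Sum>i\<le>degree (coeff (coeff P k) j).
     mono4 (coeff (coeff (coeff P k) j) i) i j k (i + j + k))"
proof -
  have x: "[:0, x0:] = mono4 1 1 0 0 1" "[:0, x1:] = mono4 1 0 1 0 1" "[:0, x2:] = mono4 1 0 0 1 1"
    "[:const3 b:] = mono4 b 0 0 0 0" for b
    by (simp_all add: x0_def x1_def x2_def monom_Suc monom_0 one_pCons)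
  show ?thesis
    unfolding scale_def x
    by (simp add: poly_map_poly_altdef monom_power mult_monom sum_distrib_right add.assoc add.commute
        add.left_commute)
qed

lemma sum_if_const: "(\<Sum>i\<in>A. if b then f i else 0) = (if b then sum f A else 0)"
  by simp

lemma coeff_scale:
  "coeff (coeff (coeff (coeff (scale P) e) k) j) i
     = (if i + j + k = e then coeff (coeff (coeff P k) j) i else 0)"
proof -
  have *: "coeff (coeff (coeff (coeff (mono4 b i' j' k' d) e) k) j) i =
     (if k' = k then if j' = j then if i' = i then if d = e then b else 0 else 0 else 0 else 0)"
    for b i' j' k' d
    by simp
  show ?thesis
    unfolding scale_sum coeff_sum * sum_if_const
    by (simp add: not_le coeff_eq_0)
qed

lemma homogeneous3_iff_scale: "homogeneous3 d P \<longleftrightarrow> scale P = monom P d"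
proof
  assume h: "homogeneous3 d P"
  show "scale P = monom P d"
  proof (intro poly_eqI)
    fix e k j i
    show "coeff (coeff (coeff (coeff (scale P) e) k) j) i = coeff (coeff (coeff (coeff (monom P d) e) k) j) i"
      using h unfolding coeff_scale homogeneous3_def by auto
  qed
next
  assume s: "scale P = monom P d"
  show "homogeneous3 d P"
    unfolding homogeneous3_def
  proof (intro allI impI)
    fix i j k
    assume nz: "coeff (coeff (coeff P k) j) i \<noteq> 0"
    have "coeff (coeff (coeff (coeff (monom P d) (i + j + k)) k) j) i \<noteq> 0"
      unfolding s[symmetric] coeff_scale using nz by simp
    then show "i + j + k = d"
      by (auto split: if_splits)
  qed
qed

lemma scale_eq_0_iff: "scale P = 0 \<longleftrightarrow> P = 0"
proof
  assume s: "scale P = 0"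
  show "P = 0"
  proof (intro poly_eqI)
    fix k j i
    show "coeff (coeff (coeff P k) j) i = coeff (coeff (coeff 0 k) j) i"
      using coeff_scale[of P "i + j + k" k j i] s by simp
  qed
qed (simp add: ring_mapD(2)[OF ring_map_scale])

definition tdeg :: "cpoly3 \<Rightarrow> nat" where
  "tdeg P = degree (scale P)"

lemma tdeg_mult: "P \<noteq> 0 \<Longrightarrow> Q \<noteq> 0 \<Longrightarrow> tdeg (P * Q) = tdeg P + tdeg Q"
  unfolding tdeg_def ring_mapD(4)[OF ring_map_scale] by (rule degree_mult_eq) (simp_all add: scale_eq_0_iff)

lemma tdeg_power: "P \<noteq> 0 \<Longrightarrow> tdeg (P ^ k) = k * tdeg P"
  unfolding tdeg_def ring_mapD(7)[OF ring_map_scale] by (rule degree_power_eq) (simp add: scale_eq_0_iff)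

lemma tdeg_homogeneous: "homogeneous3 d P \<Longrightarrow> P \<noteq> 0 \<Longrightarrow> tdeg P = d"
  by (simp add: tdeg_def homogeneous3_iff_scale degree_monom_eq)

lemma tdeg_unit:
  assumes "is_unit P"
  shows "tdeg P = 0"
proof -
  obtain Q where Q: "1 = P * Q"
    using assms by (rule dvdE)
  then have "P \<noteq> 0" "Q \<noteq> 0"
    by auto
  then have "tdeg P + tdeg Q = tdeg 1"
    using tdeg_mult Q by metis
  also have "tdeg 1 = 0"
    by (simp add: tdeg_def ring_mapD(1)[OF ring_map_scale])
  finally show ?thesis by simp
qed

lemma tdeg_associated:
  assumes "normalize P = normalize Q"
  shows "tdeg P = tdeg Q"
proof (cases "P = 0 \<or> Q = 0")
  case True
  then show ?thesis
    using assms by (metis normalize_eq_0_iff)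
next
  case False
  then have PQ: "P \<noteq> 0" "Q \<noteq> 0"
    by auto
  have *: "tdeg (normalize R) = tdeg R" if "R \<noteq> 0" for R :: cpoly3
  proof -
    have "tdeg (unit_factor R * normalize R) = tdeg (unit_factor R) + tdeg (normalize R)"
      using that by (intro tdeg_mult) auto
    then show ?thesis
      using tdeg_unit[OF unit_factor_is_unit[OF that]] by simp
  qed
  show ?thesis
    using *[OF PQ(1)] *[OF PQ(2)] assms by simp
qed

lemma homogeneous3_mult:
  assumes "homogeneous3 d P" "homogeneous3 e Q"
  shows "homogeneous3 (d + e) (P * Q)"
  using assms unfolding homogeneous3_iff_scale ring_mapD(4)[OF ring_map_scale] by (simp add: mult_monom)

lemma homogeneous3_add:
  assumes "homogeneous3 d P" "homogeneous3 d Q"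
  shows "homogeneous3 d (P + Q)"
  using assms unfolding homogeneous3_iff_scale ring_mapD(3)[OF ring_map_scale] by (simp add: add_monom)

lemma homogeneous3_minus: "homogeneous3 d P \<Longrightarrow> homogeneous3 d (- P)"
  by (simp add: homogeneous3_def)

lemma homogeneous3_diff:
  assumes "homogeneous3 d P" "homogeneous3 d Q"
  shows "homogeneous3 d (P - Q)"
  using homogeneous3_add[OF assms(1) homogeneous3_minus[OF assms(2)]] by simp

lemma homogeneous3_1: "homogeneous3 0 1"
  unfolding homogeneous3_iff_scale ring_mapD(1)[OF ring_map_scale] by simp

lemma homogeneous3_power:
  assumes "homogeneous3 d P"
  shows "homogeneous3 (k * d) (P ^ k)"
  by (induction k) (simp_all add: homogeneous3_1 homogeneous3_mult assms)

lemma homogeneous3_sum: "(\<And>i. i \<in> I \<Longrightarrow> homogeneous3 d (f i)) \<Longrightarrow> homogeneous3 d (sum f I)"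
  by (induction I rule: infinite_finite_induct) (auto simp: homogeneous3_add, auto simp: homogeneous3_def)

lemma homogeneous3_const: "homogeneous3 0 (const3 a)"
  by (auto simp: homogeneous3_def coeff_pCons split: nat.splits)

lemma homogeneous3_vars: "homogeneous3 1 x0" "homogeneous3 1 x1" "homogeneous3 1 x2"
  by (auto simp: homogeneous3_def x0_def x1_def x2_def coeff_pCons split: nat.splits)

text \<open>
  In \<open>scale (P * Q)\<close> the highest and the lowest power of \<open>t\<close> agree. Both are additive in the factors, hence they agree in
  each factor.
\<close>

lemma homogeneous3_factor:
  assumes h: "homogeneous3 d (P * Q)" and nz: "P * Q \<noteq> 0"
  shows "homogeneous3 (tdeg P) P"
proof -
  have sP: "scale P \<noteq> 0" and sQ: "scale Q \<noteq> 0"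
    using nz by (auto simp: scale_eq_0_iff)
  have pq: "scale P * scale Q = monom (P * Q) d"
    using h unfolding homogeneous3_iff_scale ring_mapD(4)[OF ring_map_scale] .
  have ord: "order 0 (scale P) \<le> degree (scale P)" "order 0 (scale Q) \<le> degree (scale Q)"
    using sP sQ by (auto intro: order_degree)
  have "degree (scale P) + degree (scale Q) = d"
    using degree_mult_eq[OF sP sQ] pq nz by (simp add: degree_monom_eq)
  moreover have "order 0 (scale P) + order 0 (scale Q) = d"
    using order_mult[of "scale P" "scale Q" 0] pq nz by (simp add: order_0_monom)
  ultimately have "order 0 (scale P) = tdeg P"
    using ord by (simp add: tdeg_def)
  then have low: "coeff (scale P) e = 0" if "e < tdeg P" for e
    using order_1[of 0 "scale P"] that by (metis monom_1_dvd_iff' monom_altdef order_0_monom smult_1_left minus_zero)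
  have high: "coeff (scale P) e = 0" if "e > tdeg P" for e
    using that by (simp add: tdeg_def coeff_eq_0)
  show ?thesis
    unfolding homogeneous3_def
  proof (intro allI impI)
    fix i j k
    assume "coeff (coeff (coeff P k) j) i \<noteq> 0"
    then have "coeff (scale P) (i + j + k) \<noteq> 0"
      using coeff_scale[of P "i + j + k" k j i] by auto
    then show "i + j + k = tdeg P"
      using low high by (meson linorder_neqE_nat)
  qed
qed

definition fval :: "cpoly3 \<Rightarrow> cpoly3 fract \<Rightarrow> int" where
  "fval D f = int (multiplicity D (fst (quot_of_fract f))) - int (multiplicity D (snd (quot_of_fract f)))"

lemma fval_divide:
  assumes "prime_elem D" "a \<noteq> 0" "b \<noteq> 0"
  shows "fval D (to_fract a / to_fract b) = int (multiplicity D a) - int (multiplicity D b)"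
proof -
  define f where "f = to_fract a / to_fract b"
  define p q where "p = fst (quot_of_fract f)" and "q = snd (quot_of_fract f)"
  have q: "q \<noteq> 0"
    by (simp add: q_def)
  have f: "f = to_fract p / to_fract q"
    using Fract_quot_of_fract[of f] by (simp add: p_def q_def Fract_conv_to_fract)
  have "f \<noteq> 0"
    using assms by (simp add: f_def)
  then have p: "p \<noteq> 0"
    using f by auto
  have "to_fract (a * q) = to_fract (p * b)"
    using f q assms by (simp add: f_def field_simps)
  then have "a * q = p * b"
    by (simp only: to_fract_eq_iff)
  then have "multiplicity D a + multiplicity D q = multiplicity D p + multiplicity D b"
    using prime_elem_multiplicity_mult_distrib[OF assms(1)] assms p q by metis
  then show ?thesis
    unfolding fval_def f_def[symmetric] p_def[symmetric] q_def[symmetric] by linarith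
qed

abbreviation const_f :: "complex \<Rightarrow> cpoly3 fract" where
  "const_f a \<equiv> to_fract (const3 a)"

lemma fract_cases:
  fixes f :: "'a::{factorial_ring_gcd, semiring_gcd_mult_normalize} fract"
  obtains a b where "f = to_fract a / to_fract b" "b \<noteq> 0"
  using Fract_quot_of_fract[of f] snd_quot_of_fract_nonzero[of f] unfolding Fract_conv_to_fract by metis

lemma complex_valuation_fval:
  assumes D: "prime_elem D"
  shows "complex_valuation (fval D) const_f"
proof
  fix f g :: "cpoly3 fract"
  assume nz: "f \<noteq> 0" "g \<noteq> 0"
  obtain a b where f: "f = to_fract a / to_fract b" and b: "b \<noteq> 0"
    by (rule fract_cases)
  obtain p q where g: "g = to_fract p / to_fract q" and q: "q \<noteq> 0"
    by (rule fract_cases)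
  have a: "a \<noteq> 0" and p: "p \<noteq> 0"
    using nz f g by auto
  note m = prime_elem_multiplicity_mult_distrib[OF D]
  have fg: "f * g = to_fract (a * p) / to_fract (b * q)"
    using b q by (simp add: f g)
  show "fval D (f * g) = fval D f + fval D g"
    unfolding fg unfolding f g using a b p q D by (simp add: fval_divide m del: to_fract_mult)
  assume s: "f + g \<noteq> 0"
  have sum: "f + g = to_fract (a * q + p * b) / to_fract (b * q)"
    using b q by (simp add: f g field_simps)
  then have n: "a * q + p * b \<noteq> 0"
    using s by (metis div_0 to_fract_0)
  let ?k = "min (multiplicity D (a * q)) (multiplicity D (p * b))"
  have "D ^ ?k dvd a * q + p * b"
    by (intro dvd_add) (auto intro: multiplicity_dvd')
  then have "?k \<le> multiplicity D (a * q + p * b)"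
    using n D by (intro multiplicity_geI) (auto simp: prime_elem_def)
  then show "min (fval D f) (fval D g) \<le> fval D (f + g)"
    unfolding sum unfolding f g using a b p q D n
    by (simp add: fval_divide m del: to_fract_mult to_fract_add)
next
  fix z :: complex
  assume "z \<noteq> 0"
  then have "is_unit (const3 z)"
    by (intro dvdI[of _ _ "const3 (1 / z)"]) (simp add: one_pCons)
  then show "fval D (const_f z) = 0"
    using fval_divide[OF D, of "const3 z" 1] \<open>z \<noteq> 0\<close> by (simp add: multiplicity_unit_right)
qed (simp_all flip: to_fract_add to_fract_mult add: one_pCons[symmetric])

section \<open>Composition of rational maps\<close>

lemma ring_map_const_rf: "ring_map const_rf"
  by (simp add: ring_map_def const_rf_def one_pCons flip: to_fract_add to_fract_mult)
    (simp add: one_pCons[symmetric])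

lemma ring_map_eval2: "ring_map (\<lambda>A. eval2 A h)"
  unfolding eval2_def by (intro ring_map_poly ring_map_const_rf)

lemmas eval2_simps = ring_mapD[OF ring_map_eval2]

lemma eval2_0: "eval2 0 h = 0"
  by (rule eval2_simps(2))

text \<open>
  Any representing fraction is a witness, reduced or not. This makes the set of elements that are defined at \<open>h\<close> visibly
  closed under the field operations, while \<open>rat_subst\<close> itself uses the reduced fraction.
\<close>

definition defined_at :: "ratmap \<Rightarrow> ratfun \<Rightarrow> bool" where
  "defined_at h r \<longleftrightarrow> (\<exists>a b. r = to_fract a / to_fract b \<and> eval2 b h \<noteq> 0)"

text \<open>
  If some denominator of a fraction does not vanish at \<open>h\<close>, then neither does the reduced
  one, which divides it.
\<close>

lemma rat_subst_divide:
  assumes "eval2 b h \<noteq> 0"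
  shows "rat_subst (to_fract a / to_fract b) h = eval2 a h / eval2 b h"
proof -
  define r where "r = to_fract a / to_fract b"
  define p q where "p = fst (quot_of_fract r)" and "q = snd (quot_of_fract r)"
  have b: "b \<noteq> 0"
    using assms eval2_0[of h] by auto
  have q: "q \<noteq> 0" and cop: "coprime p q"
    by (simp_all add: p_def q_def coprime_quot_of_fract)
  have "r = to_fract p / to_fract q"
    using Fract_quot_of_fract[of r] by (simp add: p_def q_def Fract_conv_to_fract)
  then have "to_fract (a * q) = to_fract (p * b)"
    using b q by (simp add: r_def field_simps)
  then have eq: "a * q = p * b"
    by (simp only: to_fract_eq_iff)
  then have "q dvd b"
    using cop by (metis coprime_commute coprime_dvd_mult_right_iff dvd_triv_right)
  then obtain k where "b = q * k"
    by (rule dvdE)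
  then have "eval2 q h \<noteq> 0"
    using assms eval2_simps(4)[of q k h] by (metis mult_zero_left)
  moreover have "eval2 a h * eval2 q h = eval2 p h * eval2 b h"
    using eq eval2_simps(4) by metis
  ultimately show ?thesis
    using assms unfolding rat_subst_def r_def[symmetric] p_def[symmetric] q_def[symmetric]
    by (simp add: field_simps)
qed

lemma rat_subst_add:
  assumes "defined_at h r" "defined_at h t"
  shows "defined_at h (r + t)" "rat_subst (r + t) h = rat_subst r h + rat_subst t h"
proof -
  obtain a b where r: "r = to_fract a / to_fract b" and b: "eval2 b h \<noteq> 0"
    using assms(1) unfolding defined_at_def by blast
  obtain p q where t: "t = to_fract p / to_fract q" and q: "eval2 q h \<noteq> 0"
    using assms(2) unfolding defined_at_def by blast
  have nz: "b \<noteq> 0" "q \<noteq> 0"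
    using b q eval2_0[of h] by auto
  have rt: "r + t = to_fract (a * q + p * b) / to_fract (b * q)"
    using nz by (simp add: r t field_simps)
  have bq: "eval2 (b * q) h \<noteq> 0"
    using b q by (simp add: eval2_simps)
  show "defined_at h (r + t)"
    unfolding defined_at_def using rt bq by blast
  show "rat_subst (r + t) h = rat_subst r h + rat_subst t h"
    unfolding rt rat_subst_divide[OF bq] unfolding r t rat_subst_divide[OF b] rat_subst_divide[OF q]
    using b q by (simp add: eval2_simps field_simps)
qed

lemma rat_subst_mult:
  assumes "defined_at h r" "defined_at h t"
  shows "defined_at h (r * t)" "rat_subst (r * t) h = rat_subst r h * rat_subst t h"
proof -
  obtain a b where r: "r = to_fract a / to_fract b" and b: "eval2 b h \<noteq> 0"
    using assms(1) unfolding defined_at_def by blast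
  obtain p q where t: "t = to_fract p / to_fract q" and q: "eval2 q h \<noteq> 0"
    using assms(2) unfolding defined_at_def by blast
  have rt: "r * t = to_fract (a * p) / to_fract (b * q)"
    by (simp add: r t)
  have bq: "eval2 (b * q) h \<noteq> 0"
    using b q by (simp add: eval2_simps)
  show "defined_at h (r * t)"
    unfolding defined_at_def using rt bq by blast
  show "rat_subst (r * t) h = rat_subst r h * rat_subst t h"
    unfolding rt rat_subst_divide[OF bq] unfolding r t rat_subst_divide[OF b] rat_subst_divide[OF q]
    by (simp add: eval2_simps)
qed

lemma rat_subst_inverse:
  assumes "defined_at h r" "rat_subst r h \<noteq> 0"
  shows "defined_at h (inverse r)" "rat_subst (inverse r) h = inverse (rat_subst r h)"
proof -
  obtain a b where r: "r = to_fract a / to_fract b" and b: "eval2 b h \<noteq> 0"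
    using assms(1) unfolding defined_at_def by blast
  have a: "eval2 a h \<noteq> 0"
    using assms(2) unfolding r rat_subst_divide[OF b] by auto
  have ir: "inverse r = to_fract b / to_fract a"
    by (simp add: r)
  show "defined_at h (inverse r)"
    unfolding defined_at_def using ir a by blast
  show "rat_subst (inverse r) h = inverse (rat_subst r h)"
    unfolding ir rat_subst_divide[OF a] unfolding r rat_subst_divide[OF b] by simp
qed

lemma rat_subst_divide_defined:
  assumes "defined_at h r" "defined_at h t" "rat_subst t h \<noteq> 0"
  shows "defined_at h (r / t)" "rat_subst (r / t) h = rat_subst r h / rat_subst t h"
  using rat_subst_mult[OF assms(1) rat_subst_inverse(1)[OF assms(2,3)]] rat_subst_inverse[OF assms(2,3)]
  by (auto simp: divide_inverse)

lemma rat_subst_polynomial: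
  "defined_at h (to_fract a)" "rat_subst (to_fract a) h = eval2 a h"
proof -
  have 1: "eval2 1 h \<noteq> 0"
    by (simp add: eval2_simps)
  have a: "to_fract a = to_fract a / to_fract 1"
    by simp
  show "defined_at h (to_fract a)"
    unfolding defined_at_def using a 1 by blast
  show "rat_subst (to_fract a) h = eval2 a h"
    by (subst a, subst rat_subst_divide[OF 1]) (simp add: eval2_simps)
qed

lemma rat_subst_const: "defined_at h (const_rf z)" "rat_subst (const_rf z) h = const_rf z"
  unfolding const_rf_def rat_subst_polynomial(2)
  by (rule rat_subst_polynomial) (simp add: eval2_def map_poly_pCons const_rf_def)

lemma rat_subst_one: "defined_at h 1" "rat_subst 1 h = 1"
  using rat_subst_const[where h = h and z = 1] by (simp_all add: const_rf_def one_pCons[symmetric])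

lemma rat_subst_minus:
  assumes "defined_at h r"
  shows "defined_at h (- r)" "rat_subst (- r) h = - rat_subst r h"
proof -
  have "const_rf (- 1) = - 1"
    using ring_mapD(5)[OF ring_map_const_rf, of 1] ring_mapD(1)[OF ring_map_const_rf] by simp
  then show "defined_at h (- r)" "rat_subst (- r) h = - rat_subst r h"
    using rat_subst_mult[OF rat_subst_const(1)[where z = "- 1"] assms] rat_subst_const(2)[where h = h and z = "- 1"] by auto
qed

lemma rat_subst_diff:
  assumes "defined_at h r" "defined_at h t"
  shows "defined_at h (r - t)" "rat_subst (r - t) h = rat_subst r h - rat_subst t h"
  using rat_subst_add[OF assms(1) rat_subst_minus(1)[OF assms(2)]] rat_subst_minus(2)[OF assms(2)]
  by auto

lemma rat_subst_X: "defined_at h X_rf" "rat_subst X_rf h = fst h"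
  and rat_subst_Y: "defined_at h Y_rf" "rat_subst Y_rf h = snd h"
proof -
  have c: "const_rf 0 = 0" "const_rf 1 = 1"
    using ring_mapD[OF ring_map_const_rf] by auto
  show "defined_at h X_rf" "rat_subst X_rf h = fst h" "defined_at h Y_rf" "rat_subst Y_rf h = snd h"
    unfolding X_rf_def Y_rf_def rat_subst_polynomial(2)
    by (rule rat_subst_polynomial, simp add: eval2_def map_poly_pCons c,
        rule rat_subst_polynomial, simp add: eval2_def map_poly_pCons c one_pCons)
qed

lemma rat_subst_poly:
  assumes "defined_at h r"
  shows "defined_at h (poly (map_poly const_rf G) r)
    \<and> rat_subst (poly (map_poly const_rf G) r) h = poly (map_poly const_rf G) (rat_subst r h)"
proof (induction G)
  case 0
  show ?case
    using rat_subst_polynomial[where h = h and a = 0] by (simp add: eval2_simps)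
next
  case (pCons a G)
  have "const_rf 0 = 0"
    using ring_mapD(2)[OF ring_map_const_rf] .
  then show ?case
    using rat_subst_add[OF rat_subst_const(1) rat_subst_mult(1)[OF assms]]
      rat_subst_mult(2)[OF assms] rat_subst_const(2) pCons.IH
    by (simp add: map_poly_pCons)
qed

lemma k_map_eq:
  "k_map F = (- fst i_map + poly (map_poly const_rf F) (snd i_map), snd i_map)"
proof -
  note s = rat_subst_minus[OF rat_subst_X(1)] rat_subst_poly[OF rat_subst_Y(1)]
  show ?thesis
    unfolding k_map_def rat_comp_def j_map_def
    using s rat_subst_add[OF s(1) conjunct1[OF s(3)]] rat_subst_X(2) rat_subst_Y(2) by simp
qed

lemma k_map_comp:
  assumes u: "fst h - 1 \<noteq> 0" and y: "snd h \<noteq> 0"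
  shows "fst (k_map F \<circ>\<^sub>r h) - 1 = affine_next_u const_rf F (fst h - 1) (snd h)"
    and "snd (k_map F \<circ>\<^sub>r h) = next_y (fst h - 1) (snd h)"
proof -
  note X = rat_subst_X[where h = h] and Y = rat_subst_Y[where h = h] and one = rat_subst_one[where h = h]
  note X1 = rat_subst_diff[OF X(1) one(1), unfolded X(2) one(2)]
  note d1 = rat_subst_divide_defined[OF X1(1) Y(1), unfolded X1(2) Y(2), OF y]
  note d2 = rat_subst_divide_defined[OF Y(1) X1(1), unfolded X1(2) Y(2), OF u]
  have i1: "defined_at h (fst i_map)" "rat_subst (fst i_map) h = 1 - fst h - (fst h - 1) / snd h"
    using rat_subst_diff[OF rat_subst_diff(1)[OF one(1) X(1)] d1(1)] rat_subst_diff(2)[OF one(1) X(1)]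
      d1(2) X(2) one(2) by (auto simp: i_map_def)
  note mY = rat_subst_minus[OF Y(1), unfolded Y(2)]
  note mY1 = rat_subst_diff[OF mY(1) one(1), unfolded mY(2) one(2)]
  have i2: "defined_at h (snd i_map)" "rat_subst (snd i_map) h = next_y (fst h - 1) (snd h)"
    using rat_subst_diff[OF mY1(1) d2(1)] mY1(2) d2(2) by (auto simp: i_map_def next_y_def)
  show "snd (k_map F \<circ>\<^sub>r h) = next_y (fst h - 1) (snd h)"
    by (simp add: rat_comp_def k_map_eq i2)
  have "fst (k_map F \<circ>\<^sub>r h) = - (1 - fst h - (fst h - 1) / snd h)
      + poly (map_poly const_rf F) (next_y (fst h - 1) (snd h))"
    using rat_subst_add[OF rat_subst_minus(1)[OF i1(1)] conjunct1[OF rat_subst_poly[OF i2(1)]]]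
      rat_subst_minus(2)[OF i1(1)] conjunct2[OF rat_subst_poly[OF i2(1)]] i1(2) i2(2)
    by (simp add: rat_comp_def k_map_eq)
  then show "fst (k_map F \<circ>\<^sub>r h) - 1 = affine_next_u const_rf F (fst h - 1) (snd h)"
    by (simp add: affine_next_u_def)
qed

section \<open>Reduced forms and their degree\<close>

lemma ring_map_dehomogenize: "ring_map dehomogenize"
  unfolding dehomogenize_def[abs_def] by (intro ring_map_map_poly) (simp add: ring_map_def)

lemma coeff_dehomogenize:
  assumes "homogeneous3 d P" "i + j + k = d"
  shows "coeff (coeff (dehomogenize P) k) j = coeff (coeff (coeff P k) j) i"
proof -
  have "coeff (coeff (coeff P k) j) i' = 0" if "i' \<noteq> i" for i'
    using assms that unfolding homogeneous3_def by force
  then have "coeff (coeff P k) j = monom (coeff (coeff (coeff P k) j) i) i"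
    by (intro poly_eqI) simp
  then have "poly (coeff (coeff P k) j) 1 = coeff (coeff (coeff P k) j) i"
    by (metis mult.right_neutral poly_monom power_one)
  then show ?thesis
    by (simp add: dehomogenize_def coeff_map_poly)
qed

lemma dehomogenize_eq_0:
  assumes "homogeneous3 d P" "dehomogenize P = 0"
  shows "P = 0"
proof (intro poly_eqI)
  fix k j i
  show "coeff (coeff (coeff P k) j) i = coeff (coeff (coeff 0 k) j) i"
  proof (cases "i + j + k = d")
    case True
    then show ?thesis
      using coeff_dehomogenize[OF assms(1) True] assms(2) by simp
  next
    case False
    then show ?thesis
      using assms(1) unfolding homogeneous3_def by fastforce
  qed
qed

lemma dehomogenize_inj:
  assumes "homogeneous3 d P" "homogeneous3 d Q" "dehomogenize P = dehomogenize Q"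
  shows "P = Q"
  using dehomogenize_eq_0[OF homogeneous3_diff[OF assms(1,2)]] assms(3)
  by (simp add: ring_mapD(6)[OF ring_map_dehomogenize])

text \<open>
  Dehomogenization is injective on homogeneous polynomials of a fixed degree, so the equality of the affine maps gives
  \<open>P0 * Q1 = Q0 * P1\<close> and \<open>P0 * Q2 = Q0 * P2\<close>. Then \<open>P0\<close> divides \<open>Q0\<close> times the greatest common divisor of
  \<open>P0\<close>, \<open>P1\<close>, \<open>P2\<close>, which is a unit.
\<close>

lemma reduced_form_dvd:
  assumes P: "reduced_form d P0 P1 P2 h" and Q: "reduced_form e Q0 Q1 Q2 h"
  shows "P0 dvd Q0"
proof -
  note D = ring_mapD[OF ring_map_dehomogenize]
  have nz: "dehomogenize P0 \<noteq> 0" "dehomogenize Q0 \<noteq> 0"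
    using P Q by (auto simp: reduced_form_def)
  have cross: "P0 * R = Q0 * T" if "homogeneous3 e R" "homogeneous3 d T"
    "to_fract (dehomogenize T) / to_fract (dehomogenize P0)
      = to_fract (dehomogenize R) / to_fract (dehomogenize Q0)" for R T
  proof (rule dehomogenize_inj)
    show "homogeneous3 (d + e) (P0 * R)" "homogeneous3 (d + e) (Q0 * T)"
      using homogeneous3_mult[of d P0 e R] homogeneous3_mult[of e Q0 d T] that P Q
      by (auto simp: reduced_form_def add.commute)
    have "to_fract (dehomogenize P0 * dehomogenize R) = to_fract (dehomogenize Q0 * dehomogenize T)"
      using that(3) nz by (simp add: field_simps)
    then show "dehomogenize (P0 * R) = dehomogenize (Q0 * T)"
      unfolding D by (simp only: to_fract_eq_iff)
  qed
  have "P0 * Q1 = Q0 * P1" "P0 * Q2 = Q0 * P2"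
    using P Q by (auto intro!: cross simp: reduced_form_def)
  then have "P0 dvd Q0 * P0" "P0 dvd Q0 * P1" "P0 dvd Q0 * P2"
    by (auto intro: dvd_triv_left simp: dvd_def) (metis dvdI)+
  then have "P0 dvd gcd (Q0 * P0) (gcd (Q0 * P1) (Q0 * P2))"
    by simp
  moreover have "normalize (gcd (Q0 * P0) (gcd (Q0 * P1) (Q0 * P2))) = normalize (Q0 * gcd P0 (gcd P1 P2))"
    by (simp only: gcd_mult_left gcd.normalize_right_idem normalize_idem)
  moreover have "is_unit (gcd P0 (gcd P1 P2))"
    using P unfolding reduced_form_def by (meson dvd_trans gcd_dvd1 gcd_dvd2)
  ultimately show ?thesis
    by (metis dvd_mult_unit_iff dvd_normalize_iff)
qed

lemma rat_degree_eqI: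
  assumes "reduced_form d P0 P1 P2 h"
  shows "rat_degree h = d"
  unfolding rat_degree_def
proof (rule the_equality)
  show "\<exists>P0 P1 P2. reduced_form d P0 P1 P2 h"
    using assms by blast
  fix e
  assume "\<exists>P0 P1 P2. reduced_form e P0 P1 P2 h"
  then obtain Q0 Q1 Q2 where Q: "reduced_form e Q0 Q1 Q2 h"
    by blast
  have nz: "P0 \<noteq> 0" "Q0 \<noteq> 0"
    using assms Q ring_mapD(2)[OF ring_map_dehomogenize] by (auto simp: reduced_form_def)
  have "normalize P0 = normalize Q0"
    using reduced_form_dvd[OF assms Q] reduced_form_dvd[OF Q assms] by (rule associatedI)
  then show "e = d"
    using tdeg_associated tdeg_homogeneous nz assms Q unfolding reduced_form_def by metis
qed

section \<open>The orbit in homogeneous coordinates\<close>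

lemma unit_of_common_divisor:
  fixes D p q :: "'a::idom_divide poly"
  assumes "D dvd p" "degree p = 0" "p \<noteq> 0" "D dvd q" "coeff q k = 1"
  shows "is_unit D"
proof -
  have "degree D = 0"
    using dvd_imp_degree_le[OF assms(1,3)] assms(2) by simp
  then obtain e where D: "D = [:e:]"
    by (rule degree_eq_zeroE)
  then have "e dvd coeff q k"
    using assms(4) const_poly_dvd_iff by blast
  then show ?thesis
    using assms(5) by (simp add: D is_unit_const_poly_iff)
qed

lemma unit_of_x1_x2:
  assumes "D dvd x1 - const3 a * x0" "D dvd x2 - const3 b * x0"
  shows "is_unit D"
  by (rule unit_of_common_divisor[OF assms(1) _ _ assms(2), of 1])
    (simp_all add: x0_def x1_def x2_def)

lemma unit_of_x0_x2:
  assumes "D dvd x0" "D dvd x2"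
  shows "is_unit D"
  by (rule unit_of_common_divisor[OF assms(1) _ _ assms(2), of 1])
    (simp_all add: x0_def x2_def)

lemma unit_of_x0_x1:
  assumes "D dvd x0" "D dvd x1"
  shows "is_unit D"
proof -
  have "degree D = 0"
    using dvd_imp_degree_le[OF assms(1)] by (simp add: x0_def)
  then obtain e where D: "D = [:e:]"
    by (rule degree_eq_zeroE)
  have "e dvd [:[:0, 1:]:]" "e dvd [:0, 1:]"
    using assms by (simp_all add: D x0_def x1_def)
  then have "is_unit e"
    using unit_of_common_divisor[of e "[:[:0, 1:]:]" "[:0, 1:]" 1] by simp
  then show ?thesis
    by (simp add: D is_unit_const_poly_iff)
qed

lemma prime_elem_x0: "prime_elem x0"
  unfolding x0_def prime_elem_const_poly_iff by (rule prime_elem_linear_field_poly) simp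

definition s_form :: "cpoly3 \<Rightarrow> cpoly3 \<Rightarrow> cpoly3 \<Rightarrow> cpoly3" where
  "s_form W U Y = U * Y + U * W + W * Y"

locale k_degree =
  fixes F :: "complex poly" and n :: nat
  assumes deg_F: "degree F = n" and even_n: "even n" and n_pos: "n > 0"
begin

definition F_form :: "cpoly3 \<Rightarrow> cpoly3 \<Rightarrow> cpoly3" where
  "F_form a b = (\<Sum>k\<le>n. const3 (coeff F k) * a ^ (n - k) * b ^ k)"

text \<open>
  One step of the map on triples \<open>[W : U : Y]\<close>, obtained from the affine formulas by multiplication
  with \<open>W\<^sup>n U\<^sup>n Y\<close>. The results may have common factors.
\<close>

definition next_W where "next_W W U Y = W ^ n * U ^ n * Y"
definition next_Y where
  "next_Y W U Y = - (s_form W U Y * U ^ (n - 1) * W ^ (n - 1) * Y)"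
definition next_U where
  "next_U W U Y = s_form W U Y * U ^ n * W ^ (n - 1) - const3 2 * W ^ n * U ^ n * Y
     + Y * F_form (U * W) (- s_form W U Y)"

lemma homogeneous3_next:
  assumes "homogeneous3 d W" "homogeneous3 d U" "homogeneous3 d Y"
  shows "homogeneous3 ((2 * n + 1) * d) (next_W W U Y)"
    "homogeneous3 ((2 * n + 1) * d) (next_U W U Y)"
    "homogeneous3 ((2 * n + 1) * d) (next_Y W U Y)"
proof -
  have s: "homogeneous3 (d + d) (s_form W U Y)"
    unfolding s_form_def using assms by (intro homogeneous3_add homogeneous3_mult)
  obtain l where n: "n = Suc l"
    using n_pos by (cases n) auto
  have F: "homogeneous3 (n * (d + d)) (F_form (U * W) (- s_form W U Y))"
    unfolding F_form_def
  proof (rule homogeneous3_sum)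
    fix k assume "k \<in> {..n}"
    then have "n * (d + d) = 0 + (n - k) * (d + d) + k * (d + d)"
      by (simp flip: distrib_right)
    moreover have "homogeneous3 (0 + (n - k) * (d + d) + k * (d + d))
      (const3 (coeff F k) * (U * W) ^ (n - k) * (- s_form W U Y) ^ k)"
      using assms s by (intro homogeneous3_mult homogeneous3_const homogeneous3_power homogeneous3_minus)
    ultimately show "homogeneous3 (n * (d + d)) (const3 (coeff F k) * (U * W) ^ (n - k) * (- s_form W U Y) ^ k)"
      by simp
  qed
  have "homogeneous3 (n * d + n * d + d) (next_W W U Y)"
    unfolding next_W_def using assms by (intro homogeneous3_mult homogeneous3_power)
  moreover have "n * d + n * d + d = (2 * n + 1) * d"
    by (simp add: algebra_simps)
  ultimately show "homogeneous3 ((2 * n + 1) * d) (next_W W U Y)"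
    by (simp only:)
  have "homogeneous3 ((d + d) + (n - 1) * d + (n - 1) * d + d) (next_Y W U Y)"
    unfolding next_Y_def using assms s by (intro homogeneous3_minus homogeneous3_mult homogeneous3_power)
  moreover have "(d + d) + (n - 1) * d + (n - 1) * d + d = (2 * n + 1) * d"
    by (simp add: n algebra_simps)
  ultimately show "homogeneous3 ((2 * n + 1) * d) (next_Y W U Y)"
    by (simp only:)
  have 1: "homogeneous3 ((d + d) + n * d + (n - 1) * d) (s_form W U Y * U ^ n * W ^ (n - 1))"
    using assms s by (intro homogeneous3_mult homogeneous3_power)
  have 2: "homogeneous3 (0 + n * d + n * d + d) (const3 2 * W ^ n * U ^ n * Y)"
    using assms by (intro homogeneous3_mult homogeneous3_power homogeneous3_const)
  have 3: "homogeneous3 (d + n * (d + d)) (Y * F_form (U * W) (- s_form W U Y))"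
    using assms F by (intro homogeneous3_mult)
  have "(d + d) + n * d + (n - 1) * d = (2 * n + 1) * d" "0 + n * d + n * d + d = (2 * n + 1) * d"
    "d + n * (d + d) = (2 * n + 1) * d"
    by (simp_all add: n algebra_simps)
  then show "homogeneous3 ((2 * n + 1) * d) (next_U W U Y)"
    unfolding next_U_def using 1 2 3 by (metis homogeneous3_add homogeneous3_diff)
qed

text \<open>
  A homomorphism \<open>\<theta>\<close> occurs because the formula is needed twice: for the inclusion into the fraction field of the
  homogeneous coordinate ring and for dehomogenization into \<open>\<complex>(x, y)\<close>.
\<close>

lemma next_fraction:
  fixes \<theta> :: "cpoly3 \<Rightarrow> 'k::field"
  assumes \<theta>: "ring_map \<theta>" and cc: "\<And>a. \<theta> (const3 a) = cc a"
    and nz: "\<theta> W \<noteq> 0" "\<theta> U \<noteq> 0" "\<theta> Y \<noteq> 0"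
  shows "\<theta> (next_W W U Y) \<noteq> 0"
    and "\<theta> (next_Y W U Y) / \<theta> (next_W W U Y) = next_y (\<theta> U / \<theta> W) (\<theta> Y / \<theta> W)"
    and "\<theta> (next_U W U Y) / \<theta> (next_W W U Y) = affine_next_u cc F (\<theta> U / \<theta> W) (\<theta> Y / \<theta> W)"
proof -
  note h = ring_mapD[OF \<theta>]
  define w u y where "w = \<theta> W" and "u = \<theta> U" and "y = \<theta> Y"
  have nz': "w \<noteq> 0" "u \<noteq> 0" "y \<noteq> 0"
    using nz by (auto simp: w_def u_def y_def)
  define s where "s = u * y + u * w + w * y"
  have s: "\<theta> (s_form W U Y) = s"
    by (simp add: s_def s_form_def h w_def u_def y_def)
  obtain l where n: "n = Suc l"
    using n_pos by (cases n) auto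
  have nW: "\<theta> (next_W W U Y) = w ^ n * u ^ n * y"
    by (simp add: next_W_def h w_def u_def y_def)
  then show "\<theta> (next_W W U Y) \<noteq> 0"
    using nz' by simp
  have y': "next_y (u / w) (y / w) = - s / (u * w)"
    using nz' by (simp add: next_y_def s_def field_simps)
  have "\<theta> (next_Y W U Y) = - (s * u ^ (n - 1) * w ^ (n - 1) * y)"
    unfolding next_Y_def h s by (simp add: w_def u_def y_def)
  then show "\<theta> (next_Y W U Y) / \<theta> (next_W W U Y) = next_y (\<theta> U / \<theta> W) (\<theta> Y / \<theta> W)"
    unfolding nW w_def[symmetric] u_def[symmetric] y_def[symmetric] y'
    using nz' by (simp add: n field_simps)
  have cc0: "cc 0 = 0"
    using cc[of 0] h(2) by simp
  have two: "\<theta> (const3 2) = 2"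
  proof -
    have "const3 2 = 1 + 1"
      by (simp add: one_pCons)
    then have "\<theta> (const3 2) = \<theta> 1 + \<theta> 1"
      by (simp only: h(3))
    then show ?thesis
      using h(1) by simp
  qed
  have sumh: "\<theta> (\<Sum>i\<in>I. f i) = (\<Sum>i\<in>I. \<theta> (f i))" for I :: "nat set" and f
    by (induction I rule: infinite_finite_induct) (simp_all add: h)
  have "\<theta> (F_form (U * W) (- s_form W U Y)) = (\<Sum>k\<le>n. cc (coeff F k) * (u * w) ^ (n - k) * (- s) ^ k)"
    unfolding F_form_def sumh h(4) h(7) h(5) cc s by (simp add: w_def u_def)
  also have "\<dots> = (\<Sum>k\<le>n. (u * w) ^ n * (cc (coeff F k) * (- s / (u * w)) ^ k))"
  proof (rule sum.cong)
    fix k assume "k \<in> {..n}"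
    then have "(u * w) ^ n = (u * w) ^ (n - k) * (u * w) ^ k"
      by (simp flip: power_add)
    then show "cc (coeff F k) * (u * w) ^ (n - k) * (- s) ^ k
        = (u * w) ^ n * (cc (coeff F k) * (- s / (u * w)) ^ k)"
      using nz' by (simp only: power_divide) (simp add: field_simps)
  qed simp
  also have "\<dots> = (u * w) ^ n * poly (map_poly cc F) (- s / (u * w))"
    by (simp add: poly_map_poly_altdef cc0 deg_F sum_distrib_left)
  finally have Ff: "\<theta> (F_form (U * W) (- s_form W U Y)) = (u * w) ^ n * poly (map_poly cc F) (- s / (u * w))" .
  have "\<theta> (next_U W U Y) = s * u ^ n * w ^ (n - 1) - 2 * w ^ n * u ^ n * y
      + y * ((u * w) ^ n * poly (map_poly cc F) (- s / (u * w)))"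
    unfolding next_U_def h s Ff two by (simp add: w_def u_def y_def)
  moreover have "\<dots> / (w ^ n * u ^ n * y) = s / (y * w) - 2 + poly (map_poly cc F) (- s / (u * w))"
  proof -
    have "s * u ^ n * w ^ (n - 1) = s / (y * w) * (w ^ n * u ^ n * y)"
      using nz' by (simp add: n field_simps)
    then have "s * u ^ n * w ^ (n - 1) - 2 * w ^ n * u ^ n * y
        + y * ((u * w) ^ n * poly (map_poly cc F) (- s / (u * w)))
      = (s / (y * w) - 2 + poly (map_poly cc F) (- s / (u * w))) * (w ^ n * u ^ n * y)"
      by (simp add: power_mult_distrib algebra_simps)
    then show ?thesis
      using nz' by simp
  qed
  moreover have "s / (y * w) = u / w + u / w / (y / w) + 1"
    using nz' by (simp add: s_def field_simps)
  ultimately show "\<theta> (next_U W U Y) / \<theta> (next_W W U Y) = affine_next_u cc F (\<theta> U / \<theta> W) (\<theta> Y / \<theta> W)"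
    unfolding nW affine_next_u_def w_def[symmetric] u_def[symmetric] y_def[symmetric] y' by simp
qed

text \<open>
  The orbit of the identity map, in the field of fractions of the homogeneous coordinate ring. There
  the line at infinity is a prime divisor like any other curve, namely \<open>x\<^sub>0\<close>.
\<close>

fun orbit :: "nat \<Rightarrow> cpoly3 fract \<times> cpoly3 fract" where
  "orbit 0 = (to_fract (x1 - x0) / to_fract x0, to_fract x2 / to_fract x0)"
| "orbit (Suc p) = (affine_next_u const_f F (fst (orbit p)) (snd (orbit p)),
     next_y (fst (orbit p)) (snd (orbit p)))"

abbreviation u where "u p \<equiv> fst (orbit p)"
abbreviation y where "y p \<equiv> snd (orbit p)"

lemma k_valuation_fval: "prime_elem D \<Longrightarrow> k_valuation (fval D) const_f F n"
  using complex_valuation_fval[of D] deg_F even_n n_pos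
  by (simp add: k_valuation_def k_valuation_axioms_def)

lemma vars_nz: "x0 \<noteq> 0" "x1 - const3 a * x0 \<noteq> 0" "x2 - const3 a * x0 \<noteq> 0"
  by (simp_all add: x0_def x1_def x2_def)

lemma const3_1: "const3 1 = 1"
  by (simp add: one_pCons)

lemma orbit_0_minus_const:
  "u 0 - const_f a = to_fract (x1 - const3 (1 + a) * x0) / to_fract x0"
  "y 0 - const_f a = to_fract (x2 - const3 a * x0) / to_fract x0"
proof -
  have *: "to_fract b / to_fract x0 - to_fract e = to_fract (b - e * x0) / to_fract x0" for b e
    using vars_nz(1) by (simp add: field_simps)
  have "const3 (1 + a) = 1 + const3 a"
    by (simp add: one_pCons)
  then have "x1 - const3 (1 + a) * x0 = (x1 - x0) - const3 a * x0"
    by (simp only: distrib_right mult_1 diff_diff_eq)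
  then show "u 0 - const_f a = to_fract (x1 - const3 (1 + a) * x0) / to_fract x0"
    by (simp only: orbit.simps fst_conv *)
  show "y 0 - const_f a = to_fract (x2 - const3 a * x0) / to_fract x0"
    by (simp only: orbit.simps snd_conv *)
qed

lemma fval_orbit_0:
  assumes D: "prime_elem D"
  shows "fval D (u 0 - const_f a) = int (multiplicity D (x1 - const3 (1 + a) * x0)) - int (multiplicity D x0)"
    "fval D (y 0 - const_f a) = int (multiplicity D (x2 - const3 a * x0)) - int (multiplicity D x0)"
  unfolding orbit_0_minus_const using fval_divide[OF D] vars_nz by blast+

lemma orbit_start:
  assumes D: "prime_elem D"
  shows "D dvd x0 \<Longrightarrow> fval D (u 0) = - 1 \<and> fval D (y 0) = - 1"
    and "\<not> D dvd x0 \<Longrightarrow> fval D (u 0) \<ge> 0 \<and> fval D (y 0) \<ge> 0"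
proof -
  have nu: "\<not> is_unit D"
    using D by auto
  have x1: "x1 - const3 1 * x0 \<noteq> 0" and x2: "x2 - const3 0 * x0 \<noteq> 0"
    using vars_nz by blast+
  have uy: "fval D (u 0) = int (multiplicity D (x1 - const3 1 * x0)) - int (multiplicity D x0)"
    "fval D (y 0) = int (multiplicity D (x2 - const3 0 * x0)) - int (multiplicity D x0)"
    using fval_orbit_0[OF D, of 0] by simp_all
  assume "D dvd x0"
  then have "\<not> D dvd x1 - const3 1 * x0" "\<not> D dvd x2 - const3 0 * x0"
    using unit_of_x0_x1[of D] unit_of_x0_x2[of D] nu dvd_diff_left_iff[OF dvd_mult[of D x0]] by blast+
  then have m: "multiplicity D (x1 - const3 1 * x0) = 0" "multiplicity D (x2 - const3 0 * x0) = 0"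
    by (auto intro: not_dvd_imp_multiplicity_0)
  obtain k where k: "x0 = D * k"
    using \<open>D dvd x0\<close> by (rule dvdE)
  then have "is_unit k"
    using prime_elem_imp_irreducible[OF prime_elem_x0] nu irreducibleD by blast
  then have "multiplicity D x0 = 1"
    unfolding k using D vars_nz(1) k multiplicity_unit_right[of k D]
    by (subst prime_elem_multiplicity_mult_distrib) auto
  then show "fval D (u 0) = - 1 \<and> fval D (y 0) = - 1"
    using uy m by simp
next
  assume "\<not> D dvd x0"
  then have "multiplicity D x0 = 0"
    by (rule not_dvd_imp_multiplicity_0)
  then show "fval D (u 0) \<ge> 0 \<and> fval D (y 0) \<ge> 0"
    using fval_orbit_0[OF D, of 0] by simp
qed

lemma orbit_0_nz: "u 0 \<noteq> 0" "y 0 \<noteq> 0"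
  using vars_nz(1) vars_nz(2)[of 1] vars_nz(3)[of 0] const3_1 by auto

text \<open>
  Along the line at infinity \<open>u\<close> and \<open>y\<close> always have a pole.
\<close>

lemma orbit_nz: "u p \<noteq> 0" "y p \<noteq> 0"
proof -
  interpret k_valuation "fval x0" const_f F n
    by (rule k_valuation_fval[OF prime_elem_x0])
  have "infinite_state 1 (u (Suc p)) (y (Suc p))" for p
  proof (induction p)
    case 0
    show ?case
      using line_at_infinity_step[OF orbit_0_nz] orbit_start(1)[OF prime_elem_x0] by simp
  next
    case (Suc p)
    then show ?case
      using infinite_step by (simp only: orbit.simps(2) fst_conv snd_conv)
  qed
  then have "u (Suc p) \<noteq> 0" "y (Suc p) \<noteq> 0" for p
    using infinite_v_u unfolding infinite_state_def by blast+
  then show "u p \<noteq> 0" "y p \<noteq> 0"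
    using orbit_0_nz by (cases p; simp only: not_False_eq_True)+
qed

text \<open>
  If \<open>u\<close> and \<open>y\<close> both had constant residues at time \<open>0\<close>, then \<open>D\<close> would divide \<open>x\<^sub>1 - (1 + z) x\<^sub>0\<close> and
  \<open>x\<^sub>2 - w x\<^sub>0\<close>, which are coprime.
\<close>

lemma k_orbit_fval:
  assumes D: "prime_elem D"
  shows "k_orbit (fval D) const_f F n u y"
proof -
  interpret k_valuation "fval D" const_f F n
    by (rule k_valuation_fval[OF D])
  have nu: "\<not> is_unit D"
    using D by auto
  have start: "(fval D (u 0) = - 1 \<and> fval D (y 0) = - 1)
      \<or> (generic_state (u 0) (y 0) \<and> \<not> (\<exists>z w. res (u 0) z \<and> res (y 0) w))
      \<or> (\<exists>j. zero_state (u 0) j (u 0) (y 0) \<and> nonconst (u 0))"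
  proof (cases "D dvd x0")
    case True
    then show ?thesis
      using orbit_start(1)[OF D] by blast
  next
    case False
    then have mx0: "multiplicity D x0 = 0"
      by (rule not_dvd_imp_multiplicity_0)
    have pos: "fval D (u 0) \<ge> 0" "fval D (y 0) \<ge> 0"
      using orbit_start(2)[OF D False] by auto
    then have V0: "V 0 (u 0)" "V 0 (y 0)"
      by (auto simp: V_def)
    have ru: "D dvd x1 - const3 (1 + a) * x0" if "res (u 0) a" for a
    proof -
      have "u 0 - const_f a \<noteq> 0"
        unfolding orbit_0_minus_const using vars_nz by (metis divide_eq_0_iff to_fract_eq_0_iff)
      then have "fval D (u 0 - const_f a) \<ge> 1"
        using that unfolding res_def V_def by blast
      then have "multiplicity D (x1 - const3 (1 + a) * x0) > 0"
        unfolding fval_orbit_0(1)[OF D] mx0 by linarith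
      then show ?thesis
        using not_dvd_imp_multiplicity_0 by force
    qed
    have ry: "D dvd x2 - const3 a * x0" if "res (y 0) a" for a
    proof -
      have "y 0 - const_f a \<noteq> 0"
        unfolding orbit_0_minus_const using vars_nz by (metis divide_eq_0_iff to_fract_eq_0_iff)
      then have "fval D (y 0 - const_f a) \<ge> 1"
        using that unfolding res_def V_def by blast
      then have "multiplicity D (x2 - const3 a * x0) > 0"
        unfolding fval_orbit_0(2)[OF D] mx0 by linarith
      then show ?thesis
        using not_dvd_imp_multiplicity_0 by force
    qed
    have ruy: False if "res (u 0) z" "res (y 0) w" for z w
      using unit_of_x1_x2[OF ru[OF that(1)] ry[OF that(2)]] nu by blast
    show ?thesis
    proof (cases "V 1 (y 0)")
      case True
      then have "fval D (y 0) \<ge> 1"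
        using orbit_0_nz by (auto simp: V_def)
      moreover have "nonconst (u 0)"
        unfolding nonconst_def using V0(1) ruy[OF _ res_0[OF True]] by blast
      ultimately have "zero_state (u 0) (fval D (y 0)) (u 0) (y 0) \<and> nonconst (u 0)"
        using orbit_0_nz(2) V0(1) V_0 unfolding zero_state_def by (metis diff_self)
      then show ?thesis
        by blast
    next
      case False
      then have "generic_state (u 0) (y 0)"
        using V0 unfolding generic_state_def by blast
      then show ?thesis
        using ruy by blast
    qed
  qed
  show ?thesis
  proof (intro k_orbit.intro k_orbit_axioms.intro)
    show "k_valuation (fval D) const_f F n"
      by (rule k_valuation_fval[OF D])
    show "u (Suc p) = next_u (u p) (y p)" "y (Suc p) = next_y (u p) (y p)" for p
      by (simp_all only: orbit.simps(2) fst_conv snd_conv)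
    show "u p \<noteq> 0" "y p \<noteq> 0" for p
      by (rule orbit_nz)+
  qed (rule start)
qed

end

section \<open>The degrees of the iterates\<close>

context k_degree
begin

abbreviation h where "h p \<equiv> rat_iterate (k_map F) p"

text \<open>
  The triple belongs to the \<open>p\<close>-th iterate in both fields: the orbit is used for the multiplicities
  and \<open>h p\<close> for the degree.
\<close>

definition represents :: "nat \<Rightarrow> cpoly3 \<Rightarrow> cpoly3 \<Rightarrow> cpoly3 \<Rightarrow> bool" where
  "represents p W U Y \<longleftrightarrow> W \<noteq> 0 \<and> (\<exists>d. homogeneous3 d W \<and> homogeneous3 d U \<and> homogeneous3 d Y)
     \<and> gcd W (gcd U Y) = 1
     \<and> u p = to_fract U / to_fract W \<and> y p = to_fract Y / to_fract W
     \<and> fst (h p) - 1 = to_fract (dehomogenize U) / to_fract (dehomogenize W)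
     \<and> snd (h p) = to_fract (dehomogenize Y) / to_fract (dehomogenize W)"

lemma represents_nz:
  assumes "represents p W U Y"
  shows "W \<noteq> 0" "U \<noteq> 0" "Y \<noteq> 0"
  using assms orbit_nz[of p] by (auto simp: represents_def)

lemma represents_homogeneous:
  assumes "represents p W U Y"
  shows "homogeneous3 (tdeg W) W" "homogeneous3 (tdeg W) U" "homogeneous3 (tdeg W) Y"
    "tdeg U = tdeg W" "tdeg Y = tdeg W"
proof -
  obtain d where d: "homogeneous3 d W" "homogeneous3 d U" "homogeneous3 d Y"
    using assms by (auto simp: represents_def)
  then have "tdeg W = d" "tdeg U = d" "tdeg Y = d"
    using represents_nz[OF assms] by (auto intro: tdeg_homogeneous)
  then show "homogeneous3 (tdeg W) W" "homogeneous3 (tdeg W) U" "homogeneous3 (tdeg W) Y"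
    "tdeg U = tdeg W" "tdeg Y = tdeg W"
    using d by auto
qed

lemma represents_degree:
  assumes "represents p W U Y"
  shows "rat_degree (h p) = tdeg W"
proof (rule rat_degree_eqI)
  note D = ring_mapD[OF ring_map_dehomogenize] and H = represents_homogeneous[OF assms]
  have W: "dehomogenize W \<noteq> 0"
    using dehomogenize_eq_0[OF H(1)] represents_nz[OF assms] by auto
  have "is_unit Q" if "Q dvd W" "Q dvd U + W" "Q dvd Y" for Q
  proof -
    have "Q dvd gcd W (gcd U Y)"
      using that dvd_add_left_iff[OF that(1), of U] by simp
    moreover have "gcd W (gcd U Y) = 1"
      using assms by (simp add: represents_def)
    ultimately show ?thesis
      by metis
  qed
  moreover have "fst (h p) = to_fract (dehomogenize (U + W)) / to_fract (dehomogenize W)"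
  proof -
    have "fst (h p) = to_fract (dehomogenize U) / to_fract (dehomogenize W) + 1"
      using assms by (simp add: represents_def diff_eq_eq)
    then show ?thesis
      using W by (simp add: D field_simps)
  qed
  ultimately show "reduced_form (tdeg W) W (U + W) Y (h p)"
    using H W assms by (auto simp: reduced_form_def represents_def intro: homogeneous3_add)
qed

lemma represents_0: "represents 0 x0 (x1 - x0) x2"
proof -
  note D = ring_mapD[OF ring_map_dehomogenize]
  have "is_unit (gcd x0 (gcd (x1 - x0) x2))"
    by (rule unit_of_x0_x2) (simp, meson dvd_trans gcd_dvd2)
  then have g: "gcd x0 (gcd (x1 - x0) x2) = 1"
    by (simp add: is_unit_gcd_iff)
  have d: "dehomogenize x0 = 1" "dehomogenize x1 = [:[:0, 1:]:]" "dehomogenize x2 = [:0, 1:]"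
    by (simp_all add: dehomogenize_def x0_def x1_def x2_def map_poly_pCons one_pCons)
  have "x0 \<noteq> 0"
    by (rule vars_nz)
  moreover have "homogeneous3 1 x0 \<and> homogeneous3 1 (x1 - x0) \<and> homogeneous3 1 x2"
    by (intro conjI homogeneous3_diff homogeneous3_vars)
  moreover have "h 0 = (X_rf, Y_rf)"
    by (simp add: rat_iterate_def rat_id_def)
  moreover have "X_rf - 1 = to_fract (dehomogenize (x1 - x0))" "Y_rf = to_fract (dehomogenize x2)"
    unfolding D(6) d by (simp_all only: X_rf_def Y_rf_def to_fract_diff to_fract_1)
  ultimately show ?thesis
    unfolding represents_def using g d(1) by auto
qed

lemma represents_Suc:
  assumes r: "represents p W U Y"
  shows "\<exists>W U Y. represents (Suc p) W U Y"
proof -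
  note D = ring_mapD[OF ring_map_dehomogenize]
  note nz = represents_nz[OF r] and H = represents_homogeneous[OF r]
  let ?W = "next_W W U Y" and ?U = "next_U W U Y" and ?Y = "next_Y W U Y"
  note hom = homogeneous3_next[OF H(1-3)]
  have rt: "ring_map (to_fract :: cpoly3 \<Rightarrow> _)"
    by (simp add: ring_map_def)
  note n1 = next_fraction[where \<theta> = to_fract and cc = const_f and W = W and U = U and Y = Y, OF rt refl]
  have n1: "?W \<noteq> 0" "y (Suc p) = to_fract ?Y / to_fract ?W" "u (Suc p) = to_fract ?U / to_fract ?W"
    using n1 nz r by (auto simp: represents_def)
  have rd: "ring_map (\<lambda>P. to_fract (dehomogenize P))"
    unfolding ring_map_def D(1,3,4) by simp
  have dc: "to_fract (dehomogenize (const3 a)) = const_rf a" for a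
    by (simp add: dehomogenize_def map_poly_pCons const_rf_def)
  have dnz: "dehomogenize W \<noteq> 0" "dehomogenize U \<noteq> 0" "dehomogenize Y \<noteq> 0"
    using dehomogenize_eq_0 H(1-3) nz by blast+
  then have hn: "fst (h p) - 1 \<noteq> 0" "snd (h p) \<noteq> 0"
    using r by (auto simp: represents_def)
  have hS: "h (Suc p) = k_map F \<circ>\<^sub>r h p"
    by (simp add: rat_iterate_def)
  note n2 = next_fraction[where \<theta> = "\<lambda>P. to_fract (dehomogenize P)" and cc = const_rf
      and W = W and U = U and Y = Y, OF rd dc]
  have n2: "snd (h (Suc p)) = to_fract (dehomogenize ?Y) / to_fract (dehomogenize ?W)"
    "fst (h (Suc p)) - 1 = to_fract (dehomogenize ?U) / to_fract (dehomogenize ?W)"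
    unfolding hS k_map_comp[OF hn] using n2 dnz r by (auto simp: represents_def)
  have nz': "?U \<noteq> 0" "?Y \<noteq> 0"
    using n1 orbit_nz[of "Suc p"] by auto
  define G where "G = gcd ?W (gcd ?U ?Y)"
  have G: "G \<noteq> 0"
    using n1(1) by (simp add: G_def)
  have "G dvd ?W" "G dvd ?U" "G dvd ?Y"
    by (auto simp: G_def intro: dvd_trans[OF gcd_dvd2])
  then obtain W' U' Y' where q: "?W = W' * G" "?U = U' * G" "?Y = Y' * G"
    by (metis dvdE mult.commute)
  have qnz: "W' \<noteq> 0" "U' \<noteq> 0" "Y' \<noteq> 0"
    using q n1(1) nz' by auto
  have "tdeg P' = tdeg P - tdeg G \<and> homogeneous3 (tdeg P') P'"
    if "P = P' * G" "P \<noteq> 0" "homogeneous3 e P" for P P' e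
    using that homogeneous3_factor[of e P' G] tdeg_mult[of P' G] by auto
  then have hom': "homogeneous3 (tdeg ?W - tdeg G) W'" "homogeneous3 (tdeg ?U - tdeg G) U'"
    "homogeneous3 (tdeg ?Y - tdeg G) Y'"
    using q n1(1) nz' hom by metis+
  have "tdeg ?U = tdeg ?W" "tdeg ?Y = tdeg ?W"
    using tdeg_homogeneous hom n1(1) nz' by metis+
  then have hom': "\<exists>d. homogeneous3 d W' \<and> homogeneous3 d U' \<and> homogeneous3 d Y'"
    using hom' by metis
  have "gcd W' (gcd U' Y') * G dvd G"
    unfolding G_def[symmetric] using q
    by (subst (2) G_def, intro gcd_greatest) (auto intro!: mult_dvd_mono intro: dvd_trans[OF gcd_dvd2])
  then have "is_unit (gcd W' (gcd U' Y'))"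
    using G by (metis dvd_mult_cancel_right mult_1)
  then have cop: "gcd W' (gcd U' Y') = 1"
    by (simp add: is_unit_gcd_iff)
  have dG: "dehomogenize G \<noteq> 0"
  proof -
    have "dehomogenize ?W \<noteq> 0"
      using dehomogenize_eq_0[OF hom(1)] n1(1) by blast
    then show ?thesis
      unfolding q(1) D(4) by auto
  qed
  have "represents (Suc p) W' U' Y'"
    unfolding represents_def using qnz hom' cop n1(2,3) n2 G dG unfolding q D(4) by simp
  then show ?thesis
    by blast
qed

lemma ex_represents: "\<exists>W U Y. represents p W U Y"
proof (induction p)
  case 0
  show ?case
    using represents_0 by blast
next
  case (Suc p)
  then show ?case
    using represents_Suc by blast
qed

definition y_denominator :: "cpoly3 \<Rightarrow> cpoly3 \<Rightarrow> cpoly3" where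
  "y_denominator W Y = W div gcd W Y"

lemma represents_multiplicities:
  assumes r: "represents p W U Y" and D: "prime D"
  shows "k_orbit.y_pole (fval D) y p = int (multiplicity D (y_denominator W Y))"
    and "k_orbit.pole (fval D) u y p = int (multiplicity D W)"
    and "k_orbit.common_zero (fval D) u y p = int (multiplicity D (gcd U Y))"
    and "fval D (u p) = int (multiplicity D U) - int (multiplicity D W)"
    and "fval D (y p) = int (multiplicity D Y) - int (multiplicity D W)"
    and "fval D (sfun (u p) (y p)) = int (multiplicity D (s_form W U Y)) - 2 * int (multiplicity D W)"
proof -
  have D': "prime_elem D"
    using D by simp
  interpret k_orbit "fval D" const_f F n u y
    by (rule k_orbit_fval[OF D'])
  note nz = represents_nz[OF r]
  have f: "u p = to_fract U / to_fract W" "y p = to_fract Y / to_fract W"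
    using r by (auto simp: represents_def)
  show vu: "fval D (u p) = int (multiplicity D U) - int (multiplicity D W)"
    and vy: "fval D (y p) = int (multiplicity D Y) - int (multiplicity D W)"
    unfolding f using fval_divide[OF D'] nz by blast+
  have "multiplicity D (gcd W (gcd U Y)) = 0"
    using r by (simp add: represents_def)
  moreover have g: "multiplicity D (gcd U Y) = min (multiplicity D U) (multiplicity D Y)"
    by (rule multiplicity_gcd) (use nz D in auto)
  moreover have "multiplicity D (gcd W (gcd U Y)) = min (multiplicity D W) (multiplicity D (gcd U Y))"
    by (rule multiplicity_gcd) (use nz D in auto)
  ultimately have min0: "min (multiplicity D W) (min (multiplicity D U) (multiplicity D Y)) = 0"
    by simp
  have "multiplicity D W = multiplicity D (y_denominator W Y * gcd W Y)"
    by (simp add: y_denominator_def)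
  also have "\<dots> = multiplicity D (y_denominator W Y) + multiplicity D (gcd W Y)"
    using nz by (intro prime_elem_multiplicity_mult_distrib[OF D']) (auto simp: y_denominator_def dvd_div_eq_0_iff)
  also have "multiplicity D (gcd W Y) = min (multiplicity D W) (multiplicity D Y)"
    by (rule multiplicity_gcd) (use nz D in auto)
  finally have B: "multiplicity D W = multiplicity D (y_denominator W Y) + min (multiplicity D W) (multiplicity D Y)" .
  show "y_pole p = int (multiplicity D (y_denominator W Y))"
    unfolding y_pole_def vy using B by linarith
  show "pole p = int (multiplicity D W)"
    unfolding pole_def vu vy using min0 by linarith
  show "common_zero p = int (multiplicity D (gcd U Y))"
    unfolding common_zero_def vu vy g using min0 by linarith
  have s: "sfun (u p) (y p) = to_fract (s_form W U Y) / to_fract (W * W)"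
    unfolding f using nz by (simp add: sfun_def s_form_def field_simps)
  have "sfun (u p) (y p) \<noteq> 0"
    using sfun_next_y[of "u p" "y p"] u_nz y_Suc[of p] y_nz[of "Suc p"] by simp
  then have "s_form W U Y \<noteq> 0"
    unfolding s by auto
  then show "fval D (sfun (u p) (y p)) = int (multiplicity D (s_form W U Y)) - 2 * int (multiplicity D W)"
    unfolding s using fval_divide[OF D', of "s_form W U Y" "W * W"] nz
      prime_elem_multiplicity_mult_distrib[OF D', of W W] by simp
qed

lemma s_form_nz:
  assumes r: "represents p W U Y"
  shows "s_form W U Y \<noteq> 0" "tdeg (s_form W U Y) = 2 * tdeg W"
proof -
  note nz = represents_nz[OF r] and H = represents_homogeneous[OF r]
  have f: "u p = to_fract U / to_fract W" "y p = to_fract Y / to_fract W"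
    using r by (auto simp: represents_def)
  interpret k_orbit "fval x0" const_f F n u y
    by (rule k_orbit_fval[OF prime_elem_x0])
  have s: "sfun (u p) (y p) = to_fract (s_form W U Y) / to_fract (W * W)"
    unfolding f using nz by (simp add: sfun_def s_form_def field_simps)
  have "sfun (u p) (y p) \<noteq> 0"
    using sfun_next_y[of "u p" "y p"] u_nz y_Suc[of p] y_nz[of "Suc p"] by simp
  then show "s_form W U Y \<noteq> 0"
    unfolding s by auto
  moreover have "homogeneous3 (tdeg W + tdeg W) (s_form W U Y)"
    unfolding s_form_def using H by (intro homogeneous3_add homogeneous3_mult)
  ultimately show "tdeg (s_form W U Y) = 2 * tdeg W"
    using tdeg_homogeneous by fastforce
qed

lemma tdeg_eqI:
  assumes "P \<noteq> 0" "Q \<noteq> 0" "\<And>D. prime D \<Longrightarrow> multiplicity D P = multiplicity D Q"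
  shows "tdeg P = tdeg Q"
  by (rule tdeg_associated, rule multiplicity_eq_imp_eq) (use assms in auto)

lemma y_denominator_nz: "W \<noteq> 0 \<Longrightarrow> y_denominator W Y \<noteq> 0"
  by (simp add: y_denominator_def dvd_div_eq_0_iff)

text \<open>
  Both equations say that two products of polynomials have the same multiplicity at each prime. So the products are
  associated and have the same degree.
\<close>

lemma degree_pole_balance:
  assumes r: "represents p W U Y" and r': "represents (Suc p) W' U' Y'"
    and b: "\<And>D. prime D \<Longrightarrow> k_orbit.pole_balance (fval D) n u y p"
  shows "tdeg (y_denominator W' Y') + tdeg (gcd U Y) = tdeg (y_denominator W Y) + tdeg W"
    and "tdeg W' + tdeg (gcd U Y) = n * tdeg (y_denominator W' Y') + tdeg (y_denominator W Y)"
proof -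
  note nz = represents_nz[OF r] represents_nz[OF r'] and H = represents_homogeneous[OF r]
  let ?B = "y_denominator W Y" and ?B' = "y_denominator W' Y'" and ?Z = "gcd U Y"
  have nz2: "?B \<noteq> 0" "?B' \<noteq> 0" "?Z \<noteq> 0"
    using nz by (simp_all add: y_denominator_nz)
  have bal: "int (multiplicity D ?B') + int (multiplicity D ?Z) = int (multiplicity D ?B) + int (multiplicity D U)"
    "int (multiplicity D Y) + int (multiplicity D ?B) + int n * int (multiplicity D ?B')
      = int (multiplicity D W) + int (multiplicity D W') + int (multiplicity D ?Z)" if D: "prime D" for D
  proof -
    interpret k_orbit "fval D" const_f F n u y
      by (rule k_orbit_fval) (use D in simp)
    note m = represents_multiplicities[OF r D] represents_multiplicities[OF r' D]
    show "int (multiplicity D ?B') + int (multiplicity D ?Z) = int (multiplicity D ?B) + int (multiplicity D U)"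
      "int (multiplicity D Y) + int (multiplicity D ?B) + int n * int (multiplicity D ?B')
      = int (multiplicity D W) + int (multiplicity D W') + int (multiplicity D ?Z)"
      using b[OF D] unfolding pole_balance_def m by linarith+
  qed
  have "tdeg (?B' * ?Z) = tdeg (?B * U)"
  proof (rule tdeg_eqI)
    fix D :: cpoly3 assume D: "prime D"
    then show "multiplicity D (?B' * ?Z) = multiplicity D (?B * U)"
      using bal(1)[OF D] nz nz2 by (simp add: prime_elem_multiplicity_mult_distrib)
  qed (use nz nz2 in auto)
  then show "tdeg ?B' + tdeg ?Z = tdeg ?B + tdeg W"
    using nz nz2 H by (simp add: tdeg_mult)
  have "tdeg (Y * ?B * ?B' ^ n) = tdeg (W * W' * ?Z)"
  proof (rule tdeg_eqI)
    fix D :: cpoly3 assume D: "prime D"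
    have "int (multiplicity D Y + multiplicity D ?B + n * multiplicity D ?B')
      = int (multiplicity D W + multiplicity D W' + multiplicity D ?Z)"
      using bal(2)[OF D] by simp
    then have "multiplicity D Y + multiplicity D ?B + n * multiplicity D ?B'
      = multiplicity D W + multiplicity D W' + multiplicity D ?Z"
      by (simp only: of_nat_eq_iff)
    then show "multiplicity D (Y * ?B * ?B' ^ n) = multiplicity D (W * W' * ?Z)"
      using D nz nz2 by (simp add: prime_elem_multiplicity_mult_distrib prime_elem_multiplicity_power_distrib)
  qed (use nz nz2 in auto)
  then have "tdeg W + tdeg ?B + n * tdeg ?B' = tdeg W + tdeg W' + tdeg ?Z"
    using nz nz2 H by (simp add: tdeg_mult tdeg_power)
  then show "tdeg W' + tdeg ?Z = n * tdeg ?B' + tdeg ?B"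
    by simp
qed

text \<open>
  The multiplicity of \<open>s_form W U Y\<close> is that of \<open>s\<close> increased by twice that of \<open>W\<close>, and its degree is twice that of \<open>W\<close>, so
  both contributions of \<open>W\<close> cancel.
\<close>

lemma degree_s_balance:
  assumes r: "represents p W U Y" and r': "represents q W' U' Y'"
    and b: "\<And>D. prime D \<Longrightarrow> k_orbit.common_zero (fval D) u y q + k_orbit.common_zero (fval D) u y p
      = fval D (sfun (u p) (y p)) + int (n + 1) * k_orbit.y_pole (fval D) y p"
  shows "tdeg (gcd U' Y') + tdeg (gcd U Y) = (n + 1) * tdeg (y_denominator W Y)"
proof -
  note nz = represents_nz[OF r] represents_nz[OF r'] and s = s_form_nz[OF r]
  let ?B = "y_denominator W Y" and ?Z = "gcd U Y" and ?Z' = "gcd U' Y'"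
  have nz2: "?B \<noteq> 0" "?Z \<noteq> 0" "?Z' \<noteq> 0"
    using nz by (simp_all add: y_denominator_nz)
  have "tdeg (?Z' * ?Z * W ^ 2) = tdeg (s_form W U Y * ?B ^ (n + 1))"
  proof (rule tdeg_eqI)
    fix D :: cpoly3 assume D: "prime D"
    have "int (multiplicity D ?Z' + multiplicity D ?Z + 2 * multiplicity D W)
        = int (multiplicity D (s_form W U Y) + (n + 1) * multiplicity D ?B)"
      using b[OF D] unfolding represents_multiplicities[OF r D] represents_multiplicities[OF r' D]
      by (simp add: algebra_simps)
    then have "multiplicity D ?Z' + multiplicity D ?Z + 2 * multiplicity D W
        = multiplicity D (s_form W U Y) + (n + 1) * multiplicity D ?B"
      by (simp only: of_nat_eq_iff)
    then show "multiplicity D (?Z' * ?Z * W ^ 2) = multiplicity D (s_form W U Y * ?B ^ (n + 1))"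
      using D nz nz2 s(1)
      by (simp add: prime_elem_multiplicity_mult_distrib prime_elem_multiplicity_power_distrib del: power_Suc)
  qed (use nz nz2 s in auto)
  then have "tdeg ?Z' + tdeg ?Z + 2 * tdeg W = 2 * tdeg W + (n + 1) * tdeg ?B"
    using nz nz2 s by (simp add: tdeg_mult tdeg_power del: power_Suc)
  then show ?thesis
    by simp
qed

lemma degree_s_start:
  assumes r: "represents 0 W U Y" and r': "represents q W' U' Y'"
    and b: "\<And>D. prime D \<Longrightarrow> k_orbit.common_zero (fval D) u y q
      = fval D (sfun (u 0) (y 0)) + 2 * k_orbit.pole (fval D) u y 0"
  shows "tdeg (gcd U' Y') = 2 * tdeg W"
proof -
  note nz = represents_nz[OF r'] and s = s_form_nz[OF r]
  have "tdeg (gcd U' Y') = tdeg (s_form W U Y)"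
  proof (rule tdeg_eqI)
    fix D :: cpoly3 assume D: "prime D"
    show "multiplicity D (gcd U' Y') = multiplicity D (s_form W U Y)"
      using b[OF D] unfolding represents_multiplicities[OF r D] represents_multiplicities[OF r' D] by simp
  qed (use nz s in auto)
  then show ?thesis
    using s by simp
qed

lemma degree_common_zero:
  assumes r: "represents p W U Y"
    and b: "\<And>D. prime D \<Longrightarrow> k_orbit.common_zero (fval D) u y p = 0"
  shows "tdeg (gcd U Y) = 0"
proof -
  have "tdeg (gcd U Y) = tdeg 1"
    using b represents_nz[OF r] by (intro tdeg_eqI) (auto simp: represents_multiplicities(3)[OF r])
  then show ?thesis
    by (simp add: tdeg_unit)
qed

text \<open>
  Here \<open>I p\<close> is the degree of the denominator of \<open>y\<close> and \<open>z p\<close> the degree of \<open>gcd U Y\<close> for the \<open>p\<close>-th iterate. At time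
  \<open>0\<close> the curve \<open>s = 0\<close> is a conic, hence \<open>z (2 * m + 1) = 2\<close>.
\<close>

theorem degree_recurrence:
  obtains d I z :: "nat \<Rightarrow> nat" where
    "\<And>p. rat_degree (h p) = d p" "d 0 = 1" "I 0 = 1"
    "\<And>p. I (Suc p) + z p = I p + d p" "\<And>p. d (Suc p) + z p = n * I (Suc p) + I p"
    "(\<forall>m::nat. coeff F 0 \<noteq> 2 / (1 + of_nat m)) \<longrightarrow> (\<forall>p. z p = 0)"
    "\<And>m. coeff F 0 = 2 / (1 + of_nat m) \<Longrightarrow> (\<forall>p\<le>2 * m. z p = 0) \<and> z (2 * m + 1) = 2
      \<and> (\<forall>p>0. z (p + (2 * m + 1)) + z p = (n + 1) * I p)"
proof -
  define T where "T p = (if p = 0 then (x0, x1 - x0, x2) else (SOME (W, U, Y). represents p W U Y))" for p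
  define W U Y where "W p = fst (T p)" and "U p = fst (snd (T p))" and "Y p = snd (snd (T p))" for p
  have r: "represents p (W p) (U p) (Y p)" for p
  proof (cases "p = 0")
    case True
    then show ?thesis
      using represents_0 by (simp add: W_def U_def Y_def T_def)
  next
    case False
    have "\<exists>t. case t of (W, U, Y) \<Rightarrow> represents p W U Y"
      using ex_represents[of p] by auto
    then have "case (SOME (W, U, Y). represents p W U Y) of (W, U, Y) \<Rightarrow> represents p W U Y"
      by (rule someI_ex)
    then show ?thesis
      using False by (simp add: W_def U_def Y_def T_def case_prod_beta)
  qed
  define d I z where "d p = tdeg (W p)" and "I p = tdeg (y_denominator (W p) (Y p))"
    and "z p = tdeg (gcd (U p) (Y p))" for p
  have orb: "k_orbit (fval D) const_f F n u y" if "prime D" for D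
    by (rule k_orbit_fval) (use that in simp)
  have bal: "k_orbit.pole_balance (fval D) n u y p" if D: "prime D" for D p
  proof (cases "\<exists>m::nat. coeff F 0 = 2 / (1 + of_nat m)")
    case True
    then show ?thesis
      using k_orbit.balance_with_corner(1)[OF orb[OF D]] by blast
  next
    case False
    then show ?thesis
      using k_orbit.balance_without_corner[OF orb[OF D]] by blast
  qed
  have x0: "tdeg x0 = 1"
    by (rule tdeg_homogeneous[OF homogeneous3_vars(1) vars_nz(1)])
  have "is_unit (gcd x0 x2)"
    by (rule unit_of_x0_x2) auto
  then have "gcd x0 x2 = 1"
    by (simp add: is_unit_gcd_iff)
  then have 0: "d 0 = 1" "I 0 = 1"
    by (simp_all add: d_def I_def W_def Y_def T_def y_denominator_def x0)
  show ?thesis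
  proof (rule that[of d I z])
    show "rat_degree (h p) = d p" for p
      unfolding d_def by (rule represents_degree[OF r])
    show "d 0 = 1" "I 0 = 1"
      by (rule 0)+
    show "I (Suc p) + z p = I p + d p" "d (Suc p) + z p = n * I (Suc p) + I p" for p
      unfolding d_def I_def z_def by (rule degree_pole_balance[OF r r bal]; assumption)+
    show "(\<forall>m::nat. coeff F 0 \<noteq> 2 / (1 + of_nat m)) \<longrightarrow> (\<forall>p. z p = 0)"
      unfolding z_def using k_orbit.balance_without_corner[OF orb]
      by (intro impI allI degree_common_zero[OF r]) blast
    fix m assume a: "coeff F 0 = 2 / (1 + of_nat m)"
    note b = k_orbit.balance_with_corner[OF orb a]
    have "z p = 0" if "p \<le> 2 * m" for p
      unfolding z_def using that b(2) by (intro degree_common_zero[OF r])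
    moreover have "z (2 * m + 1) = 2 * tdeg (W 0)"
      unfolding z_def using b(4) by (intro degree_s_start[OF r r])
    moreover have "z (p + (2 * m + 1)) + z p = (n + 1) * I p" if "p > 0" for p
      unfolding z_def I_def using that b(3) by (intro degree_s_balance[OF r r])
    ultimately show "(\<forall>p\<le>2 * m. z p = 0) \<and> z (2 * m + 1) = 2
      \<and> (\<forall>p>0. z (p + (2 * m + 1)) + z p = (n + 1) * I p)"
      using 0(1) by (simp add: d_def)
  qed
qed

end

section \<open>Growth of the degrees\<close>

lemma root_limit_exponential:
  fixes f :: "nat \<Rightarrow> nat"
  assumes "L > 0" "c > 0" "C > 0"
    and "\<And>p. p \<ge> N \<Longrightarrow> c * L ^ p \<le> real (f p) \<and> real (f p) \<le> C * L ^ p"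
  shows "(\<lambda>p. root p (real (f p))) \<longlonglongrightarrow> L"
proof (rule tendsto_sandwich)
  have lim: "(\<lambda>p. root p b * L) \<longlonglongrightarrow> L" if "b > 0" for b
    using tendsto_mult_right[OF LIMSEQ_root_const[OF that], of L] by simp
  show "(\<lambda>p. root p c * L) \<longlonglongrightarrow> L" "(\<lambda>p. root p C * L) \<longlonglongrightarrow> L"
    using lim assms by auto
  have eq: "root p b * L = root p (b * L ^ p)" if "p > 0" for p b
    using that assms(1) by (simp add: real_root_mult real_root_power_cancel)
  show "\<forall>\<^sub>F p in sequentially. root p c * L \<le> root p (real (f p))"
    using eventually_ge_at_top[of "max N 1"]
    by eventually_elim (use assms(4) in \<open>simp add: eq\<close>)
  show "\<forall>\<^sub>F p in sequentially. root p (real (f p)) \<le> root p C * L"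
    using eventually_ge_at_top[of "max N 1"]
    by eventually_elim (use assms(4) in \<open>simp add: eq\<close>)
qed

lemma quadratic_growth:
  fixes I d :: "nat \<Rightarrow> nat"
  assumes n: "n \<ge> 1" and init: "d 0 = 1" "I 0 = 1"
    and rec: "\<And>p. I (Suc p) = I p + d p" "\<And>p. d (Suc p) = n * I (Suc p) + I p"
  shows "\<exists>L. (\<lambda>p. root p (real (d p))) \<longlonglongrightarrow> L \<and>
    is_largest_root (\<lambda>x. x ^ 2 - (real n + 1) * x - 1) L"
proof -
  define b where "b = real n + 1"
  define L where "L = (b + sqrt (b ^ 2 + 4)) / 2"
  have b: "b \<ge> 2"
    using n by (simp add: b_def)
  have "sqrt (b ^ 2 + 4) > sqrt (b ^ 2)"
    by (rule real_sqrt_less_mono) simp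
  then have Lb: "L > b"
    using b by (simp add: L_def)
  have L2: "L ^ 2 = b * L + 1"
    using real_sqrt_pow2[of "b ^ 2 + 4"] by (simp add: L_def power2_eq_square field_simps)
  have root: "s \<le> L" if "s ^ 2 - b * s - 1 = 0" for s
  proof (rule ccontr)
    assume "\<not> s \<le> L"
    then have "s > L" by simp
    have "(s - L) * (s + L - b) = 0"
      using that L2 by (simp add: power2_eq_square algebra_simps)
    then show False
      using \<open>s > L\<close> Lb b by simp
  qed
  have I2: "I (Suc (Suc p)) = (n + 1) * I (Suc p) + I p" for p
    using rec(1)[of "Suc p"] rec(2)[of p] by simp
  have bd: "L ^ p \<le> L * real (I p) \<and> real (I p) \<le> 2 * L ^ p" for p
  proof (induction p rule: induct_nat_012)
    case 0
    then show ?case using init Lb b by simp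
  next
    case 1
    then show ?case using rec(1)[of 0] init Lb b by simp
  next
    case (ge2 p)
    have e: "L ^ Suc (Suc p) = b * L ^ Suc p + L ^ p"
    proof -
      have "L ^ Suc (Suc p) = L ^ 2 * L ^ p"
        by (simp add: power2_eq_square)
      then show ?thesis
        unfolding L2 by (simp add: algebra_simps)
    qed
    have r: "real (I (Suc (Suc p))) = b * real (I (Suc p)) + real (I p)"
      unfolding I2 by (simp add: b_def algebra_simps)
    have "b * L ^ Suc p \<le> b * (L * real (I (Suc p)))" "b * real (I (Suc p)) \<le> b * (2 * L ^ Suc p)"
      using ge2(2) b by (intro mult_left_mono; simp)+
    then show ?case
      unfolding e r using ge2(1) by (simp add: algebra_simps)
  qed
  have "(\<lambda>p. root p (real (d p))) \<longlonglongrightarrow> L"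
  proof (rule root_limit_exponential[of L "1 / L" "2 * b" 1])
    fix p :: nat assume "p \<ge> 1"
    then obtain k where p: "p = Suc k"
      by (cases p) auto
    have "I k \<le> I p"
      using rec(1)[of k] p by simp
    moreover have "I p \<le> n * I p"
      using n by (cases n) auto
    moreover have "d p = n * I p + I k" "(n + 1) * I p = n * I p + I p"
      using rec(2)[of k] p by simp_all
    ultimately have "I p \<le> d p" "d p \<le> (n + 1) * I p"
      by linarith+
    then have "real (I p) \<le> real (d p)" "real (d p) \<le> b * real (I p)"
      unfolding b_def by (simp, metis (mono_tags) of_nat_1 of_nat_add of_nat_le_iff of_nat_mult)
    moreover have "1 / L * L ^ p \<le> real (I p)"
      using bd[of p] Lb b by (simp add: field_simps)
    moreover have "b * real (I p) \<le> b * (2 * L ^ p)"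
      using bd[of p] b by (intro mult_left_mono) auto
    ultimately show "1 / L * L ^ p \<le> real (d p) \<and> real (d p) \<le> 2 * b * L ^ p"
      by (simp add: mult.assoc mult.left_commute)
  qed (use Lb b in auto)
  then show ?thesis
    using L2 root by (intro exI[of _ L]) (auto simp: is_largest_root_def b_def)
qed

text \<open>
  After division by \<open>x\<^sup>2 - 1\<close> all coefficients except the leading one have the same sign, which is
  the source of both the uniqueness of the positive root and the estimates of the growth.
\<close>

lemma corner_polynomial_factor:
  fixes x :: real
  shows "x ^ (2 * m + 1) * (x ^ 2 - (b + 1) * x - 1) + x ^ 2 + b
    = (x ^ 2 - 1) * (x ^ (2 * m + 1) - (b + (b + 1) * (\<Sum>k=1..m. x ^ (2 * k))))"
proof -
  have "(x ^ 2 - 1) * (\<Sum>k=1..m. x ^ (2 * k)) = x ^ (2 * m + 2) - x ^ 2"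
    by (induction m) (simp_all add: algebra_simps power2_eq_square)
  moreover have "(x ^ 2 - 1) * (b + (b + 1) * S) = (x ^ 2 - 1) * b + (b + 1) * ((x ^ 2 - 1) * S)" for S
    by (simp add: algebra_simps)
  ultimately have "(x ^ 2 - 1) * (b + (b + 1) * (\<Sum>k=1..m. x ^ (2 * k)))
      = (x ^ 2 - 1) * b + (b + 1) * (x ^ (2 * m + 2) - x ^ 2)"
    by (simp only:)
  then show ?thesis
    unfolding right_diff_distrib[of "x ^ 2 - 1"] by (simp add: algebra_simps power2_eq_square)
qed

text \<open>
  By \<open>I_sum\<close> the sequence \<open>z\<close> satisfies the positive recursion \<open>zrec\<close> up to the bounded term \<open>Q\<close>. Induction
  along a positive recursion preserves both \<open>c L\<^sup>p \<le> z\<^sub>p\<close> and, with a constant that absorbs \<open>Q\<close>, an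
  upper bound by a multiple of \<open>L\<^sup>p\<close>.
\<close>

lemma corner_growth:
  fixes I d z :: "nat \<Rightarrow> nat" and m :: nat
  assumes n: "n \<ge> 2" and init: "d 0 = 1" "I 0 = 1"
    and rec: "\<And>p. I (Suc p) + z p = I p + d p" "\<And>p. d (Suc p) + z p = n * I (Suc p) + I p"
    and z: "\<And>p. p \<le> 2 * m \<Longrightarrow> z p = 0" "z (2 * m + 1) = 2"
      "\<And>p. p > 0 \<Longrightarrow> z (p + (2 * m + 1)) + z p = (n + 1) * I p"
  shows "\<exists>L. (\<lambda>p. root p (real (d p))) \<longlonglongrightarrow> L \<and> is_largest_root
    (\<lambda>x. x ^ (2 * m + 1) * (x ^ 2 - (real n + 1) * x - 1) + x ^ 2 + real n) L"
proof -
  define b where "b = real n"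
  define A where "A x = b + (b + 1) * (\<Sum>k=1..m. x ^ (2 * k))" for x :: real
  have b: "b \<ge> 2"
    using n by (simp add: b_def)
  have "\<exists>x\<ge>1. x \<le> b + 2 \<and> x ^ (2 * m + 1) - A x = 0"
  proof (rule IVT)
    have "0 \<le> (b + 1) * real m"
      using b by simp
    moreover have "A 1 = b + (b + 1) * real m"
      by (simp add: A_def)
    ultimately show "(1::real) ^ (2 * m + 1) - A 1 \<le> 0"
      using b unfolding power_one by linarith
    \<comment> \<open>At \<open>?t = b + 2\<close> the sum is compared with a geometric series of factor \<open>?t - 1 = b + 1\<close>.\<close>
    let ?t = "b + 2"
    have "A ?t \<le> (b + 1) * (\<Sum>k=0..m. ?t ^ (2 * k))"
      unfolding A_def by (simp add: sum.atLeast_Suc_atMost[of 0 m] algebra_simps)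
    also have "(\<Sum>k=0..m. ?t ^ (2 * k)) = (\<Sum>i\<in>(\<lambda>k. 2 * k) ` {0..m}. ?t ^ i)"
      by (subst sum.reindex) (auto simp: inj_on_def)
    also have "\<dots> \<le> (\<Sum>i<2 * m + 1. ?t ^ i)"
      using b by (intro sum_mono2) auto
    also have "(b + 1) * (\<Sum>i<2 * m + 1. ?t ^ i) = ?t ^ (2 * m + 1) - 1"
      using power_diff_1_eq[of ?t "2 * m + 1"] by (simp add: algebra_simps)
    finally show "0 \<le> ?t ^ (2 * m + 1) - A ?t"
      using b by (simp add: mult_left_mono)
    show "\<forall>x. 1 \<le> x \<and> x \<le> ?t \<longrightarrow> isCont (\<lambda>x. x ^ (2 * m + 1) - A x) x"
      unfolding A_def by (intro allI impI continuous_intros)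
  qed (use b in simp)
  then obtain L where L: "L \<ge> 1" "L ^ (2 * m + 1) = A L"
    by auto
  \<comment> \<open>For \<open>t > 1\<close> passing from \<open>L\<close> to \<open>t L\<close> multiplies \<open>A\<close> by at most \<open>t\<^sup>2\<^sup>m\<close>.\<close>
  have top: "s \<le> L" if "s ^ (2 * m + 1) * (s ^ 2 - (b + 1) * s - 1) + s ^ 2 + b = 0" for s
  proof (rule ccontr)
    assume "\<not> s \<le> L"
    then have s: "s > L" by simp
    define t where "t = s / L"
    have t: "t > 1" and st: "s = t * L"
      using s L(1) by (auto simp: t_def)
    have "s ^ 2 > 1"
      using s L(1) by (simp add: one_less_power)
    then have sA: "s ^ (2 * m + 1) = A s"
      using that unfolding corner_polynomial_factor A_def by simp
    have "b * 1 \<le> b * t ^ (2 * m)"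
      using b t by (intro mult_left_mono one_le_power) auto
    moreover have "(\<Sum>k=1..m. s ^ (2 * k)) \<le> (\<Sum>k=1..m. t ^ (2 * m) * L ^ (2 * k))"
      unfolding st power_mult_distrib using t L(1)
      by (intro sum_mono mult_right_mono power_increasing) auto
    then have "(b + 1) * (\<Sum>k=1..m. s ^ (2 * k)) \<le> (b + 1) * (t ^ (2 * m) * (\<Sum>k=1..m. L ^ (2 * k)))"
      using b by (intro mult_left_mono) (auto simp: sum_distrib_left)
    ultimately have "A s \<le> t ^ (2 * m) * A L"
      unfolding A_def by (simp add: algebra_simps)
    also have "\<dots> = t ^ (2 * m) * L ^ (2 * m + 1)"
      by (simp only: L(2))
    also have "\<dots> < t ^ (2 * m + 1) * L ^ (2 * m + 1)"
      using t L(1) by (intro mult_strict_right_mono power_strict_increasing) auto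
    also have "\<dots> = s ^ (2 * m + 1)"
      by (simp only: st power_mult_distrib)
    finally show False
      using sA by simp
  qed
  have I2: "I (Suc (Suc p)) + z p = z (p + 2 * m + 2) + I p" for p
    using rec(1)[of "Suc p"] rec(2)[of p] z(3)[of "Suc p"] by simp
  have I_sum: "I p = (\<Sum>k\<le>m. z (p + 2 * k)) + (if even p then 1 else 0)" for p
  proof (induction p rule: induct_nat_012)
    case 0
    then show ?case using init z(1) by simp
  next
    case 1
    have "(\<Sum>k\<le>m. z (1 + 2 * k)) = (\<Sum>k<m. z (1 + 2 * k)) + z (1 + 2 * m)"
      by (simp add: lessThan_Suc_atMost[symmetric])
    also have "(\<Sum>k<m. z (1 + 2 * k)) = 0"
      using z(1) by simp
    finally show ?case using rec(1)[of 0] init z(1)[of 0] z(2) by simp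
  next
    case (ge2 p)
    have "(\<Sum>k\<le>m. z (Suc (Suc p) + 2 * k)) + z p = (\<Sum>k\<le>Suc m. z (p + 2 * k))"
      by (subst sum.atMost_Suc_shift) simp
    also have "\<dots> = (\<Sum>k\<le>m. z (p + 2 * k)) + z (p + 2 * m + 2)"
      by simp
    finally show ?case
      using I2[of p] ge2(1) by simp
  qed
  have sum0: "(\<Sum>k\<le>m. z (p + 2 * k)) = z p + (\<Sum>k=1..m. z (p + 2 * k))" for p
    by (simp add: atMost_atLeast0 sum.atLeast_Suc_atMost)
  define Q where "Q p = (if even p then 1 else 0 :: real)" for p :: nat
  have zrec: "real (z (p + (2 * m + 1))) = b * real (z p)
      + (b + 1) * (\<Sum>k=1..m. real (z (p + 2 * k))) + (b + 1) * Q p" if "p > 0" for p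
  proof -
    have "real (z (p + (2 * m + 1))) + real (z p) = (b + 1) * real (I p)"
      using arg_cong[OF z(3)[OF that], of real] by (simp add: b_def algebra_simps)
    also have "real (I p) = real (z p) + (\<Sum>k=1..m. real (z (p + 2 * k))) + Q p"
      unfolding I_sum[of p] sum0 by (simp add: Q_def)
    finally show ?thesis
      by (simp add: algebra_simps)
  qed
  have Lrec: "L ^ (p + (2 * m + 1)) = b * L ^ p + (b + 1) * (\<Sum>k=1..m. L ^ (p + 2 * k))" for p
    unfolding power_add[of L p] L(2) A_def by (simp add: algebra_simps sum_distrib_left power_add)
  \<comment> \<open>The summand \<open>3\<close> absorbs \<open>Q\<close>, since \<open>(b + 1) + 3 \<le> 3 b\<close>, and then \<open>5\<close> covers \<open>z (2 * m + 1) + 3\<close>.\<close>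
  have up: "real (z p) + 3 \<le> 5 * L ^ p" for p
  proof (induction p rule: less_induct)
    case (less p)
    have L1: "L ^ p \<ge> 1"
      using L(1) by (rule one_le_power)
    consider "p \<le> 2 * m" | "p = 2 * m + 1" | "p > 2 * m + 1"
      by linarith
    then show ?case
    proof cases
      case 3
      define q where "q = p - (2 * m + 1)"
      have p: "p = q + (2 * m + 1)" and q: "q > 0"
        using 3 by (auto simp: q_def)
      have "real (z (q + 2 * k)) \<le> 5 * L ^ (q + 2 * k) - 3" if "k \<in> {1..m}" for k
        using less[of "q + 2 * k"] that p by auto
      then have "(\<Sum>k=1..m. real (z (q + 2 * k))) \<le> (\<Sum>k=1..m. 5 * L ^ (q + 2 * k) - 3)"
        by (rule sum_mono)
      also have "\<dots> = 5 * (\<Sum>k=1..m. L ^ (q + 2 * k)) - 3 * real m"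
        by (simp add: sum_subtractf sum_distrib_left)
      finally have "(b + 1) * (\<Sum>k=1..m. real (z (q + 2 * k)))
          \<le> (b + 1) * (5 * (\<Sum>k=1..m. L ^ (q + 2 * k)) - 3 * real m)"
        using b by (intro mult_left_mono) auto
      moreover have "b * real (z q) \<le> b * (5 * L ^ q - 3)"
        using less[of q] p b by (intro mult_left_mono) auto
      moreover have "(b + 1) * Q q \<le> (b + 1) * 1"
        using b by (intro mult_left_mono) (auto simp: Q_def)
      ultimately have "real (z p) \<le> b * (5 * L ^ q - 3)
          + (b + 1) * (5 * (\<Sum>k=1..m. L ^ (q + 2 * k)) - 3 * real m) + (b + 1) * 1"
        unfolding p zrec[OF q] by linarith
      also have "\<dots> = 5 * L ^ p - 3 * b - 3 * ((b + 1) * real m) + b + 1"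
        unfolding p Lrec by (simp add: algebra_simps)
      also have "\<dots> \<le> 5 * L ^ p - 3"
      proof -
        have "0 \<le> (b + 1) * real m"
          using b by simp
        then show ?thesis
          using b by linarith
      qed
      finally show ?thesis
        by simp
    qed (use z(1,2) L1 in auto)
  qed
  have pos: "z p \<ge> 1" if "p \<ge> 2 * m + 1" for p
    using that
  proof (induction p rule: less_induct)
    case (less p)
    show ?case
    proof (cases "p = 2 * m + 1")
      case True
      then show ?thesis using z(2) by simp
    next
      case False
      define q where "q = p - (2 * m + 1)"
      have p: "p = q + (2 * m + 1)" and q: "q > 0"
        using less(2) False by (auto simp: q_def)
      have zq: "z (q + 2 * m) \<ge> 1"
        using less(1)[of "q + 2 * m"] p q by simp
      have "z p + z q = (n + 1) * I q"
        using z(3)[OF q] p by simp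
      moreover have "(\<Sum>k\<le>m. z (q + 2 * k)) \<le> I q"
        unfolding I_sum[of q] by simp
      moreover have "z (q + 2 * m) \<le> (\<Sum>k\<le>m. z (q + 2 * k))" "z (q + 2 * 0) \<le> (\<Sum>k\<le>m. z (q + 2 * k))"
        by (rule member_le_sum; simp)+
      ultimately have "z p \<ge> n * I q" "I q \<ge> 1"
        using zq by auto
      then show ?thesis
        using n by (metis le_trans mult_le_mono nat_mult_1 one_le_numeral)
    qed
  qed
  \<comment> \<open>The value \<open>c\<close> makes \<open>c * L ^ p \<le> 1\<close> on the initial window from \<open>2 * m + 1\<close> to \<open>4 * m + 1\<close>.\<close>
  define c where "c = 1 / L ^ (4 * m + 1)"
  have c: "c > 0"
    using L(1) by (simp add: c_def)
  have low: "c * L ^ p \<le> real (z p)" if "p \<ge> 2 * m + 1" for p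
    using that
  proof (induction p rule: less_induct)
    case (less p)
    show ?case
    proof (cases "p \<le> 4 * m + 1")
      case True
      then have "L ^ p \<le> L ^ (4 * m + 1)"
        using L(1) by (rule power_increasing)
      then have "c * L ^ p \<le> 1"
        using L(1) by (simp add: c_def)
      then show ?thesis
        using pos[OF less(2)] by simp
    next
      case False
      define q where "q = p - (2 * m + 1)"
      have p: "p = q + (2 * m + 1)" and q: "q \<ge> 2 * m + 1"
        using False by (auto simp: q_def)
      have "(\<Sum>k=1..m. c * L ^ (q + 2 * k)) \<le> (\<Sum>k=1..m. real (z (q + 2 * k)))"
        by (rule sum_mono) (use less(1) p q in auto)
      then have "(b + 1) * (\<Sum>k=1..m. c * L ^ (q + 2 * k)) \<le> (b + 1) * (\<Sum>k=1..m. real (z (q + 2 * k)))"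
        using b by (intro mult_left_mono) auto
      moreover have "b * (c * L ^ q) \<le> b * real (z q)"
        using less(1)[of q] p q b by (intro mult_left_mono) auto
      moreover have "(b + 1) * Q q \<ge> 0"
        using b by (simp add: Q_def)
      ultimately have "b * (c * L ^ q) + (b + 1) * (\<Sum>k=1..m. c * L ^ (q + 2 * k)) \<le> real (z p)"
        unfolding p using zrec[of q] q by simp
      moreover have "b * (c * L ^ q) + (b + 1) * (\<Sum>k=1..m. c * L ^ (q + 2 * k)) = c * L ^ p"
        unfolding p Lrec by (simp add: algebra_simps sum_distrib_left)
      ultimately show ?thesis
        by simp
    qed
  qed
  define M where "M = 5 * (L ^ (2 * m + 1) + 1)"
  have I_up: "real (I p) \<le> M * L ^ p" for p
  proof (cases "p = 0")
    case True
    have "L ^ (2 * m + 1) \<ge> 1"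
      using L(1) by (rule one_le_power)
    then show ?thesis
      using True init by (simp add: M_def)
  next
    case False
    then have "I p \<le> z (p + (2 * m + 1)) + z p"
      using z(3)[of p] by simp
    then have "real (I p) \<le> real (z (p + (2 * m + 1))) + real (z p)"
      by (simp flip: of_nat_add)
    also have "\<dots> \<le> 5 * L ^ (p + (2 * m + 1)) + 5 * L ^ p"
      using up[of p] up[of "p + (2 * m + 1)"] by linarith
    also have "\<dots> = M * L ^ p"
      by (simp add: M_def algebra_simps power_add)
    finally show ?thesis .
  qed
  have zI: "z p \<le> I p" for p
    unfolding I_sum[of p] sum0 by simp
  have M: "M > 0"
    using L(1) by (simp add: M_def add_pos_pos)
  have "(\<lambda>p. root p (real (d p))) \<longlonglongrightarrow> L"
  proof (rule root_limit_exponential[of L c "(b + 1) * M" "2 * m + 1"])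
    fix p assume p1: "p \<ge> 2 * m + 1"
    then obtain k where p: "p = Suc k"
      by (cases p) auto
    have "d p \<le> n * I p + I k" "n * I p \<le> d p"
      using rec(2)[of k] zI[of k] p by auto
    moreover have "z p \<le> n * I p"
      using zI[of p] n by (metis le_trans mult_le_mono1 nat_mult_1 one_le_numeral)
    ultimately have "real (z p) \<le> real (d p)" "real (d p) \<le> b * real (I p) + real (I k)"
      unfolding b_def by (simp, metis of_nat_add of_nat_le_iff of_nat_mult)
    moreover have "M * L ^ k \<le> M * L ^ p"
      using M L(1) p by (intro mult_left_mono power_increasing) auto
    then have "real (I k) \<le> M * L ^ p"
      using I_up[of k] by linarith
    moreover have "b * real (I p) \<le> b * (M * L ^ p)"
      using I_up[of p] b by (intro mult_left_mono) auto
    ultimately show "c * L ^ p \<le> real (d p) \<and> real (d p) \<le> (b + 1) * M * L ^ p"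
      using low[OF p1] by (simp add: algebra_simps)
  qed (use L(1) c M b in auto)
  moreover have "L ^ (2 * m + 1) * (L ^ 2 - (b + 1) * L - 1) + L ^ 2 + b = 0"
    unfolding corner_polynomial_factor using L(2) by (simp add: A_def)
  ultimately show ?thesis
    using top by (intro exI[of _ L]) (simp add: is_largest_root_def b_def)
qed

theorem theorem1:
  fixes F :: "complex poly" and n :: nat
  assumes "degree F = n" and "even n" and "n > 0"
  shows "((\<forall>m::nat. coeff F 0 \<noteq> 2 / (1 + of_nat m)) \<longrightarrow>
            (\<exists>\<delta>. has_degree_complexity (k_map F) \<delta> \<and>
                 is_largest_root (\<lambda>x. x ^ 2 - (real n + 1) * x - 1) \<delta>)) \<and>
         (\<forall>m::nat. coeff F 0 = 2 / (1 + of_nat m) \<longrightarrow>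
            (\<exists>\<delta>. has_degree_complexity (k_map F) \<delta> \<and>
                 is_largest_root
                   (\<lambda>x. x ^ (2 * m + 1) * (x ^ 2 - (real n + 1) * x - 1) + x ^ 2 + real n) \<delta>))"
proof -
  interpret k_degree F n
    using assms by unfold_locales
  obtain d I z :: "nat \<Rightarrow> nat" where
    deg: "\<And>p. rat_degree (rat_iterate (k_map F) p) = d p" and init: "d 0 = 1" "I 0 = 1"
    and rec: "\<And>p. I (Suc p) + z p = I p + d p" "\<And>p. d (Suc p) + z p = n * I (Suc p) + I p"
    and z0: "(\<forall>m::nat. coeff F 0 \<noteq> 2 / (1 + of_nat m)) \<longrightarrow> (\<forall>p. z p = 0)"
    and zm: "\<And>m. coeff F 0 = 2 / (1 + of_nat m) \<Longrightarrow> (\<forall>p\<le>2 * m. z p = 0) \<and> z (2 * m + 1) = 2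
      \<and> (\<forall>p>0. z (p + (2 * m + 1)) + z p = (n + 1) * I p)"
    by (rule degree_recurrence) (rule that)
  have n: "n \<ge> 2"
    using assms by (elim evenE) auto
  show ?thesis
    unfolding has_degree_complexity_def deg
  proof (intro conjI allI impI)
    assume "\<forall>m::nat. coeff F 0 \<noteq> 2 / (1 + of_nat m)"
    then have "z p = 0" for p
      using z0 by blast
    then show "\<exists>\<delta>. (\<lambda>p. root p (real (d p))) \<longlonglongrightarrow> \<delta> \<and>
        is_largest_root (\<lambda>x. x ^ 2 - (real n + 1) * x - 1) \<delta>"
      using n init rec by (intro quadratic_growth[of n d I]) simp_all
  next
    fix m :: nat
    assume "coeff F 0 = 2 / (1 + of_nat m)"
    from zm[OF this] show "\<exists>\<delta>. (\<lambda>p. root p (real (d p))) \<longlonglongrightarrow> \<delta> \<and> is_largest_root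
        (\<lambda>x. x ^ (2 * m + 1) * (x ^ 2 - (real n + 1) * x - 1) + x ^ 2 + real n) \<delta>"
      by (intro corner_growth[OF n init rec]) blast+
  qed
qed

end
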